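(* Let $d,n\ge1$ be integers, let $\Omega\subset\mathbb{R}^d$ be a bounded connected open set with $C^2$ boundary, let $d_1,\dots,d_n>0$, and let $F=(f_1,\dots,f_n):\mathbb{R}^n\to\mathbb{R}^n$ be locally Lipschitz continuous. Consider the reaction-diffusion system with homogeneous Dirichlet boundary conditions $$\frac{\partial u_i}{\partial t}-d_i\Delta u_i=f_i(u_1,\dots,u_n)\ \text{ in }\mathbb{R}^+\times\Omega,\qquad u_i=0\ \text{ on }\mathbb{R}^+\times\partial\Omega,\qquad i=1,\dots,n .$$ Assume that whenever the initial vector $U(0)=(u_{0,1},\dots,u_{0,n})\in C_0(\Omega)^n$ satisfies $u_{0,i}(x)\ge0$ for all $x\in\Omega$ and all $i\in\{1,\dots,n\}$, all components of the corresponding maximal solution $U(t,x)$ are non-negative everywhere in $\Omega$ for all $t\in[0,T_{\max})$. Then $$\forall i\in\{1,\dots,n\},\ \forall (u_j)_{j\neq i}\in[0,\infty)^{n-1},\quad f_i(u_1,\dots,u_{i-1},0,u_{i+1},\dots,u_n)\ge 0 .$$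
   Context: $C_0(\Omega)=\{u\in C(\overline\Omega): u=0 \text{ throughout }\partial\Omega\}$ (real-valued, sup norm). $S_i(t)=\exp(td_i\Delta)$ denotes the heat semigroup with homogeneous Dirichlet boundary conditions: it is generated on $L^2(\Omega)$ by $d_i$ times the Dirichlet Laplacian, acts as a contraction semigroup on $C_0(\Omega)$, and is applied to any bounded measurable function. The maximal solution with initial vector $U(0)$ is the maximal (in forward time, on $[0,T_{\max})$, $0<T_{\max}\le\infty$) mild solution, i.e. $U=(u_1,\dots,u_n)\in C([0,T_{\max}),C_0(\Omega)^n)$ with $$u_i(t)=S_i(t)u_i(0)+\int_0^tS_i(t-s)f_i(u_1(s),\dots,u_n(s))\,ds,\qquad t\in[0,T_{\max}),\ i=1,\dots,n .$$ *)

theory Defs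
  imports "HOL-Analysis.Analysis"
begin

primrec Ck :: "nat \<Rightarrow> ('a::euclidean_space \<Rightarrow> real) \<Rightarrow> bool" where
  "Ck 0 f \<longleftrightarrow> continuous_on UNIV f"
| "Ck (Suc k) f \<longleftrightarrow> (\<forall>x. f differentiable (at x)) \<and>
     (\<forall>b\<in>Basis. Ck k (\<lambda>x. frechet_derivative f (at x) b))"

definition grad :: "('a::euclidean_space \<Rightarrow> real) \<Rightarrow> 'a \<Rightarrow> 'a" where
  "grad f x = (\<Sum>b\<in>Basis. frechet_derivative f (at x) b *\<^sub>R b)"

text \<open>Near each boundary point, \<open>\<Omega>\<close> is the part lying strictly above the graph of a
  \<open>C\<^sup>2\<close> function over the hyperplane orthogonal to a unit vector \<open>e\<close>. Only the values of
  \<open>\<gamma>\<close> on that hyperplane matter; every \<open>C\<^sup>2\<close> function on the hyperplane extends to the space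
  by composition with the orthogonal projection.\<close>

definition C2_boundary :: "'a::euclidean_space set \<Rightarrow> bool" where
  "C2_boundary \<Omega> \<longleftrightarrow>
     (\<forall>z\<in>frontier \<Omega>. \<exists>r>0. \<exists>e \<gamma>. norm e = 1 \<and> Ck 2 \<gamma> \<and>
        \<Omega> \<inter> ball z r = {x \<in> ball z r. \<gamma> (x - (x \<bullet> e) *\<^sub>R e) < x \<bullet> e})"

text \<open>Elements of \<open>L\<^sup>2(\<Omega>)\<close> are represented by functions on the whole space; two functions
  represent the same element iff they agree almost everywhere in \<open>\<Omega>\<close>.\<close>

definition L2 :: "'a::euclidean_space set \<Rightarrow> ('a \<Rightarrow> real) set" where
  "L2 \<Omega> = {u. u \<in> borel_measurable (lebesgue_on \<Omega>) \<and>
              integrable (lebesgue_on \<Omega>) (\<lambda>x. (u x)\<^sup>2)}"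

definition L2_inner :: "'a::euclidean_space set \<Rightarrow> ('a \<Rightarrow> real) \<Rightarrow> ('a \<Rightarrow> real) \<Rightarrow> real" where
  "L2_inner \<Omega> u v = (\<integral>x. u x * v x \<partial>lebesgue_on \<Omega>)"

definition L2_norm :: "'a::euclidean_space set \<Rightarrow> ('a \<Rightarrow> real) \<Rightarrow> real" where
  "L2_norm \<Omega> u = sqrt (L2_inner \<Omega> u u)"

definition L2_eq :: "'a::euclidean_space set \<Rightarrow> ('a \<Rightarrow> real) \<Rightarrow> ('a \<Rightarrow> real) \<Rightarrow> bool" where
  "L2_eq \<Omega> u v \<longleftrightarrow> (AE x in lebesgue_on \<Omega>. u x = v x)"

definition test_fun :: "'a::euclidean_space set \<Rightarrow> ('a \<Rightarrow> real) set" where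
  "test_fun \<Omega> = {\<phi>. (\<forall>k. Ck k \<phi>) \<and>
     compact (closure {x. \<phi> x \<noteq> 0}) \<and> closure {x. \<phi> x \<noteq> 0} \<subseteq> \<Omega>}"

text \<open>\<open>H01 \<Omega> u G\<close>: the function \<open>u\<close> belongs to \<open>H\<^sup>1\<^sub>0(\<Omega>)\<close>, the closure of the test functions
  in \<open>H\<^sup>1(\<Omega>)\<close>, and \<open>G\<close> is its weak gradient.\<close>

definition H01 :: "'a::euclidean_space set \<Rightarrow> ('a \<Rightarrow> real) \<Rightarrow> ('a \<Rightarrow> 'a) \<Rightarrow> bool" where
  "H01 \<Omega> u G \<longleftrightarrow> u \<in> L2 \<Omega> \<and> (\<forall>b\<in>Basis. (\<lambda>x. G x \<bullet> b) \<in> L2 \<Omega>) \<and>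
     (\<exists>\<phi>::nat \<Rightarrow> 'a \<Rightarrow> real. (\<forall>k. \<phi> k \<in> test_fun \<Omega>) \<and>
        (\<lambda>k. L2_norm \<Omega> (\<lambda>x. \<phi> k x - u x)) \<longlonglongrightarrow> 0 \<and>
        (\<forall>b\<in>Basis. (\<lambda>k. L2_norm \<Omega> (\<lambda>x. grad (\<phi> k) x \<bullet> b - G x \<bullet> b)) \<longlonglongrightarrow> 0))"

text \<open>Graph of the Dirichlet Laplacian on \<open>L\<^sup>2(\<Omega>)\<close>: \<open>u \<in> H\<^sup>1\<^sub>0(\<Omega>)\<close> and the distributional
  Laplacian of \<open>u\<close> is \<open>w \<in> L\<^sup>2(\<Omega>)\<close>.\<close>

definition dirichlet_laplacian ::
    "'a::euclidean_space set \<Rightarrow> ('a \<Rightarrow> real) \<Rightarrow> ('a \<Rightarrow> real) \<Rightarrow> bool" where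
  "dirichlet_laplacian \<Omega> u w \<longleftrightarrow> w \<in> L2 \<Omega> \<and>
     (\<exists>G. H01 \<Omega> u G \<and>
        (\<forall>\<phi>\<in>test_fun \<Omega>.
           (\<integral>x. G x \<bullet> grad \<phi> x \<partial>lebesgue_on \<Omega>) = - (\<integral>x. w x * \<phi> x \<partial>lebesgue_on \<Omega>)))"

definition L2_C0_semigroup ::
    "'a::euclidean_space set \<Rightarrow> (real \<Rightarrow> ('a \<Rightarrow> real) \<Rightarrow> 'a \<Rightarrow> real) \<Rightarrow> bool" where
  "L2_C0_semigroup \<Omega> S \<longleftrightarrow>
     (\<forall>t\<ge>0. \<forall>u\<in>L2 \<Omega>. S t u \<in> L2 \<Omega>) \<and>
     (\<forall>t\<ge>0. \<forall>u\<in>L2 \<Omega>. \<forall>v\<in>L2 \<Omega>. \<forall>a b.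
        L2_eq \<Omega> (S t (\<lambda>x. a * u x + b * v x)) (\<lambda>x. a * S t u x + b * S t v x)) \<and>
     (\<forall>t\<ge>0. \<exists>C. \<forall>u\<in>L2 \<Omega>. L2_norm \<Omega> (S t u) \<le> C * L2_norm \<Omega> u) \<and>
     (\<forall>u\<in>L2 \<Omega>. L2_eq \<Omega> (S 0 u) u) \<and>
     (\<forall>s\<ge>0. \<forall>t\<ge>0. \<forall>u\<in>L2 \<Omega>. L2_eq \<Omega> (S (s + t) u) (S s (S t u))) \<and>
     (\<forall>u\<in>L2 \<Omega>. ((\<lambda>t. L2_norm \<Omega> (\<lambda>x. S t u x - u x)) \<longlongrightarrow> 0) (at_right 0))"

definition L2_generator ::
    "'a::euclidean_space set \<Rightarrow> (real \<Rightarrow> ('a \<Rightarrow> real) \<Rightarrow> 'a \<Rightarrow> real) \<Rightarrow>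
     ('a \<Rightarrow> real) \<Rightarrow> ('a \<Rightarrow> real) \<Rightarrow> bool" where
  "L2_generator \<Omega> S u w \<longleftrightarrow> u \<in> L2 \<Omega> \<and> w \<in> L2 \<Omega> \<and>
     ((\<lambda>h. L2_norm \<Omega> (\<lambda>x. (S h u x - u x) / h - w x)) \<longlongrightarrow> 0) (at_right 0)"

text \<open>\<open>C\<^sub>0(\<Omega>)\<close>. For bounded open \<open>\<Omega>\<close>, extension by zero identifies the continuous functions on
  \<open>closure \<Omega>\<close> vanishing on the boundary, isometrically for the sup norm, with the bounded
  continuous functions on the whole space below.\<close>

definition C0 :: "'a::euclidean_space set \<Rightarrow> ('a \<Rightarrow>\<^sub>C real) set" where
  "C0 \<Omega> = {u. (\<forall>x\<in>frontier \<Omega>. apply_bcontfun u x = 0) \<and>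
              (\<forall>x. x \<notin> closure \<Omega> \<longrightarrow> apply_bcontfun u x = 0)}"

text \<open>On \<open>C\<^sub>0(\<Omega>)\<close> the semigroup \<open>S\<close> restricts to a strongly continuous semigroup \<open>P\<close> of
  contractions. Linearity and the semigroup law of \<open>P\<close> need not be repeated: they are inherited
  from \<open>S\<close>, since elements of \<open>C\<^sub>0(\<Omega>)\<close> that agree almost everywhere in \<open>\<Omega>\<close> are equal.\<close>

definition acts_as_contractions_on_C0 ::
    "'a::euclidean_space set \<Rightarrow> (real \<Rightarrow> ('a \<Rightarrow> real) \<Rightarrow> 'a \<Rightarrow> real) \<Rightarrow> bool" where
  "acts_as_contractions_on_C0 \<Omega> S \<longleftrightarrow>
     (\<exists>P :: real \<Rightarrow> ('a \<Rightarrow>\<^sub>C real) \<Rightarrow> ('a \<Rightarrow>\<^sub>C real).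
        (\<forall>t\<ge>0. \<forall>g\<in>C0 \<Omega>. P t g \<in> C0 \<Omega> \<and> norm (P t g) \<le> norm g \<and>
           L2_eq \<Omega> (apply_bcontfun (P t g)) (S t (apply_bcontfun g))) \<and>
        (\<forall>g\<in>C0 \<Omega>. ((\<lambda>t. P t g) \<longlongrightarrow> g) (at_right 0)))"

text \<open>\<open>S t = exp (t \<kappa> \<Delta>)\<close> with homogeneous Dirichlet boundary conditions. On a bounded \<open>\<Omega>\<close> the
  bounded measurable functions belong to \<open>L\<^sup>2(\<Omega>)\<close>, so \<open>S t\<close> applies to them.\<close>

definition dirichlet_heat_semigroup ::
    "'a::euclidean_space set \<Rightarrow> real \<Rightarrow> (real \<Rightarrow> ('a \<Rightarrow> real) \<Rightarrow> 'a \<Rightarrow> real) \<Rightarrow> bool" where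
  "dirichlet_heat_semigroup \<Omega> \<kappa> S \<longleftrightarrow>
     L2_C0_semigroup \<Omega> S \<and>
     (\<forall>u w. L2_generator \<Omega> S u (\<lambda>x. \<kappa> * w x) \<longleftrightarrow> dirichlet_laplacian \<Omega> u w) \<and>
     acts_as_contractions_on_C0 \<Omega> S"

text \<open>The integral of an \<open>L\<^sup>2(\<Omega>)\<close>-valued map over \<open>[a, b]\<close>, defined by duality. For the
  norm-continuous integrand in the mild formulation it coincides with the Riemann and the
  Bochner integral in \<open>L\<^sup>2(\<Omega>)\<close>.\<close>

definition has_L2_integral ::
    "'a::euclidean_space set \<Rightarrow> (real \<Rightarrow> 'a \<Rightarrow> real) \<Rightarrow> real \<Rightarrow> real \<Rightarrow> ('a \<Rightarrow> real) \<Rightarrow> bool" where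
  "has_L2_integral \<Omega> g a b w \<longleftrightarrow> (\<forall>s\<in>{a..b}. g s \<in> L2 \<Omega>) \<and> w \<in> L2 \<Omega> \<and>
     (\<forall>\<phi>\<in>L2 \<Omega>. ((\<lambda>s. L2_inner \<Omega> (g s) \<phi>) has_integral L2_inner \<Omega> w \<phi>) {a..b})"

definition at_point :: "('a::euclidean_space \<Rightarrow>\<^sub>C real) ^ 'n \<Rightarrow> 'a \<Rightarrow> real ^ 'n" where
  "at_point V x = (\<chi> i. apply_bcontfun (V $ i) x)"

definition mild_solution ::
    "'a::euclidean_space set \<Rightarrow> ('n::finite \<Rightarrow> real \<Rightarrow> ('a \<Rightarrow> real) \<Rightarrow> 'a \<Rightarrow> real) \<Rightarrow>
     (real ^ 'n \<Rightarrow> real ^ 'n) \<Rightarrow> ereal \<Rightarrow> (real \<Rightarrow> ('a \<Rightarrow>\<^sub>C real) ^ 'n) \<Rightarrow> bool" where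
  "mild_solution \<Omega> S F T U \<longleftrightarrow> 0 < T \<and>
     continuous_on {t. 0 \<le> t \<and> ereal t < T} U \<and>
     (\<forall>t. 0 \<le> t \<and> ereal t < T \<longrightarrow> (\<forall>i. U t $ i \<in> C0 \<Omega> \<and>
        (\<exists>w. has_L2_integral \<Omega> (\<lambda>s. S i (t - s) (\<lambda>x. F (at_point (U s) x) $ i)) 0 t w \<and>
             L2_eq \<Omega> (apply_bcontfun (U t $ i))
                     (\<lambda>x. S i t (apply_bcontfun (U 0 $ i)) x + w x))))"

definition maximal_solution ::
    "'a::euclidean_space set \<Rightarrow> ('n::finite \<Rightarrow> real \<Rightarrow> ('a \<Rightarrow> real) \<Rightarrow> 'a \<Rightarrow> real) \<Rightarrow>
     (real ^ 'n \<Rightarrow> real ^ 'n) \<Rightarrow> ('a \<Rightarrow>\<^sub>C real) ^ 'n \<Rightarrow> ereal \<Rightarrow>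
     (real \<Rightarrow> ('a \<Rightarrow>\<^sub>C real) ^ 'n) \<Rightarrow> bool" where
  "maximal_solution \<Omega> S F U0 T U \<longleftrightarrow> mild_solution \<Omega> S F T U \<and> U 0 = U0 \<and>
     (\<forall>T' U'. mild_solution \<Omega> S F T' U' \<and> T \<le> T' \<and>
        (\<forall>t. 0 \<le> t \<and> ereal t < T \<longrightarrow> U' t = U t) \<longrightarrow> T' = T)"

definition locally_lipschitz :: "(real ^ 'n \<Rightarrow> real ^ 'n) \<Rightarrow> bool" where
  "locally_lipschitz F \<longleftrightarrow> (\<forall>v. \<exists>r>0. \<exists>L. L-lipschitz_on (cball v r) F)"

end

theory Submission imports Defs begin

text \<open>If \<open>f\<^sub>i(v) < 0\<close> with \<open>v\<^sub>i = 0\<close> and \<open>v \<ge> 0\<close>, start from a cutoff of the constant \<open>v\<close>. Testing the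
  mild formulation with the indicator \<open>\<phi>\<close> of a ball on which \<open>U(0) = v\<close> gives
  \<open>\<langle>u\<^sub>i(t), \<phi>\<rangle> = \<integral>\<^sub>0\<^sup>t \<langle>S\<^sub>i(t - s) f\<^sub>i(U(s)), \<phi>\<rangle> ds\<close>, which is negative for small \<open>t > 0\<close>, so positivity fails.

  The work lies in the existence of a maximal solution, without which the hypothesis would be void.
  Since \<open>F(U) - F(0)\<close> vanishes on the boundary, the contraction principle applies in \<open>C\<^sub>0(\<Omega>)\<close> once
  \<open>\<integral>\<^sub>0\<^sup>t S(s) 1 ds \<in> C\<^sub>0(\<Omega>)\<close>, and Zorn's lemma extends the local solution. The functions \<open>g\<close> with
  \<open>\<integral>\<^sub>0\<^sup>t S(s) g ds \<in> C\<^sub>0(\<Omega>)\<close> form a closed subspace containing \<open>C\<^sub>0(\<Omega>)\<close> and \<open>\<Delta>u\<close> for \<open>u\<close> in the domain.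
  If \<open>\<Omega>\<close> is locally \<open>{\<rho> > 0}\<close> with \<open>\<rho>\<close> of class \<open>C\<^sup>2\<close>, then \<open>u = \<zeta> \<rho>\<^sup>2 / 2\<close> with a cutoff \<open>\<zeta>\<close> lies in that domain
  and \<open>\<Delta>u = \<zeta> |\<nabla>\<rho>|\<^sup>2\<close> on the boundary. Uniform approximation and a partition of unity along the
  boundary then yield \<open>g = 1\<close>, so that no elliptic boundary value problem has to be solved.\<close>

text \<open>\<open>S\<close> acts on \<open>L2\<close> representatives, and its link to continuous
  functions is its restriction to \<open>C0 \<Omega>\<close>; no kernel, no smoothing and no point
  values of \<open>S t u\<close> are given. Identities are therefore tested against
  \<open>p \<in> L2 \<Omega>\<close>, and a bound of the form
  \<open>\<bar>ip (ap W) p\<bar> \<le> B * L1 p\<close> is converted back into a sup-norm bound. The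
  obstacle is the constant \<open>F 0\<close>: constants do not vanish on the boundary, so the orbit
  of 1 lies outside the reach of the contractions on \<open>C0 \<Omega>\<close>, and only its time
  integral is brought into that space.

  The square in the auxiliary function has two effects. It removes the second derivatives of
  \<open>rho\<close> from the boundary values of the Laplacian, and it makes the extension by zero
  continuously differentiable, so that membership in H^1_0 follows by lowering \<open>rho\<close> a
  little and mollifying.

  The hypothesis speaks of every maximal solution, so any maximal element supplied by Zorn's lemma
  serves.\<close>

abbreviation (input) ap :: "('a::topological_space \<Rightarrow>\<^sub>C 'b::metric_space) \<Rightarrow> 'a \<Rightarrow> 'b" where
  "ap \<equiv> apply_bcontfun"

section \<open>Functions of class \<open>C\<^sup>k\<close> and mollification\<close>

abbreviation pd :: "'a::euclidean_space \<Rightarrow> ('a \<Rightarrow> real) \<Rightarrow> 'a \<Rightarrow> real" where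
  "pd b f \<equiv> \<lambda>x. frechet_derivative f (at x) b"

lemma frechet_derivative_eq:
  "(f has_derivative f') (at x) \<Longrightarrow> frechet_derivative f (at x) = f'"
  by (metis frechet_derivative_at)

lemma has_derivative_pd:
  "f differentiable at x \<Longrightarrow> (f has_derivative frechet_derivative f (at x)) (at x)"
  by (rule frechet_derivative_works[THEN iffD1])

lemma Ck_Suc_lower: "Ck (Suc k) f \<Longrightarrow> Ck k f"
proof (induction k arbitrary: f)
  case 0
  then show ?case
    by (auto simp: continuous_on_eq_continuous_at differentiable_imp_continuous_within)
next
  case (Suc k)
  then show ?case by (metis Ck.simps(2))
qed

lemma Ck_mono: "Ck m f \<Longrightarrow> k \<le> m \<Longrightarrow> Ck k f"
  by (induction m) (auto simp: le_Suc_eq dest: Ck_Suc_lower simp del: Ck.simps)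

lemma Ck_continuous: "Ck k f \<Longrightarrow> continuous_on S f"
  by (metis Ck.simps(1) Ck_mono le0 continuous_on_subset subset_UNIV)

lemma Ck_differentiable: "Ck (Suc k) f \<Longrightarrow> f differentiable at x"
  by simp

lemma Ck_pd: "Ck (Suc k) f \<Longrightarrow> b \<in> Basis \<Longrightarrow> Ck k (pd b f)"
  by simp

lemma pd_const: "pd b (\<lambda>x. c) = (\<lambda>x. 0)"
  by (simp add: frechet_derivative_const)

lemma pd_bounded_linear: "bounded_linear f \<Longrightarrow> pd b f = (\<lambda>x. f b)"
  by (metis bounded_linear_imp_has_derivative frechet_derivative_eq)

lemma pd_add:
  "f differentiable at x \<Longrightarrow> g differentiable at x \<Longrightarrow>
     pd b (\<lambda>x. f x + g x) x = pd b f x + pd b g x"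
  by (subst frechet_derivative_eq[OF has_derivative_add]) (auto intro: has_derivative_pd)

lemma pd_mult:
  "f differentiable at x \<Longrightarrow> g differentiable at x \<Longrightarrow>
     pd b (\<lambda>x. f x * g x) x = f x * pd b g x + pd b f x * g x"
  by (subst frechet_derivative_eq[OF has_derivative_mult]) (auto intro: has_derivative_pd)

lemma pd_compose_real:
  fixes H :: "real \<Rightarrow> real"
  assumes "(H has_real_derivative H') (at (g x))" "g differentiable at x"
  shows "pd b (\<lambda>x. H (g x)) x = H' * pd b g x"
    and "(\<lambda>x. H (g x)) differentiable at x"
proof -
  have "((\<lambda>x. H (g x)) has_derivative (\<lambda>h. H' * frechet_derivative g (at x) h)) (at x)"
    using has_derivative_compose[OF has_derivative_pd[OF assms(2)], of H "(*) H'"] assms(1)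
    by (simp add: has_field_derivative_def)
  then show "pd b (\<lambda>x. H (g x)) x = H' * pd b g x" "(\<lambda>x. H (g x)) differentiable at x"
    by (auto simp: frechet_derivative_eq differentiable_def)
qed

lemma frechet_derivative_Basis:
  assumes "f differentiable at x"
  shows "frechet_derivative f (at x) h = (\<Sum>b\<in>Basis. (h \<bullet> b) * pd b f x)"
proof -
  have l: "linear (frechet_derivative f (at x))"
    using assms by (rule linear_frechet_derivative)
  show ?thesis
    by (subst euclidean_representation[symmetric, of h])
      (simp add: linear_sum[OF l] linear_cmul[OF l])
qed

lemma pd_eq_0_outside:
  assumes "closed K" "\<And>x. x \<notin> K \<Longrightarrow> f x = 0" "x \<notin> K"
  shows "pd b f x = 0"
proof -
  have "(f has_derivative (\<lambda>h. 0)) (at x)"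
    by (rule has_derivative_transform_within_open[of "\<lambda>x. 0" _ _ _ "- K"])
      (use assms in \<open>auto simp: open_Compl\<close>)
  then show ?thesis by (simp add: frechet_derivative_eq)
qed

lemma Ck_const: "Ck k (\<lambda>x. c)"
  by (induction k arbitrary: c) (auto simp: pd_const)

lemma Ck_bounded_linear: "bounded_linear f \<Longrightarrow> Ck k f"
  by (cases k) (auto simp: linear_continuous_on pd_bounded_linear Ck_const
      bounded_linear_imp_differentiable)

lemma Ck_add: "Ck k f \<Longrightarrow> Ck k g \<Longrightarrow> Ck k (\<lambda>x. f x + g x)"
proof (induction k arbitrary: f g)
  case (Suc k)
  then show ?case by (auto simp: pd_add intro!: differentiable_add Suc.IH)
qed (auto intro: continuous_intros)

lemma Ck_mult: "Ck k f \<Longrightarrow> Ck k g \<Longrightarrow> Ck k (\<lambda>x. f x * g x)"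
proof (induction k arbitrary: f g)
  case (Suc k)
  have "Ck k f" "Ck k g"
    using Suc.prems Ck_Suc_lower by blast+
  moreover have "pd b (\<lambda>x. f x * g x) = (\<lambda>x. f x * pd b g x + pd b f x * g x)" for b
    using Suc.prems by (auto simp: pd_mult)
  ultimately show ?case
    using Suc.prems by (auto intro!: Suc.IH Ck_add)
qed (auto intro: continuous_intros)

lemma Ck_sum: "finite I \<Longrightarrow> (\<And>i. i \<in> I \<Longrightarrow> Ck k (f i)) \<Longrightarrow> Ck k (\<lambda>x. \<Sum>i\<in>I. f i x)"
  by (induction I rule: finite_induct) (auto intro: Ck_add Ck_const)

lemma Ck_diff: "Ck k f \<Longrightarrow> Ck k g \<Longrightarrow> Ck k (\<lambda>x. f x - g x)"
  using Ck_add[of k f "\<lambda>x. (-1) * g x"] Ck_mult[OF Ck_const[of k "-1"], of g] by simp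

lemma Ck_compose_linear:
  assumes "bounded_linear L"
  shows "Ck k f \<Longrightarrow> Ck k (\<lambda>x. f (L x))"
proof (induction k arbitrary: f)
  case 0
  then show ?case
    using assms linear_continuous_on by (auto intro: continuous_on_compose2)
next
  case (Suc k)
  have der: "((\<lambda>x. f (L x)) has_derivative (\<lambda>h. frechet_derivative f (at (L x)) (L h))) (at x)" for x
    using has_derivative_compose[OF bounded_linear_imp_has_derivative[OF assms]
        has_derivative_pd[OF Ck_differentiable[OF Suc.prems]]] .
  have "pd b (\<lambda>x. f (L x)) = (\<lambda>x. \<Sum>c\<in>Basis. (L b \<bullet> c) * pd c f (L x))" for b
    by (rule ext, subst frechet_derivative_eq[OF der])
       (rule frechet_derivative_Basis[OF Ck_differentiable[OF Suc.prems]])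
  moreover have "Ck k (\<lambda>x. \<Sum>c\<in>Basis. (L b \<bullet> c) * pd c f (L x))" for b
    using Suc.prems by (intro Ck_sum Ck_mult Ck_const Suc.IH) auto
  ultimately show ?case
    using der by (auto simp: differentiable_def)
qed

section \<open>Smooth bump functions\<close>

definition flat :: "nat \<Rightarrow> real \<Rightarrow> real" where
  "flat n x = (if x \<le> 0 then 0 else (1 / x) ^ n * exp (- (1 / x)))"

lemma flat_at_0: "((\<lambda>x. flat n x) \<longlongrightarrow> 0) (at 0)"
proof (rule filterlim_split_at)
  show "(flat n \<longlongrightarrow> 0) (at_left 0)"
    by (rule tendsto_eventually) (auto simp: eventually_at_filter flat_def)
  have "((\<lambda>x::real. (1 / x) ^ n * exp (- (1 / x))) \<longlongrightarrow> 0) (at_right 0)"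
    using filterlim_compose[OF tendsto_power_div_exp_0[of n] filterlim_inverse_at_top_right]
    by (simp add: exp_minus field_simps)
  then show "(flat n \<longlongrightarrow> 0) (at_right 0)"
    by (rule Lim_transform_eventually) (auto simp: eventually_at_filter flat_def)
qed

text \<open>The powers of \<open>1 / x\<close> are carried along so that the family is closed under
  differentiation up to linear combinations. Only the glueing point 0 needs a limit.\<close>

lemma flat_has_derivative:
  "(flat n has_real_derivative flat (n + 2) x - real n * flat (n + 1) x) (at x)"
proof -
  consider "x < 0" | "x = 0" | "x > 0" by linarith
  then show ?thesis
  proof cases
    case 1
    have "(flat n has_real_derivative 0) (at x)"
      by (rule has_field_derivative_transform_within_open[of "\<lambda>x. 0" _ _ "{..<0}"])
         (use 1 in \<open>auto simp: flat_def\<close>)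
    with 1 show ?thesis by (simp add: flat_def)
  next
    case 2
    \<comment> \<open>The difference quotient of \<open>flat n\<close> at 0 is exactly
      \<open>flat (n + 1)\<close>.\<close>
    have "((\<lambda>h. (flat n (0 + h) - flat n 0) / h) \<longlongrightarrow> 0) (at 0)"
      by (rule Lim_transform_eventually[OF flat_at_0[of "n+1"]])
         (auto simp: eventually_at_filter flat_def field_simps)
    with 2 show ?thesis by (simp add: flat_def DERIV_def)
  next
    case 3
    have d: "((\<lambda>x. 1 / x) has_real_derivative - ((1 / x)\<^sup>2)) (at x)"
      using 3 by (auto intro!: derivative_eq_intros simp: power2_eq_square)
    have "((\<lambda>x. (1 / x) ^ n * exp (- (1 / x))) has_real_derivative
        real n * (- ((1 / x)\<^sup>2) * (1 / x) ^ (n - Suc 0)) * exp (- (1 / x)) +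
        exp (- (1 / x)) * (1 / x)\<^sup>2 * (1 / x) ^ n) (at x)"
      using DERIV_mult[OF DERIV_power[OF d, of n] DERIV_chain2[OF DERIV_exp DERIV_minus[OF d]]] by simp
    moreover have "real n * (- (y\<^sup>2) * y ^ (n - Suc 0)) * e + e * y\<^sup>2 * y ^ n
        = y ^ (n + 2) * e - real n * (y ^ (n + 1) * e)" for y e :: real
      by (cases n) (auto simp: power2_eq_square algebra_simps)
    ultimately have "((\<lambda>x. (1 / x) ^ n * exp (- (1 / x))) has_real_derivative
        flat (n + 2) x - real n * flat (n + 1) x) (at x)"
      using 3 by (simp only: flat_def not_le[symmetric] if_False)
    then show ?thesis
      by (rule has_field_derivative_transform_within_open[of _ _ _ "{0<..}"])
         (use 3 in \<open>auto simp: flat_def\<close>)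
  qed
qed

text \<open>Induction on \<open>k\<close> with \<open>n\<close> arbitrary, since each derivative
  raises the index. The derivatives of \<open>g\<close> enter through the chain rule, whence the
  assumption on \<open>g\<close> for every order.\<close>

lemma Ck_flat:
  assumes "\<And>k. Ck k g"
  shows "Ck k (\<lambda>x. flat n (g x))"
proof (induction k arbitrary: n)
  case 0
  have "continuous_on UNIV (flat n)"
    using flat_has_derivative DERIV_isCont by (metis continuous_at_imp_continuous_on)
  then show ?case
    using assms[of 0] by (auto intro: continuous_on_compose2)
next
  case (Suc k)
  have d: "g differentiable at x" for x
    using assms[of "Suc 0"] by simp
  have "pd b (\<lambda>x. flat n (g x)) = (\<lambda>x. (flat (n+2) (g x) - real n * flat (n+1) (g x)) * pd b g x)" for b
    by (rule ext, rule pd_compose_real(1)[OF flat_has_derivative d])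
  moreover have "Ck k (\<lambda>x. (flat (n+2) (g x) - real n * flat (n+1) (g x)) * pd b g x)"
    if "b \<in> Basis" for b
    using assms[of "Suc k"] that by (intro Ck_mult Ck_diff Ck_const Suc.IH) auto
  ultimately show ?case
    using pd_compose_real(2)[OF flat_has_derivative d] by simp
qed

text \<open>The argument of \<open>flat 0\<close> is a polynomial in the coordinates, hence smooth
  at the origin too, where the norm is not. The function is even and, for \<open>h > 0\<close>,
  positive exactly on the open ball of radius \<open>h\<close>; it is normalised where it serves as
  a mollifier.\<close>

definition bump :: "real \<Rightarrow> 'a::euclidean_space \<Rightarrow> real" where
  "bump h x = flat 0 (h\<^sup>2 - x \<bullet> x)"

lemma Ck_inner: "Ck k (\<lambda>x::'a::euclidean_space. x \<bullet> c)"
  by (intro Ck_bounded_linear bounded_linear_inner_left)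

lemma Ck_bump: "Ck k (bump h :: 'a::euclidean_space \<Rightarrow> real)"
proof -
  have "(\<lambda>x::'a. x \<bullet> x) = (\<lambda>x. \<Sum>b\<in>Basis. (x \<bullet> b) * (x \<bullet> b))"
    by (subst euclidean_inner) simp
  then have "Ck k (\<lambda>x::'a. x \<bullet> x)" for k
    by (simp add: Ck_sum Ck_mult Ck_inner)
  then have "Ck k (\<lambda>x::'a. h\<^sup>2 - x \<bullet> x)" for k
    by (intro Ck_diff Ck_const)
  from Ck_flat[OF this, where n = 0] show ?thesis
    by (simp add: bump_def[abs_def])
qed

lemma bump_nonneg: "bump h x \<ge> 0"
  by (simp add: bump_def flat_def)

lemma bump_pos_iff: "h > 0 \<Longrightarrow> bump h x > 0 \<longleftrightarrow> norm x < h"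
  by (auto simp: bump_def flat_def dot_square_norm abs_le_square_iff[symmetric] not_le
      power2_less_imp_less intro: power_strict_mono)

lemma bump_eq_0: "h > 0 \<Longrightarrow> norm x \<ge> h \<Longrightarrow> bump h x = 0"
  using bump_pos_iff[of h x] bump_nonneg[of h x] by linarith

lemma bump_minus: "bump h (x - y) = bump h (y - x)"
  by (simp add: bump_def algebra_simps inner_commute)

section \<open>Integration by parts and convolution on the whole space\<close>

lemma has_integral_UNIV_cbox:
  fixes f :: "'a::euclidean_space \<Rightarrow> real"
  assumes "continuous_on UNIV f" "\<And>x. x \<notin> cbox a c \<Longrightarrow> f x = 0"
  shows "(f has_integral integral (cbox a c) f) UNIV"
proof -
  have "f integrable_on cbox a c"
    using assms(1) by (intro integrable_continuous) (auto intro: continuous_on_subset)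
  then show ?thesis
    using assms(2) by (intro has_integral_on_superset[OF integrable_integral, of _ "cbox a c"]) auto
qed

lemma integral_UNIV_cbox:
  fixes f :: "'a::euclidean_space \<Rightarrow> real"
  assumes "continuous_on UNIV f" "\<And>x. x \<notin> cbox a c \<Longrightarrow> f x = 0"
  shows "integral UNIV f = integral (cbox a c) f" "f integrable_on UNIV"
  using has_integral_UNIV_cbox[OF assms] by (auto simp: integral_unique has_integral_integrable)

lemma has_integral_translation:
  fixes f :: "'a::euclidean_space \<Rightarrow> real"
  assumes "continuous_on UNIV f" "\<And>x. x \<notin> cbox a c \<Longrightarrow> f x = 0"
  shows "((\<lambda>x. f (x + v)) has_integral integral UNIV f) UNIV"
proof (rule has_integral_on_superset)
  have "f integrable_on cbox a c"
    using assms(1) by (intro integrable_continuous) (auto intro: continuous_on_subset)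
  then show "((\<lambda>x. f (x + v)) has_integral integral UNIV f) (cbox (a - v) (c - v))"
    using has_integral_shift_cbox[OF integrable_integral] integral_UNIV_cbox(1)[OF assms] by metis
  show "f (x + v) = 0" if "x \<notin> cbox (a - v) (c - v)" for x
    using that by (intro assms(2)) (auto simp: mem_box algebra_simps)
qed simp

text \<open>The integral of \<open>f\<close> does not change when \<open>f\<close> is translated
  along \<open>b\<close>; differentiating under the integral sign at translation 0 gives the claim.
  Integration by parts is obtained from it by inserting products in which one factor has compact
  support.\<close>

lemma integral_pd_eq_0:
  fixes f :: "'a::euclidean_space \<Rightarrow> real"
  assumes f: "Ck (Suc 0) f" and K: "bounded K" "\<And>x. x \<notin> K \<Longrightarrow> f x = 0" and b: "b \<in> Basis"
  shows "(pd b f has_integral 0) UNIV"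
proof -
  \<comment> \<open>Room of width 1 around \<open>K\<close>: translations by \<open>t\<close> with
    \<open>\<bar>t\<bar> \<le> 1\<close> then keep the support inside one box, so that the Leibniz
    rule can be applied on a fixed domain.\<close>
  have "bounded (\<Union>x\<in>K. cball x 1)"
  proof -
    from K(1) obtain B where B: "\<And>x. x \<in> K \<Longrightarrow> norm x \<le> B"
      by (auto simp: bounded_iff)
    show ?thesis
      unfolding bounded_iff
    proof (intro exI ballI)
      fix y assume "y \<in> (\<Union>x\<in>K. cball x 1)"
      then obtain x where "x \<in> K" "dist x y \<le> 1" by auto
      then show "norm y \<le> B + 1"
        using B[of x] norm_triangle_ineq2[of y x] by (simp add: dist_norm norm_minus_commute)
    qed
  qed
  then obtain a where a: "(\<Union>x\<in>K. cball x 1) \<subseteq> cbox (-a) a"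
    using bounded_subset_cbox_symmetric by blast
  have f0: "f (x + t *\<^sub>R b) = 0" if "x \<notin> cbox (-a) a" "\<bar>t\<bar> \<le> 1" for x t
  proof (rule K(2))
    have "dist (x + t *\<^sub>R b) x \<le> 1"
      using that b by (simp add: dist_norm)
    then show "x + t *\<^sub>R b \<notin> K" using a that by (metis UN_I mem_cball subsetD)
  qed
  have c: "continuous_on S f" "continuous_on S (pd b f)" for S
    using f b Ck_continuous Ck_pd by blast+
  have const: "integral (cbox (-a) a) (\<lambda>x. f (x + t *\<^sub>R b)) = integral UNIV f" if "\<bar>t\<bar> \<le> 1" for t
  proof -
    have "integral (cbox (-a) a) (\<lambda>x. f (x + t *\<^sub>R b)) = integral UNIV (\<lambda>x. f (x + t *\<^sub>R b))"
      using f0[OF _ that]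
      by (intro integral_UNIV_cbox(1)[symmetric])
         (auto intro!: continuous_on_compose2[OF c(1)[of UNIV]] continuous_intros)
    also have "\<dots> = integral UNIV f"
      using f0[of _ 0] by (intro integral_unique has_integral_translation c) auto
    finally show ?thesis .
  qed
  have d1: "((\<lambda>t. f (x + t *\<^sub>R b)) has_field_derivative pd b f (x + t *\<^sub>R b)) (at t within U)" for x t U
  proof -
    have df: "(f has_derivative frechet_derivative f (at (x + t *\<^sub>R b))) (at (x + t *\<^sub>R b))"
      by (intro has_derivative_pd Ck_differentiable[OF f])
    have "((\<lambda>t. f (x + t *\<^sub>R b)) has_derivative (\<lambda>h. frechet_derivative f (at (x + t *\<^sub>R b)) (h *\<^sub>R b)))
        (at t within U)"
      by (rule has_derivative_compose[where f = "\<lambda>t. x + t *\<^sub>R b", OF _ df]) (auto intro!: derivative_eq_intros)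
    moreover have "frechet_derivative f (at (x + t *\<^sub>R b)) (h *\<^sub>R b) = pd b f (x + t *\<^sub>R b) * h" for h
      using linear_frechet_derivative[OF Ck_differentiable[OF f]] by (simp add: linear_cmul)
    ultimately show ?thesis by (simp add: has_field_derivative_def)
  qed
  have "((\<lambda>t. integral (cbox (-a) a) (\<lambda>x. f (x + t *\<^sub>R b))) has_field_derivative
      integral (cbox (-a) a) (\<lambda>x. pd b f (x + 0 *\<^sub>R b))) (at 0 within {-1..1::real})"
    by (rule leibniz_rule_field_derivative[OF d1])
       (auto intro!: integrable_continuous continuous_on_compose2[OF c(1)[of UNIV]]
          continuous_on_compose2[OF c(2)[of UNIV]] continuous_intros simp: split_beta)
  moreover have "((\<lambda>t. integral (cbox (-a) a) (\<lambda>x. f (x + t *\<^sub>R b))) has_field_derivative 0)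
      (at 0 within {-1..1::real})"
    by (rule has_field_derivative_transform_within[of "\<lambda>t. integral UNIV f" _ _ _ 1])
       (auto simp: const)
  ultimately have "integral (cbox (-a) a) (pd b f) = 0"
    using at_within_interior[of 0 "{-1..1::real}"] DERIV_unique by fastforce
  moreover have "(pd b f has_integral integral (cbox (-a) a) (pd b f)) UNIV"
  proof (rule has_integral_UNIV_cbox[OF c(2)])
    fix x assume "x \<notin> cbox (-a) a"
    then show "pd b f x = 0"
      using f0[of _ 0] by (intro pd_eq_0_outside[of "cbox (-a) a"]) auto
  qed
  ultimately show ?thesis by simp
qed

text \<open>All differentiation falls on \<open>\<eta>\<close>, so continuity of \<open>u\<close>
  suffices. The domain of integration is a fixed box, and the derivative of the integrand is
  packaged as a bounded linear function \<open>fx\<close>, as the Leibniz rule requires.\<close>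

lemma has_derivative_convolution:
  fixes u :: "'a::euclidean_space \<Rightarrow> real"
  assumes \<eta>: "Ck (Suc 0) \<eta>" and u: "continuous_on UNIV u"
  shows "((\<lambda>x. integral (cbox a c) (\<lambda>y. \<eta> (x - y) * u y)) has_derivative
      (\<lambda>h. \<Sum>b\<in>Basis. (h \<bullet> b) * integral (cbox a c) (\<lambda>y. pd b \<eta> (x - y) * u y))) (at x)"
proof -
  define fx where "fx x y = (\<Sum>b\<in>Basis. (pd b \<eta> (x - y) * u y) *\<^sub>R blinfun_inner_left b)" for x y
  have c: "continuous_on UNIV \<eta>" "\<And>b. b \<in> Basis \<Longrightarrow> continuous_on UNIV (pd b \<eta>)"
    using \<eta> Ck_continuous Ck_pd by blast+
  have fxc: "continuous_on (S \<times> T) (\<lambda>(x, y). fx x y)" for S T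
    unfolding fx_def split_beta
    by (intro continuous_intros continuous_on_compose2[OF c(2)] continuous_on_compose2[OF u]) auto
  have *: "fx x integrable_on cbox a c" for x
  proof (rule integrable_continuous)
    have "continuous_on (cbox a c) (Pair x)"
      by (intro continuous_intros)
    then show "continuous_on (cbox a c) (fx x)"
      using continuous_on_compose2[OF fxc[of UNIV UNIV], of "cbox a c" "Pair x"] by simp
  qed
  have "((\<lambda>x. integral (cbox a c) (\<lambda>y. \<eta> (x - y) * u y)) has_derivative
     blinfun_apply (integral (cbox a c) (fx x))) (at x within UNIV)"
  proof (rule leibniz_rule)
    fix x t
    have "((\<lambda>x. \<eta> (x - t) * u t) has_derivative (\<lambda>h. frechet_derivative \<eta> (at (x - t)) h * u t)) (at x within UNIV)"
      by (intro has_derivative_mult_left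
          has_derivative_compose[OF _ has_derivative_pd[OF Ck_differentiable[OF \<eta>]], of "\<lambda>x. x - t" "\<lambda>h. h"])
        (auto intro!: derivative_eq_intros)
    moreover have "(\<lambda>h. frechet_derivative \<eta> (at (x - t)) h * u t) = blinfun_apply (fx x t)"
      unfolding fx_def by (rule ext, subst frechet_derivative_Basis[OF Ck_differentiable[OF \<eta>]])
        (simp add: blinfun.bilinear_simps sum_distrib_left sum_distrib_right mult_ac)
    ultimately show "((\<lambda>x. \<eta> (x - t) * u t) has_derivative blinfun_apply (fx x t)) (at x within UNIV)"
      by simp
  next
    fix x show "(\<lambda>y. \<eta> (x - y) * u y) integrable_on cbox a c"
      by (intro integrable_continuous continuous_intros continuous_on_compose2[OF c(1)]
          continuous_on_compose2[OF u]) auto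
  qed (auto intro: fxc)
  moreover have "blinfun_apply (integral (cbox a c) (fx x)) =
     (\<lambda>h. \<Sum>b\<in>Basis. (h \<bullet> b) * integral (cbox a c) (\<lambda>y. pd b \<eta> (x - y) * u y))"
  proof
    fix h
    have i: "(\<lambda>y. pd b \<eta> (x - y) * u y) integrable_on cbox a c" if "b \<in> Basis" for b
      by (intro integrable_continuous continuous_intros continuous_on_compose2[OF c(2)]
          continuous_on_compose2[OF u]) (use that in auto)
    have "blinfun_apply (integral (cbox a c) (fx x)) h = integral (cbox a c) (\<lambda>y. fx x y h)"
      by (rule blinfun_apply_integral[OF *])
    also have "\<dots> = integral (cbox a c) (\<lambda>y. \<Sum>b\<in>Basis. (h \<bullet> b) * (pd b \<eta> (x - y) * u y))"
      by (simp add: fx_def blinfun.bilinear_simps mult_ac)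
    also have "\<dots> = (\<Sum>b\<in>Basis. integral (cbox a c) (\<lambda>y. (h \<bullet> b) * (pd b \<eta> (x - y) * u y)))"
      by (rule integral_sum) (auto intro!: integrable_on_mult_right i)
    finally show "blinfun_apply (integral (cbox a c) (fx x)) h =
      (\<Sum>b\<in>Basis. (h \<bullet> b) * integral (cbox a c) (\<lambda>y. pd b \<eta> (x - y) * u y))"
      by simp
  qed
  ultimately show ?thesis by simp
qed

lemma pd_convolution:
  fixes u :: "'a::euclidean_space \<Rightarrow> real"
  assumes "Ck (Suc 0) \<eta>" "continuous_on UNIV u" "b \<in> Basis"
  shows "pd b (\<lambda>x. integral (cbox a c) (\<lambda>y. \<eta> (x - y) * u y)) =
     (\<lambda>x. integral (cbox a c) (\<lambda>y. pd b \<eta> (x - y) * u y))"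
  by (rule ext, subst frechet_derivative_eq[OF has_derivative_convolution[OF assms(1,2)]])
     (use assms(3) in \<open>simp add: inner_Basis if_distrib[of "\<lambda>x. x * _"] cong: if_cong\<close>)

lemma Ck_convolution:
  fixes u :: "'a::euclidean_space \<Rightarrow> real"
  assumes "\<And>k. Ck k \<eta>" "continuous_on UNIV u"
  shows "Ck k (\<lambda>x. integral (cbox a c) (\<lambda>y. \<eta> (x - y) * u y))"
  using assms(1)
proof (induction k arbitrary: \<eta>)
  case 0
  show ?case
    using has_derivative_continuous[OF has_derivative_convolution[OF 0 assms(2)]]
    by (simp add: continuous_on_eq_continuous_at)
next
  case (Suc k)
  have "Ck k (pd b \<eta>)" if "b \<in> Basis" for b k
    using Suc.prems[of "Suc k"] that by simp
  then have "Ck k (\<lambda>x. integral (cbox a c) (\<lambda>y. pd b \<eta> (x - y) * u y))" if "b \<in> Basis" for b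
    using that by (intro Suc.IH)
  moreover have "(\<lambda>x. integral (cbox a c) (\<lambda>y. \<eta> (x - y) * u y)) differentiable at x" for x
    using has_derivative_convolution[OF Suc.prems assms(2)] differentiableI by blast
  ultimately show ?case
    by (simp add: pd_convolution[OF Suc.prems assms(2)])
qed

text \<open>A weighted mean of \<open>u\<close> over the ball of radius \<open>h\<close> around
  \<open>x\<close> differs from \<open>u x\<close> by at most the oscillation there. The box
  contains the support of \<open>u\<close>, so the box integral is the full convolution.\<close>

lemma convolution_approx:
  fixes u :: "'a::euclidean_space \<Rightarrow> real"
  assumes \<eta>: "continuous_on UNIV \<eta>" "\<And>x. \<eta> x \<ge> 0" "\<And>x. norm x \<ge> h \<Longrightarrow> \<eta> x = 0"
    "\<And>x y. \<eta> (x - y) = \<eta> (y - x)" "integral UNIV \<eta> = 1"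
    and u: "continuous_on UNIV u" "\<And>x. x \<notin> cbox a c \<Longrightarrow> u x = 0"
    and e: "\<And>y. norm (x - y) < h \<Longrightarrow> \<bar>u y - u x\<bar> \<le> e"
  shows "\<bar>integral (cbox a c) (\<lambda>y. \<eta> (x - y) * u y) - u x\<bar> \<le> e"
proof -
  obtain r :: 'a where r: "ball 0 h \<subseteq> cbox (-r) r"
    using bounded_subset_cbox_symmetric bounded_ball by blast
  have \<eta>0: "\<eta> y = 0" if "y \<notin> cbox (-r) r" for y
    using r that \<eta>(3)[of y] by (meson mem_ball_0 not_less subsetD)
  have "((\<lambda>y. \<eta> (y + (- x))) has_integral 1) UNIV"
    using has_integral_translation[OF \<eta>(1), of "-r" r, OF \<eta>0, of "- x"] \<eta>(5) by simp
  then have i1: "((\<lambda>y. \<eta> (x - y)) has_integral 1) UNIV"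
    using \<eta>(4) by simp
  have i2: "((\<lambda>y. \<eta> (x - y) * u y) has_integral integral (cbox a c) (\<lambda>y. \<eta> (x - y) * u y)) UNIV"
    by (rule has_integral_UNIV_cbox)
      (auto intro!: continuous_intros continuous_on_compose2[OF \<eta>(1)] u)
  have i3: "((\<lambda>y. \<eta> (x - y) * u y - \<eta> (x - y) * u x) has_integral
      integral (cbox a c) (\<lambda>y. \<eta> (x - y) * u y) - 1 * u x) UNIV"
    by (intro has_integral_diff has_integral_mult_left i1 i2)
  moreover have i4: "((\<lambda>y. \<eta> (x - y) * e) has_integral 1 * e) UNIV"
    by (intro has_integral_mult_left i1)
  moreover have "norm (\<eta> (x - y) * u y - \<eta> (x - y) * u x) \<le> \<eta> (x - y) * e" for y
  proof (cases "norm (x - y) < h")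
    case True
    have "norm (\<eta> (x - y) * u y - \<eta> (x - y) * u x) = \<eta> (x - y) * \<bar>u y - u x\<bar>"
      using \<eta>(2) by (simp add: abs_mult flip: right_diff_distrib)
    then show ?thesis using e[OF True] \<eta>(2) by (simp add: mult_left_mono)
  qed (use \<eta>(3) in auto)
  ultimately have "norm (integral UNIV (\<lambda>y. \<eta> (x - y) * u y - \<eta> (x - y) * u x))
      \<le> integral UNIV (\<lambda>y. \<eta> (x - y) * e)"
    by (intro integral_norm_bound_integral) (auto dest: has_integral_integrable)
  then show ?thesis
    using integral_unique[OF i3] integral_unique[OF i1] by simp
qed

lemma uniformly_continuous_compact_support:
  fixes u :: "'a::euclidean_space \<Rightarrow> real"
  assumes "continuous_on UNIV u" "bounded K" "\<And>x. x \<notin> K \<Longrightarrow> u x = 0" "e > 0"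
  shows "\<exists>d>0. \<forall>x y. norm (x - y) < d \<longrightarrow> \<bar>u y - u x\<bar> < e"
proof -
  obtain B where B: "\<And>x. x \<in> K \<Longrightarrow> norm x \<le> B"
    using assms(2) by (auto simp: bounded_iff)
  \<comment> \<open>The margin 1, together with the restriction to distances below 1, ensures that a
    pair with one point outside this ball has both points off \<open>K\<close>, where
    \<open>u\<close> is 0.\<close>
  have "uniformly_continuous_on (cball 0 (B + 1)) u"
    by (intro compact_uniformly_continuous continuous_on_subset[OF assms(1)]) auto
  then obtain d where d: "d > 0"
      "\<And>x y. x \<in> cball 0 (B + 1) \<Longrightarrow> y \<in> cball 0 (B + 1) \<Longrightarrow> dist y x < d \<Longrightarrow> dist (u y) (u x) < e"
    using assms(4) uniformly_continuous_onE by metis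
  show ?thesis
  proof (intro exI[of _ "min d 1"] conjI allI impI)
    fix x y :: 'a assume xy: "norm (x - y) < min d 1"
    show "\<bar>u y - u x\<bar> < e"
    proof (cases "norm x \<le> B + 1 \<and> norm y \<le> B + 1")
      case False
      then have "x \<notin> K \<and> y \<notin> K"
        using B[of x] B[of y] xy norm_triangle_ineq2[of x y] norm_triangle_ineq2[of y x]
        by (auto simp: norm_minus_commute)
      then show ?thesis using assms(3,4) by simp
    qed (use d(2)[of x y] xy in \<open>auto simp: dist_norm norm_minus_commute\<close>)
  qed (use d in auto)
qed

lemma Ck_translate:
  fixes f :: "'a::euclidean_space \<Rightarrow> real"
  shows "Ck k f \<Longrightarrow> Ck k (\<lambda>x. f (x - c))"
proof (induction k arbitrary: f)
  case 0
  then show ?case by (auto intro!: continuous_on_compose2[of UNIV f] continuous_intros)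
next
  case (Suc k)
  have d: "((\<lambda>x. f (x - c)) has_derivative frechet_derivative f (at (x - c))) (at x)" for x
    by (rule has_derivative_compose[where f = "\<lambda>x. x - c",
          OF _ has_derivative_pd[OF Ck_differentiable[OF Suc.prems]]])
      (auto intro!: derivative_eq_intros)
  have "pd b (\<lambda>x. f (x - c)) = (\<lambda>x. pd b f (x - c))" for b
    by (rule ext, subst frechet_derivative_eq[OF d]) simp
  moreover have "(\<lambda>x. f (x - c)) differentiable at x" for x
    using d by (rule differentiableI)
  moreover have "Ck k (\<lambda>x. pd b f (x - c))" if "b \<in> Basis" for b
    by (rule Suc.IH[OF Ck_pd[OF Suc.prems that]])
  ultimately show ?case by simp
qed

text \<open>The estimate for the derivatives is conditional because the lemma serves two purposes:
  uniform approximation of a merely continuous function, and simultaneous approximation of a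
  \<open>C^1\<close> function and its gradient. The approximant is a mollification in both
  cases.\<close>

lemma test_fun_approx:
  fixes u :: "'a::euclidean_space \<Rightarrow> real"
  assumes K: "compact K" "K \<subseteq> V" "open V" and u: "continuous_on UNIV u" "\<And>x. x \<notin> K \<Longrightarrow> u x = 0"
    and e: "e > 0"
  obtains \<phi> where "\<phi> \<in> test_fun V" "\<And>x. \<bar>\<phi> x - u x\<bar> \<le> e"
    "\<And>b x. Ck (Suc 0) u \<Longrightarrow> b \<in> Basis \<Longrightarrow> \<bar>pd b \<phi> x - pd b u x\<bar> \<le> e"
proof -
  obtain h0 where h0: "h0 > 0" "(\<Union>x\<in>K. cball x h0) \<subseteq> V"
    using compact_subset_open_imp_cball_epsilon_subset[OF K(1,3,2)] by blast
  obtain h1 where h1: "h1 > 0" "\<And>x y. norm (x - y) < h1 \<Longrightarrow> \<bar>u y - u x\<bar> < e"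
    using uniformly_continuous_compact_support[OF u(1) compact_imp_bounded[OF K(1)] u(2) e] by blast
  have pdu0: "pd b u x = 0" if "x \<notin> K" for b x
    by (rule pd_eq_0_outside[OF compact_imp_closed[OF K(1)] u(2) that])
  have "\<exists>d>0. Ck (Suc 0) u \<longrightarrow> (\<forall>b\<in>Basis. \<forall>x y. norm (x - y) < d \<longrightarrow> \<bar>pd b u y - pd b u x\<bar> < e)"
  proof (cases "Ck (Suc 0) u")
    case True
    have "\<exists>d>0. \<forall>x y. norm (x - y) < d \<longrightarrow> \<bar>pd b u y - pd b u x\<bar> < e" if "b \<in> Basis" for b
      by (rule uniformly_continuous_compact_support[OF _ compact_imp_bounded[OF K(1)] pdu0 e])
         (use True that in auto)
    then obtain d where d: "\<And>b. b \<in> Basis \<Longrightarrow> d b > 0 \<and> (\<forall>x y. norm (x - y) < d b \<longrightarrow> \<bar>pd b u y - pd b u x\<bar> < e)"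
      by metis
    show ?thesis
      by (intro exI[of _ "Min (d ` Basis)"]) (use d in auto)
  qed (auto intro: exI[of _ 1])
  then obtain h2 where h2: "h2 > 0"
    "\<And>b x y. Ck (Suc 0) u \<Longrightarrow> b \<in> Basis \<Longrightarrow> norm (x - y) < h2 \<Longrightarrow> \<bar>pd b u y - pd b u x\<bar> < e"
    by blast
  \<comment> \<open>\<open>h0\<close> keeps the support inside \<open>V\<close>; \<open>h1\<close>
    and \<open>h2\<close> control the oscillation of \<open>u\<close> and of its first
    derivatives.\<close>
  define h where "h = min h0 (min h1 h2)"
  have h: "h > 0" "h \<le> h0" "h \<le> h1" "h \<le> h2" using h0 h1 h2 by (auto simp: h_def)
  obtain r :: 'a where r: "cball 0 h \<subseteq> cbox (-r) r"
    using bounded_subset_cbox_symmetric bounded_cball by blast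
  obtain a where a: "K \<subseteq> cbox (-a) a"
    using bounded_subset_cbox_symmetric compact_imp_bounded[OF K(1)] by blast
  define I where "I = integral UNIV (bump h :: 'a \<Rightarrow> real)"
  have bc: "continuous_on S (bump h :: 'a \<Rightarrow> real)" for S
    by (rule Ck_continuous[OF Ck_bump])
  have b0: "bump h x = 0" if "x \<notin> cbox (-r) r" for x :: 'a
    using that r h(1) by (intro bump_eq_0) (auto simp: subset_iff intro: linorder_le_cases[of h "norm x"])
  have bi: "(bump h has_integral I) (cbox (-r) r)" "((bump h :: 'a \<Rightarrow> real) has_integral I) UNIV"
    using has_integral_UNIV_cbox[OF bc, of "-r" r, OF b0] integral_UNIV_cbox(1)[OF bc, of "-r" r, OF b0]
      integrable_integral[OF integrable_continuous[OF bc]]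
    by (simp_all add: I_def)
  have "I \<ge> 0" using bi(2) by (rule has_integral_nonneg) (simp add: bump_nonneg)
  moreover have "I \<noteq> 0"
  proof
    assume "I = 0"
    moreover have "ball 0 h \<subseteq> interior (cbox (-r) r)"
      using r by (intro interior_maximal) (auto simp: subset_iff)
    then have "box (-r) r \<noteq> {}" using h(1) by (metis ball_eq_empty interior_cbox not_less subset_empty)
    moreover have "0 \<in> cbox (-r) r" using r h(1) by auto
    ultimately have "bump h (0::'a) = 0"
      using has_integral_0_cbox_imp_0[OF bc, of "-r" r] bi(1) bump_nonneg by metis
    then show False using bump_pos_iff[OF h(1), of "0::'a"] h(1) by simp
  qed
  ultimately have I: "I > 0" by simp
  define \<eta> :: "'a \<Rightarrow> real" where "\<eta> x = bump h x * (1 / I)" for x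
  have \<eta>: "continuous_on UNIV \<eta>" "\<And>x. \<eta> x \<ge> 0" "\<And>x. norm x \<ge> h \<Longrightarrow> \<eta> x = 0"
    "\<And>x y. \<eta> (x - y) = \<eta> (y - x)" 
    using I h bump_minus[of h] by (auto simp: \<eta>_def bump_nonneg bump_eq_0 intro!: continuous_intros bc)
  have "(\<eta> has_integral I * (1 / I)) UNIV"
    unfolding \<eta>_def by (rule has_integral_mult_left[OF bi(2)])
  then have \<eta>5: "integral UNIV \<eta> = 1" using I by (simp add: integral_unique)
  have \<eta>k: "Ck k \<eta>" for k
    unfolding \<eta>_def by (intro Ck_mult Ck_bump Ck_const)
  define \<phi> where "\<phi> x = integral (cbox (-a) a) (\<lambda>y. \<eta> (x - y) * u y)" for x
  have \<phi>k: "Ck k \<phi>" for k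
    unfolding \<phi>_def by (rule Ck_convolution[OF \<eta>k u(1)])
  have supp: "{x. \<phi> x \<noteq> 0} \<subseteq> (\<Union>x\<in>K. cball x h)"
  proof
    fix x assume "x \<in> {x. \<phi> x \<noteq> 0}"
    then have "(\<lambda>y. \<eta> (x - y) * u y) \<noteq> (\<lambda>y. 0)"
      unfolding \<phi>_def by (metis (mono_tags, lifting) integral_0 mem_Collect_eq)
    then have "\<not> (\<forall>y. \<eta> (x - y) * u y = 0)" by blast
    then obtain y where "\<eta> (x - y) * u y \<noteq> 0" by blast
    then have "y \<in> K" "norm (x - y) < h" using u(2) \<eta>(3) by (auto simp: not_le[symmetric])
    then show "x \<in> (\<Union>x\<in>K. cball x h)" by (auto simp: dist_norm norm_minus_commute intro!: bexI[of _ y])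
  qed
  have "compact {x + y | x y. x \<in> K \<and> y \<in> cball 0 h}"
    by (intro compact_sums K compact_cball)
  also have "{x + y | x y. x \<in> K \<and> y \<in> cball 0 h} = (\<Union>x\<in>K. cball x h)"
  proof (intro equalityI subsetI)
    fix z assume "z \<in> (\<Union>x\<in>K. cball x h)"
    then obtain x where "x \<in> K" "norm (z - x) \<le> h" by (auto simp: dist_norm norm_minus_commute)
    then show "z \<in> {x + y | x y. x \<in> K \<and> y \<in> cball 0 h}"
      by (intro CollectI exI[of _ x] exI[of _ "z - x"]) auto
  next
    fix z assume "z \<in> {x + y | x y. x \<in> K \<and> y \<in> cball 0 h}"
    then obtain x y where "z = x + y" "x \<in> K" "norm y \<le> h" by auto
    then show "z \<in> (\<Union>x\<in>K. cball x h)"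
      by (intro UN_I[of x]) (auto simp: dist_norm)
  qed
  finally have cp: "compact (\<Union>x\<in>K. cball x h)" .
  have cl: "closure {x. \<phi> x \<noteq> 0} \<subseteq> (\<Union>x\<in>K. cball x h)"
    by (rule closure_minimal[OF supp compact_imp_closed[OF cp]])
  have "compact (closure {x. \<phi> x \<noteq> 0})"
    using compact_Int_closed[OF cp closed_closure] cl by (metis Int_absorb1)
  moreover have "(\<Union>x\<in>K. cball x h) \<subseteq> V" using h0(2) h(2) by fastforce
  ultimately have "\<phi> \<in> test_fun V"
    using \<phi>k cl by (auto simp: test_fun_def)
  moreover have "\<bar>\<phi> x - u x\<bar> \<le> e" for x
    unfolding \<phi>_def
  proof (rule convolution_approx[OF \<eta> \<eta>5 u(1)])
    show "\<bar>u y - u x\<bar> \<le> e" if "norm (x - y) < h" for y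
      using h1(2)[of x y] that h by simp
  qed (use a u(2) in auto)
  moreover have "\<bar>pd b \<phi> x - pd b u x\<bar> \<le> e" if C: "Ck (Suc 0) u" and b: "b \<in> Basis" for b x
  proof -
    \<comment> \<open>The derivative of \<open>f\<close> in \<open>y\<close> integrates to 0. This
      moves the derivative from the mollifier to \<open>u\<close>, so that the derivative of
      \<open>\<phi>\<close> is the mollification of the derivative of \<open>u\<close>.\<close>
    define f where "f y = \<eta> (x - y) * u y" for y
    have \<eta>': "(\<lambda>y. \<eta> (x - y)) = (\<lambda>y. \<eta> (y + - x))" using \<eta>(4) by simp
    have d\<eta>: "(\<lambda>y. \<eta> (x - y)) differentiable at y" "pd b (\<lambda>y. \<eta> (x - y)) y = - pd b \<eta> (x - y)" for y
    proof -
      have "((\<lambda>y. \<eta> (x - y)) has_derivative (\<lambda>h. frechet_derivative \<eta> (at (x - y)) (- h))) (at y)"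
        by (rule has_derivative_compose[OF _ has_derivative_pd[OF Ck_differentiable[OF \<eta>k]]])
           (auto intro!: derivative_eq_intros)
      then show "(\<lambda>y. \<eta> (x - y)) differentiable at y" "pd b (\<lambda>y. \<eta> (x - y)) y = - pd b \<eta> (x - y)"
        using linear_frechet_derivative[OF Ck_differentiable[OF \<eta>k], of "x - y"]
        by (auto simp: differentiable_def frechet_derivative_eq linear_neg)
    qed
    have c: "continuous_on UNIV \<eta>" "continuous_on UNIV (pd b \<eta>)" "continuous_on UNIV (pd b u)"
      using \<eta>k[of "Suc 0"] \<eta>(1) C b by auto
    have du: "u differentiable at y" for y using C by simp
    have pdf: "pd c f y = \<eta> (x - y) * pd c u y + pd c (\<lambda>y. \<eta> (x - y)) y * u y" for c y
      unfolding f_def by (rule pd_mult[OF d\<eta>(1) du])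
    have "Ck (Suc 0) (\<lambda>y. \<eta> (x - y))"
      using Ck_translate[OF \<eta>k[of "Suc 0"], of x] \<eta>(4) by simp
    then have f1: "Ck (Suc 0) f" unfolding f_def by (intro Ck_mult C)
    have "(pd b f has_integral 0) UNIV"
      by (rule integral_pd_eq_0[OF f1 compact_imp_bounded[OF K(1)] _ b]) (simp add: f_def u)
    moreover have "pd b f y = 0" if "y \<notin> cbox (-a) a" for y
    proof -
      have "y \<notin> K" using that a by blast
      then show ?thesis by (simp add: pdf pdu0 u(2))
    qed
    then have "(pd b f has_integral integral (cbox (-a) a) (pd b f)) UNIV"
      by (intro has_integral_UNIV_cbox) (use f1 b in auto)
    ultimately have "integral (cbox (-a) a) (pd b f) = 0" using has_integral_unique by blast
    moreover have "integral (cbox (-a) a) (pd b f) =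
       integral (cbox (-a) a) (\<lambda>y. \<eta> (x - y) * pd b u y - pd b \<eta> (x - y) * u y)"
      by (simp add: pdf d\<eta>(2))
    moreover have "\<dots> = integral (cbox (-a) a) (\<lambda>y. \<eta> (x - y) * pd b u y) -
        integral (cbox (-a) a) (\<lambda>y. pd b \<eta> (x - y) * u y)"
      by (intro integral_diff integrable_continuous continuous_intros continuous_on_compose2[OF c(1)]
          continuous_on_compose2[OF c(2)] continuous_on_compose2[OF c(3)] continuous_on_compose2[OF u(1)]) auto
    ultimately have "pd b \<phi> x = integral (cbox (-a) a) (\<lambda>y. \<eta> (x - y) * pd b u y)"
      using fun_cong[OF pd_convolution[OF \<eta>k u(1) b, of "-a" a], of x] by (simp add: \<phi>_def[abs_def])
    moreover have "\<bar>integral (cbox (-a) a) (\<lambda>y. \<eta> (x - y) * pd b u y) - pd b u x\<bar> \<le> e"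
    proof (rule convolution_approx[OF \<eta> \<eta>5 c(3)])
      show "\<bar>pd b u y - pd b u x\<bar> \<le> e" if "norm (x - y) < h" for y
        using h2(2)[OF C b, of x y] that h by simp
    qed (use a pdu0 in auto)
    ultimately show ?thesis by simp
  qed
  ultimately show ?thesis using that by blast
qed

section \<open>The spaces \<open>L\<^sup>2(\<Omega>)\<close> and \<open>C\<^sub>0(\<Omega>)\<close>\<close>

text \<open>For \<open>c = 0\<close> the polynomial is affine in \<open>t\<close>, and if
  \<open>b \<noteq> 0\<close> it would take the value -1 at the chosen \<open>t\<close>. Otherwise
  it is evaluated at its minimum point \<open>- b / c\<close>.\<close>

lemma quadratic_nonneg_discriminant:
  fixes a b c :: real
  assumes "\<And>t. 0 \<le> a + 2 * t * b + t\<^sup>2 * c" "c \<ge> 0"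
  shows "b\<^sup>2 \<le> a * c"
proof (cases "c = 0")
  case True
  have "b = 0"
  proof (rule ccontr)
    assume "b \<noteq> 0"
    then have "2 * (- (a + 1) / (2 * b)) * b = - (a + 1)" by simp
    with assms(1)[of "- (a + 1) / (2 * b)"] True show False by simp
  qed
  with True show ?thesis by simp
next
  case False
  have "0 \<le> c * (a + 2 * (- b / c) * b + (- b / c)\<^sup>2 * c)"
    by (intro mult_nonneg_nonneg assms)
  also have "\<dots> = a * c - b\<^sup>2"
    using False by (simp add: field_simps power2_eq_square)
  finally show ?thesis by simp
qed

lemma C0_zero: "u \<in> C0 \<Omega> \<Longrightarrow> open \<Omega> \<Longrightarrow> x \<notin> \<Omega> \<Longrightarrow> ap u x = 0"
  by (cases "x \<in> closure \<Omega>") (auto simp: C0_def frontier_def interior_open)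

lemma C0_iff: "open \<Omega> \<Longrightarrow> u \<in> C0 \<Omega> \<longleftrightarrow> (\<forall>x. x \<notin> \<Omega> \<longrightarrow> ap u x = 0)"
  using closure_subset[of \<Omega>] by (auto simp: C0_def frontier_def interior_open)

lemma bounded_linear_apply_bcontfun:
  "bounded_linear (\<lambda>u :: 'a::topological_space \<Rightarrow>\<^sub>C 'b::real_normed_vector. ap u x)"
  by (rule bounded_linear_intro[of _ 1]) (use norm_bounded[where 'b = 'b] in auto)

locale bounded_domain =
  fixes \<Omega> :: "'a::euclidean_space set"
  assumes open_dom: "open \<Omega>" and bounded_dom: "bounded \<Omega>"
begin

abbreviation "leb \<equiv> lebesgue_on \<Omega>"

abbreviation ip :: "('a \<Rightarrow> real) \<Rightarrow> ('a \<Rightarrow> real) \<Rightarrow> real" where "ip \<equiv> L2_inner \<Omega>"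

lemma dom_lebesgue [simp]: "\<Omega> \<in> sets lebesgue"
  using open_dom by (simp add: borel_open)

lemma dom_lmeasurable: "\<Omega> \<in> lmeasurable"
  using open_dom bounded_dom by (rule lmeasurable_open[rotated])

lemma space_dom [simp]: "space leb = \<Omega>"
  by simp

lemma finite_measure_dom: "finite_measure leb"
  using dom_lmeasurable by (intro finite_measure_lebesgue_on) 

lemma integrable_bounded:
  fixes f :: "'a \<Rightarrow> real"
  assumes "f \<in> borel_measurable leb" "\<And>x. x \<in> \<Omega> \<Longrightarrow> \<bar>f x\<bar> \<le> B"
  shows "integrable leb f"
  by (rule finite_measure.integrable_const_bound[OF finite_measure_dom, of f B])
    (use assms in \<open>auto intro!: AE_I2\<close>)

lemma L2_bounded:
  fixes f :: "'a \<Rightarrow> real"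
  assumes "f \<in> borel_measurable leb" "\<And>x. x \<in> \<Omega> \<Longrightarrow> \<bar>f x\<bar> \<le> B"
  shows "f \<in> L2 \<Omega>"
proof -
  have "(\<lambda>x. (f x)\<^sup>2) \<in> borel_measurable leb"
    using assms(1) by measurable
  moreover have "\<bar>(f x)\<^sup>2\<bar> \<le> B\<^sup>2" if "x \<in> \<Omega>" for x
    using power_mono[OF assms(2)[OF that], of 2] by simp
  ultimately show ?thesis
    using assms(1) integrable_bounded unfolding L2_def by blast
qed

lemma L2_measurable: "f \<in> L2 \<Omega> \<Longrightarrow> f \<in> borel_measurable leb"
  by (simp add: L2_def)

lemma L2_const: "(\<lambda>x. c) \<in> L2 \<Omega>"
  by (rule L2_bounded[of _ "\<bar>c\<bar>"]) auto

lemma continuous_measurable: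
  "continuous_on \<Omega> f \<Longrightarrow> f \<in> borel_measurable leb" for f :: "'a \<Rightarrow> real"
  by (rule continuous_imp_measurable_on_sets_lebesgue) auto

lemma L2_bcontfun: "ap g \<in> L2 \<Omega>"
  using norm_bounded[of g] by (intro L2_bounded[of _ "norm g"] continuous_measurable) auto

lemma integrable_ip:
  assumes "f \<in> L2 \<Omega>" "g \<in> L2 \<Omega>"
  shows "integrable leb (\<lambda>x. f x * g x)"
proof (rule Bochner_Integration.integrable_bound)
  show "integrable leb (\<lambda>x. (f x)\<^sup>2 + (g x)\<^sup>2)"
    using assms by (auto simp: L2_def)
  show "(\<lambda>x. f x * g x) \<in> borel_measurable leb"
    using assms L2_measurable by (auto intro: borel_measurable_times)
  have "\<bar>a * b\<bar> \<le> a\<^sup>2 + b\<^sup>2" for a b :: real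
  proof -
    have "2 * (\<bar>a\<bar> * \<bar>b\<bar>) \<le> a\<^sup>2 + b\<^sup>2"
      using sum_squares_bound[of "\<bar>a\<bar>" "\<bar>b\<bar>"] by (simp add: mult.assoc)
    moreover have "0 \<le> \<bar>a\<bar> * \<bar>b\<bar>" by simp
    ultimately show ?thesis unfolding abs_mult by linarith
  qed
  then show "AE x in leb. norm (f x * g x) \<le> norm ((f x)\<^sup>2 + (g x)\<^sup>2)"
    by auto
qed

lemma L2_integrable: "f \<in> L2 \<Omega> \<Longrightarrow> integrable leb f"
  using integrable_ip[OF _ L2_const[of 1]] by simp

lemma L2_lin:
  assumes "f \<in> L2 \<Omega>" "g \<in> L2 \<Omega>"
  shows "(\<lambda>x. a * f x + b * g x) \<in> L2 \<Omega>"
proof -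
  have "(\<lambda>x. (a * f x + b * g x)\<^sup>2) = (\<lambda>x. a\<^sup>2 * (f x)\<^sup>2 + b\<^sup>2 * (g x)\<^sup>2 + 2 * a * b * (f x * g x))"
    by (auto simp: power2_eq_square algebra_simps)
  moreover have "integrable leb (\<lambda>x. a\<^sup>2 * (f x)\<^sup>2 + b\<^sup>2 * (g x)\<^sup>2 + 2 * a * b * (f x * g x))"
    using assms integrable_ip[OF assms] by (auto simp: L2_def)
  moreover have "(\<lambda>x. a * f x + b * g x) \<in> borel_measurable leb"
    using assms[THEN L2_measurable] by measurable
  ultimately show ?thesis by (simp add: L2_def)
qed

lemma L2_add: "f \<in> L2 \<Omega> \<Longrightarrow> g \<in> L2 \<Omega> \<Longrightarrow> (\<lambda>x. f x + g x) \<in> L2 \<Omega>"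
  using L2_lin[of f g 1 1] by simp

lemma L2_diff: "f \<in> L2 \<Omega> \<Longrightarrow> g \<in> L2 \<Omega> \<Longrightarrow> (\<lambda>x. f x - g x) \<in> L2 \<Omega>"
  using L2_lin[of f g 1 "-1"] by simp

lemma L2_cmult: "f \<in> L2 \<Omega> \<Longrightarrow> (\<lambda>x. c * f x) \<in> L2 \<Omega>"
  using L2_lin[of f f c 0] by simp

lemma ip_commute: "ip f g = ip g f"
  by (simp add: L2_inner_def mult.commute)

lemma ip_lin:
  assumes "f \<in> L2 \<Omega>" "g \<in> L2 \<Omega>" "p \<in> L2 \<Omega>"
  shows "ip (\<lambda>x. a * f x + b * g x) p = a * ip f p + b * ip g p"
  using integrable_ip[OF assms(1,3)] integrable_ip[OF assms(2,3)]
  by (simp add: L2_inner_def distrib_right mult.assoc)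

lemma ip_add: "f \<in> L2 \<Omega> \<Longrightarrow> g \<in> L2 \<Omega> \<Longrightarrow> p \<in> L2 \<Omega> \<Longrightarrow> ip (\<lambda>x. f x + g x) p = ip f p + ip g p"
  using ip_lin[of f g p 1 1] by simp

lemma ip_diff: "f \<in> L2 \<Omega> \<Longrightarrow> g \<in> L2 \<Omega> \<Longrightarrow> p \<in> L2 \<Omega> \<Longrightarrow> ip (\<lambda>x. f x - g x) p = ip f p - ip g p"
  using ip_lin[of f g p 1 "-1"] by simp

lemma ip_cmult: "ip (\<lambda>x. c * f x) p = c * ip f p"
  by (simp add: L2_inner_def mult.assoc)

lemma ip_cong_AE:
  assumes "L2_eq \<Omega> f g" "f \<in> L2 \<Omega>" "g \<in> L2 \<Omega>" "p \<in> L2 \<Omega>"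
  shows "ip f p = ip g p"
  unfolding L2_inner_def
  using assms(1) assms(2-4)[THEN L2_measurable]
  by (intro integral_cong_AE) (auto simp: L2_eq_def)

lemma ip_self_nonneg: "0 \<le> ip f f"
  unfolding L2_inner_def by (intro integral_nonneg_AE) auto

lemma L2_norm_nonneg: "0 \<le> L2_norm \<Omega> f"
  by (simp add: L2_norm_def ip_self_nonneg)

lemma ip_Cauchy_Schwarz:
  assumes "f \<in> L2 \<Omega>" "g \<in> L2 \<Omega>"
  shows "\<bar>ip f g\<bar> \<le> L2_norm \<Omega> f * L2_norm \<Omega> g"
proof -
  have "0 \<le> ip f f + 2 * t * ip f g + t\<^sup>2 * ip g g" for t
  proof -
    let ?h = "\<lambda>x. 1 * f x + t * g x"
    have h: "?h \<in> L2 \<Omega>" by (rule L2_lin[OF assms])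
    have "ip ?h ?h = 1 * ip f ?h + t * ip g ?h"
      by (rule ip_lin[OF assms h])
    also have "ip f ?h = 1 * ip f f + t * ip f g"
      by (subst ip_commute, subst ip_lin[OF assms assms(1)]) (simp add: ip_commute[of g f])
    also have "ip g ?h = 1 * ip f g + t * ip g g"
      by (subst ip_commute, subst ip_lin[OF assms assms(2)]) simp
    finally have "ip ?h ?h = ip f f + 2 * t * ip f g + t\<^sup>2 * ip g g"
      by (simp add: algebra_simps power2_eq_square)
    then show ?thesis using ip_self_nonneg[of ?h] by simp
  qed
  then have "(ip f g)\<^sup>2 \<le> ip f f * ip g g"
    using ip_self_nonneg by (rule quadratic_nonneg_discriminant)
  then have "sqrt ((ip f g)\<^sup>2) \<le> sqrt (ip f f * ip g g)"
    by (rule real_sqrt_le_mono)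
  then show ?thesis
    by (simp add: L2_norm_def real_sqrt_mult)
qed

lemma tendsto_ip:
  assumes "((\<lambda>k. L2_norm \<Omega> (\<lambda>x. f k x - g x)) \<longlongrightarrow> 0) F"
    and "eventually (\<lambda>k. f k \<in> L2 \<Omega>) F" "g \<in> L2 \<Omega>" "p \<in> L2 \<Omega>"
  shows "((\<lambda>k. ip (f k) p) \<longlongrightarrow> ip g p) F"
proof -
  have "((\<lambda>k. ip (f k) p - ip g p) \<longlongrightarrow> 0) F"
  proof (rule Lim_null_comparison)
    show "((\<lambda>k. L2_norm \<Omega> (\<lambda>x. f k x - g x) * L2_norm \<Omega> p) \<longlongrightarrow> 0) F"
      using tendsto_mult_left_zero[OF assms(1)] by simp
    show "\<forall>\<^sub>F k in F. norm (ip (f k) p - ip g p) \<le> L2_norm \<Omega> (\<lambda>x. f k x - g x) * L2_norm \<Omega> p"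
      using assms(2)
    proof eventually_elim
      case (elim k)
      show ?case
        using ip_Cauchy_Schwarz[OF L2_diff[OF elim assms(3)] assms(4)] ip_diff[OF elim assms(3,4)]
        by simp
    qed
  qed
  then show ?thesis using LIM_zero_iff by blast
qed

lemma L2_norm_le_sup:
  fixes f :: "'a \<Rightarrow> real"
  assumes "f \<in> borel_measurable leb" "\<And>x. x \<in> \<Omega> \<Longrightarrow> \<bar>f x\<bar> \<le> B" "B \<ge> 0"
  shows "L2_norm \<Omega> f \<le> B * sqrt (measure lebesgue \<Omega>)"
proof -
  have "ip f f \<le> (\<integral>x. B\<^sup>2 \<partial>leb)"
    unfolding L2_inner_def
  proof (rule integral_mono)
    show "integrable leb (\<lambda>x. f x * f x)"
      using L2_bounded[OF assms(1,2)] integrable_ip by blast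
    show "integrable leb (\<lambda>x. B\<^sup>2)"
      using L2_integrable[OF L2_const] .
    show "f x * f x \<le> B\<^sup>2" if "x \<in> space leb" for x
      using power_mono[OF assms(2)[of x], of 2] that by (simp add: power2_eq_square)
  qed
  also have "\<dots> = B\<^sup>2 * measure lebesgue \<Omega>"
    by (simp add: measure_restrict_space)
  finally have "sqrt (ip f f) \<le> sqrt (B\<^sup>2 * measure lebesgue \<Omega>)"
    by (rule real_sqrt_le_mono)
  then show ?thesis using assms(3) by (simp add: L2_norm_def real_sqrt_mult)
qed

section \<open>Sup-norm bounds by duality with \<open>L1\<close>\<close>

definition L1 :: "('a \<Rightarrow> real) \<Rightarrow> real" where "L1 p = (\<integral>x. \<bar>p x\<bar> \<partial>leb)"

lemma L1_nonneg: "L1 p \<ge> 0"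
  unfolding L1_def by (intro integral_nonneg_AE) auto

lemma ip_le_L1:
  assumes "f \<in> L2 \<Omega>" "\<And>x. x \<in> \<Omega> \<Longrightarrow> \<bar>f x\<bar> \<le> B" "p \<in> L2 \<Omega>"
  shows "\<bar>ip f p\<bar> \<le> B * L1 p"
proof -
  have "\<bar>ip f p\<bar> \<le> (\<integral>x. \<bar>f x * p x\<bar> \<partial>leb)"
    unfolding L2_inner_def by (rule integral_abs_bound)
  also have "\<dots> \<le> (\<integral>x. B * \<bar>p x\<bar> \<partial>leb)"
  proof (rule integral_mono)
    show "integrable leb (\<lambda>x. \<bar>f x * p x\<bar>)"
      by (intro integrable_abs integrable_ip assms)
    show "integrable leb (\<lambda>x. B * \<bar>p x\<bar>)"
      using L2_integrable[OF assms(3)] by auto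
  qed (use assms(2) in \<open>auto simp: abs_mult intro!: mult_right_mono\<close>)
  finally show ?thesis by (simp add: L1_def)
qed

lemma ip_bcontfun_le: "p \<in> L2 \<Omega> \<Longrightarrow> \<bar>ip (ap g) p\<bar> \<le> norm g * L1 p"
  using norm_bounded[of g] by (intro ip_le_L1 L2_bcontfun) auto

text \<open>Lets the pairing with \<open>p\<close> pass through limits and integrals of maps with
  values in the bounded continuous functions.\<close>

lemma bounded_linear_ip:
  assumes "p \<in> L2 \<Omega>"
  shows "bounded_linear (\<lambda>g. ip (ap g) p)"
proof (rule bounded_linear_intro[of _ "L1 p"])
  show "ip (ap (f + g)) p = ip (ap f) p + ip (ap g) p" for f g
    using ip_add[OF L2_bcontfun[of f] L2_bcontfun[of g] assms] by (simp add: plus_bcontfun.rep_eq)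
  show "ip (ap (c *\<^sub>R f)) p = c *\<^sub>R ip (ap f) p" for c f
    by (simp add: scaleR_bcontfun.rep_eq ip_cmult)
qed (use ip_bcontfun_le[OF assms] in auto)

lemma L2_indicator: "A \<in> sets lebesgue \<Longrightarrow> indicator A \<in> L2 \<Omega>"
  by (rule L2_bounded[of _ 1])
    (auto intro!: measurable_restrict_space1[OF borel_measurable_indicator] split: split_indicator)

text \<open>If the bound fails at \<open>x\<close>, the part of \<open>\<Omega>\<close> where
  \<open>W\<close> exceeds \<open>B + e\<close> is open and nonempty, hence of positive measure, and
  its indicator is a test function that violates the assumption.\<close>

lemma bcontfun_le_of_ip:
  assumes "\<And>p. p \<in> L2 \<Omega> \<Longrightarrow> (\<And>x. p x \<ge> 0) \<Longrightarrow> ip (ap W) p \<le> B * L1 p" "x \<in> \<Omega>"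
  shows "ap W x \<le> B"
proof (rule ccontr)
  assume "\<not> ?thesis"
  then obtain e where e: "e > 0" "ap W x > B + e"
    using dense[of B "ap W x"] by (metis diff_gt_0_iff_gt le_add_diff_inverse not_less less_imp_le)
  define A where "A = \<Omega> \<inter> ap W -` {B + e<..}"
  have oA: "open A"
    unfolding A_def by (rule continuous_open_preimage) (auto simp: open_dom)
  have xA: "x \<in> A" using e assms(2) by (simp add: A_def)
  have Al: "A \<in> lmeasurable"
    using oA bounded_subset[OF bounded_dom, of A] by (auto simp: A_def intro: lmeasurable_open)
  have mA: "measure lebesgue A > 0"
    using oA xA Al open_not_negligible[OF oA] negligible_iff_measure
    by (metis empty_iff measure_nonneg order_le_less)
  have L2A: "indicator A \<in> L2 \<Omega>" using oA by (intro L2_indicator) (simp add: borel_open)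
  have intA: "(\<integral>x. indicator A x \<partial>leb) = measure lebesgue A"
  proof -
    have "(\<integral>x. indicator A x \<partial>leb) = measure leb (A \<inter> \<Omega>)"
      by simp
    also have "\<dots> = measure lebesgue A"
      using Al by (subst measure_restrict_space) (auto simp: A_def intro!: arg_cong[of _ _ "measure lebesgue"])
    finally show ?thesis .
  qed
  have "(B + e) * measure lebesgue A = (\<integral>x. (B + e) * indicator A x \<partial>leb)"
    using L2_integrable[OF L2A] intA by simp
  also have "\<dots> \<le> ip (ap W) (indicator A)"
    unfolding L2_inner_def using L2_integrable[OF L2A] integrable_ip[OF L2_bcontfun[of W] L2A]
    by (intro integral_mono integrable_mult_right) (auto simp: A_def split: split_indicator)
  also have "\<dots> \<le> B * L1 (indicator A)"
    by (rule assms(1)[OF L2A]) simp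
  also have "L1 (indicator A) = measure lebesgue A"
    using intA by (simp add: L1_def)
  finally show False using mult_pos_pos[OF e(1) mA] by (simp add: distrib_right)
qed

text \<open>This is the way back from weak estimates to the norm of \<open>C0 \<Omega>\<close>.
  Elements of that space vanish off \<open>\<Omega>\<close>, so the one-sided bound inside, applied
  to \<open>W\<close> and \<open>- W\<close>, controls the whole sup norm.\<close>

lemma norm_le_of_ip:
  assumes "\<And>p. p \<in> L2 \<Omega> \<Longrightarrow> \<bar>ip (ap W) p\<bar> \<le> B * L1 p" "W \<in> C0 \<Omega>" "B \<ge> 0"
  shows "norm W \<le> B"
proof (rule norm_bound)
  fix x
  show "norm (ap W x) \<le> B"
  proof (cases "x \<in> \<Omega>")
    case True
    have "ap W x \<le> B"
      using assms(1) True by (intro bcontfun_le_of_ip) (auto dest: abs_le_D1)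
    moreover have "ap (- W) x \<le> B"
    proof (rule bcontfun_le_of_ip[OF _ True])
      fix p assume "p \<in> L2 \<Omega>"
      then show "ip (ap (- W)) p \<le> B * L1 p"
        using assms(1)[of p] ip_cmult[of "-1" "ap W" p]
        by (simp add: uminus_bcontfun.rep_eq)
    qed
    ultimately show ?thesis by (simp add: uminus_bcontfun.rep_eq abs_le_iff)
  qed (use C0_zero[OF assms(2) open_dom] assms(3) in auto)
qed

lemma C0_eqI:
  assumes "\<And>p. p \<in> L2 \<Omega> \<Longrightarrow> ip (ap u) p = ip (ap v) p" "u \<in> C0 \<Omega>" "v \<in> C0 \<Omega>"
  shows "u = v"
proof -
  have "norm (u - v) \<le> 0"
  proof (rule norm_le_of_ip)
    fix p assume p: "p \<in> L2 \<Omega>"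
    show "\<bar>ip (ap (u - v)) p\<bar> \<le> 0 * L1 p"
      using assms(1)[OF p] ip_diff[OF L2_bcontfun[of u] L2_bcontfun[of v] p] by (simp add: minus_bcontfun.rep_eq)
  qed (use assms C0_iff[OF open_dom] in \<open>auto simp: minus_bcontfun.rep_eq\<close>)
  then show ?thesis by simp
qed

lemma subspace_C0: "subspace (C0 \<Omega>)"
  by (auto simp: subspace_def C0_iff[OF open_dom] plus_bcontfun.rep_eq scaleR_bcontfun.rep_eq zero_bcontfun.rep_eq)

lemma closed_C0: "closed (C0 \<Omega>)"
proof -
  have "C0 \<Omega> = (\<Inter>x\<in>-\<Omega>. {u. ap u x = 0})"
    by (auto simp: C0_iff[OF open_dom])
  moreover have "closed {u. ap u x = (0::real)}" for x :: 'a
    by (intro closed_Collect_eq linear_continuous_on[OF bounded_linear_apply_bcontfun] continuous_on_const)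
  ultimately show ?thesis by auto
qed

text \<open>A function that does not vanish on the boundary can be approximated in \<open>L2\<close>
  but not uniformly. The bound by \<open>norm g\<close> is kept so that contractivity carries over
  from \<open>C0 \<Omega>\<close> to all bounded continuous functions. The cutoffs are eventually 1
  at each point of \<open>\<Omega>\<close>, and dominated convergence applies.\<close>

lemma C0_dense:
  obtains g' where "\<And>k. g' k \<in> C0 \<Omega>" "\<And>k. norm (g' k :: 'a \<Rightarrow>\<^sub>C real) \<le> norm g"
    "(\<lambda>k. L2_norm \<Omega> (\<lambda>x. ap (g' k) x - ap g x)) \<longlonglongrightarrow> 0"
proof (cases "\<Omega> = UNIV")
  \<comment> \<open>\<open>infdist\<close> to the empty set is 0 by convention, so the cutoffs of
    the other case would vanish identically here.\<close>
  case True
  then have "g \<in> C0 \<Omega>" using C0_iff[OF open_dom] by auto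
  then show ?thesis using that[of "\<lambda>_. g"] by (simp add: L2_norm_def L2_inner_def)
next
  case False
  define c where "c k x = min 1 (real k * infdist x (- \<Omega>))" for k x
  have c01: "0 \<le> c k x" "c k x \<le> 1" for k x
    by (auto simp: c_def infdist_nonneg)
  have cc: "continuous_on S (c k)" for k S
    unfolding c_def by (intro continuous_intros)
  have bc: "(\<lambda>x. c k x * ap g x) \<in> bcontfun" for k
  proof (rule bcontfun_normI[of _ "norm g"])
    show "norm (c k x * ap g x) \<le> norm g" for x
      using mult_mono[OF c01(2)[of k x] norm_bounded[of g x]] c01 by (simp add: abs_mult)
  qed (auto intro!: continuous_intros cc)
  define g' where "g' k = Bcontfun (\<lambda>x. c k x * ap g x)" for k
  have g': "ap (g' k) x = c k x * ap g x" for k x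
    unfolding g'_def using bc by (simp add: Bcontfun_inverse)
  have "g' k \<in> C0 \<Omega>" for k
    unfolding C0_iff[OF open_dom] by (auto simp: g' c_def)
  moreover have "norm (g' k) \<le> norm g" for k
  proof (rule norm_bound)
    show "norm (ap (g' k) x) \<le> norm g" for x
      using mult_mono[OF c01(2)[of k x] norm_bounded[of g x]] c01 by (simp add: abs_mult g')
  qed
  moreover have "(\<lambda>k. L2_norm \<Omega> (\<lambda>x. ap (g' k) x - ap g x)) \<longlonglongrightarrow> 0"
  proof -
    define h where "h k x = ap (g' k) x - ap g x" for k x
    have "(\<lambda>k. \<integral>x. h k x * h k x \<partial>leb) \<longlonglongrightarrow> (\<integral>x. 0 \<partial>leb)"
    proof (rule integral_dominated_convergence[where w = "\<lambda>x. (norm g)\<^sup>2"])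
      show "(\<lambda>x. h k x * h k x) \<in> borel_measurable leb" for k
        unfolding h_def by (intro continuous_measurable continuous_intros) auto
      show "integrable leb (\<lambda>x. (norm g)\<^sup>2)"
        by (rule L2_integrable[OF L2_const])
      show "AE x in leb. (\<lambda>k. h k x * h k x) \<longlonglongrightarrow> 0"
      proof (rule AE_I2)
        fix x assume "x \<in> space leb"
        then have "x \<in> \<Omega>" by simp
        then have d: "infdist x (- \<Omega>) > 0"
          using False open_dom by (intro infdist_pos_not_in_closed) auto
        then obtain N where "1 < real N * infdist x (- \<Omega>)"
          using reals_Archimedean3 by blast
        moreover have "real N * infdist x (- \<Omega>) \<le> real k * infdist x (- \<Omega>)" if "k \<ge> N" for k
          using that d by (intro mult_right_mono) auto
        ultimately have "c k x = 1" if "k \<ge> N" for k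
          using that by (fastforce simp: c_def)
        then show "(\<lambda>k. h k x * h k x) \<longlonglongrightarrow> 0"
          by (intro tendsto_eventually) (auto simp: eventually_sequentially g' h_def intro!: exI[of _ N])
      qed
      show "AE x in leb. norm (h k x * h k x) \<le> (norm g)\<^sup>2" for k
      proof (rule AE_I2)
        fix x
        have "h k x = - ((1 - c k x) * ap g x)"
          by (simp add: g' h_def algebra_simps)
        then have "\<bar>h k x\<bar> \<le> norm g"
          using mult_mono[of "1 - c k x" 1 "\<bar>ap g x\<bar>" "norm g"] norm_bounded[of g x] c01[of k x]
          by (simp add: abs_mult)
        then show "norm (h k x * h k x) \<le> (norm g)\<^sup>2"
          by (metis abs_le_square_iff abs_of_nonneg abs_power2 norm_ge_zero power2_eq_square real_norm_def)
      qed
    qed simp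
    then have "(\<lambda>k. sqrt (\<integral>x. h k x * h k x \<partial>leb)) \<longlonglongrightarrow> sqrt 0"
      by (intro tendsto_real_sqrt) simp
    then show ?thesis by (simp add: L2_norm_def L2_inner_def h_def)
  qed
  ultimately show ?thesis using that by blast
qed

end

section \<open>The Dirichlet heat semigroup\<close>

text \<open>The generator is a limit for \<open>h > 0\<close>, so it yields right derivatives only.
  For each slope \<open>e > 0\<close>, the set \<open>A\<close> of points up to which the increment
  stays within \<open>e * (y - a)\<close> has supremum \<open>b\<close>: continuity extends the
  estimate to the supremum, and the right derivative there pushes it further unless \<open>b\<close>
  is reached.\<close>

lemma right_derivative_zero_imp_const:
  fixes f :: "real \<Rightarrow> real"
  assumes ab: "a \<le> b" and cont: "continuous_on {a..b} f"
    and der: "\<And>x. a \<le> x \<Longrightarrow> x < b \<Longrightarrow> (f has_real_derivative 0) (at_right x)"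
  shows "f b = f a"
proof -
  have main: "\<bar>f b - f a\<bar> \<le> e * (b - a)" if e: "e > 0" for e
  proof -
    define A where "A = {x\<in>{a..b}. \<forall>y\<in>{a..x}. \<bar>f y - f a\<bar> \<le> e * (y - a)}"
    have aA: "a \<in> A" using ab by (auto simp: A_def)
    have bdd: "bdd_above A" by (auto simp: A_def intro!: bdd_aboveI[of _ b])
    define s where "s = Sup A"
    have s: "a \<le> s" "s \<le> b"
      unfolding s_def using cSup_upper[OF aA bdd] aA
      by (auto intro!: cSup_least simp: A_def)
    have below: "\<bar>f y - f a\<bar> \<le> e * (y - a)" if "a \<le> y" "y < s" for y
    proof -
      from that obtain x where "x \<in> A" "y < x"
        unfolding s_def using less_cSupE[of y A] aA by auto
      then show ?thesis using that(1) unfolding A_def by force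
    qed
    have fs: "\<bar>f s - f a\<bar> \<le> e * (s - a)"
    proof (cases "s = a")
      case False
      then have as: "a < s" using s by simp
      have "continuous_on {a..s} (\<lambda>y. e * (y - a) - \<bar>f y - f a\<bar>)"
        using cont s by (intro continuous_intros) (auto intro: continuous_on_subset)
      then have "((\<lambda>y. e * (y - a) - \<bar>f y - f a\<bar>) \<longlongrightarrow> e * (s - a) - \<bar>f s - f a\<bar>) (at_left s)"
        using as by (rule continuous_on_Icc_at_leftD)
      moreover have "\<forall>\<^sub>F y in at_left s. 0 \<le> e * (y - a) - \<bar>f y - f a\<bar>"
        unfolding eventually_at_left_field
        by (intro exI[of _ a] conjI as allI impI) (use below in auto)
      ultimately have "0 \<le> e * (s - a) - \<bar>f s - f a\<bar>"
        using tendsto_lowerbound trivial_limit_at_left_real by blast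
      then show ?thesis by simp
    qed simp
    have "s = b"
    proof (rule ccontr)
      assume "s \<noteq> b"
      then have sb: "s < b" using s by simp
      have "((\<lambda>y. (f y - f s) / (y - s)) \<longlongrightarrow> 0) (at_right s)"
        using der[OF s(1) sb] by (simp add: has_field_derivative_iff)
      then have "\<forall>\<^sub>F y in at_right s. \<bar>(f y - f s) / (y - s)\<bar> < e"
        using tendstoD[OF _ e] by fastforce
      then obtain c where c: "c > s" "\<And>y. s < y \<Longrightarrow> y < c \<Longrightarrow> \<bar>(f y - f s) / (y - s)\<bar> < e"
        unfolding eventually_at_right_field by blast
      define r where "r = (s + min c b) / 2"
      have r: "s < r" "r < c" "r \<le> b" using c sb by (auto simp: r_def)
      have "r \<in> A"
        unfolding A_def
      proof (intro CollectI conjI ballI)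
        fix y assume y: "y \<in> {a..r}"
        show "\<bar>f y - f a\<bar> \<le> e * (y - a)"
        proof (cases "y \<le> s")
          case True
          then show ?thesis using below[of y] fs y by (cases "y = s") auto
        next
          case False
          then have "\<bar>f y - f s\<bar> / (y - s) < e"
            using c(2)[of y] y r by (simp add: abs_divide)
          then have "\<bar>f y - f s\<bar> < e * (y - s)"
            using False by (simp add: pos_divide_less_eq)
          moreover have "e * (y - s) + e * (s - a) = e * (y - a)" by (simp add: algebra_simps)
          ultimately show ?thesis using fs by linarith
        qed
      qed (use r s in auto)
      then have "r \<le> s" unfolding s_def by (rule cSup_upper[OF _ bdd])
      then show False using r by simp
    qed
    then show ?thesis using fs by simp
  qed
  have "\<bar>f b - f a\<bar> \<le> 0 + d" if "d > 0" for d
  proof -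
    \<comment> \<open>The summand 1 keeps the denominator positive when
      \<open>a = b\<close>.\<close>
    have "\<bar>f b - f a\<bar> \<le> d / (b - a + 1) * (b - a)"
      using that ab by (intro main) auto
    also have "\<dots> \<le> d" using that ab by (simp add: field_simps)
    finally show ?thesis by simp
  qed
  then have "\<bar>f b - f a\<bar> \<le> 0" by (rule field_le_epsilon)
  then show ?thesis by simp
qed

instance bcontfun :: (metric_space, banach) banach ..

locale heat_semigroup = bounded_domain \<Omega> for \<Omega> :: "'a::euclidean_space set" +
  fixes \<kappa> :: real and S :: "real \<Rightarrow> ('a \<Rightarrow> real) \<Rightarrow> 'a \<Rightarrow> real"
  assumes \<kappa>: "\<kappa> > 0" and heat: "dirichlet_heat_semigroup \<Omega> \<kappa> S"
begin

lemma sg: "L2_C0_semigroup \<Omega> S"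
  using heat by (simp add: dirichlet_heat_semigroup_def)

lemma S_L2: "t \<ge> 0 \<Longrightarrow> u \<in> L2 \<Omega> \<Longrightarrow> S t u \<in> L2 \<Omega>"
  using sg by (simp add: L2_C0_semigroup_def)

lemma S_lin:
  assumes "t \<ge> 0" "u \<in> L2 \<Omega>" "v \<in> L2 \<Omega>" "p \<in> L2 \<Omega>"
  shows "ip (S t (\<lambda>x. a * u x + b * v x)) p = a * ip (S t u) p + b * ip (S t v) p"
proof -
  have "L2_eq \<Omega> (S t (\<lambda>x. a * u x + b * v x)) (\<lambda>x. a * S t u x + b * S t v x)"
    using sg assms unfolding L2_C0_semigroup_def by blast
  from ip_cong_AE[OF this] show ?thesis
    using assms by (simp add: S_L2 L2_lin ip_lin)
qed

lemma S_add:
  assumes "s \<ge> 0" "t \<ge> 0" "u \<in> L2 \<Omega>" "p \<in> L2 \<Omega>"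
  shows "ip (S (s + t) u) p = ip (S s (S t u)) p"
  using assms sg by (intro ip_cong_AE) (auto simp: S_L2 L2_C0_semigroup_def)

lemma S_0: "u \<in> L2 \<Omega> \<Longrightarrow> p \<in> L2 \<Omega> \<Longrightarrow> ip (S 0 u) p = ip u p"
  using sg by (intro ip_cong_AE) (auto simp: S_L2 L2_C0_semigroup_def)

lemma S_right_continuous_0:
  "u \<in> L2 \<Omega> \<Longrightarrow> ((\<lambda>t. L2_norm \<Omega> (\<lambda>x. S t u x - u x)) \<longlongrightarrow> 0) (at_right 0)"
  using sg by (simp add: L2_C0_semigroup_def)

lemma S_bounded: "t \<ge> 0 \<Longrightarrow> \<exists>C. \<forall>u\<in>L2 \<Omega>. L2_norm \<Omega> (S t u) \<le> C * L2_norm \<Omega> u"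
  using sg by (simp add: L2_C0_semigroup_def)

text \<open>Follows from the operator bound at the fixed time \<open>t\<close>. The constant may
  depend on \<open>t\<close>; uniformity in time will come from the contractions on
  \<open>C0 \<Omega>\<close>.\<close>

lemma S_tendsto:
  assumes t: "t \<ge> 0" and lim: "((\<lambda>k. L2_norm \<Omega> (\<lambda>x. f k x - g x)) \<longlongrightarrow> 0) F"
    and f: "eventually (\<lambda>k. f k \<in> L2 \<Omega>) F" and g: "g \<in> L2 \<Omega>" and p: "p \<in> L2 \<Omega>"
  shows "((\<lambda>k. ip (S t (f k)) p) \<longlongrightarrow> ip (S t g) p) F"
proof -
  obtain C where C: "\<And>u. u \<in> L2 \<Omega> \<Longrightarrow> L2_norm \<Omega> (S t u) \<le> C * L2_norm \<Omega> u"
    using S_bounded[OF t] by metis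
  have "((\<lambda>k. ip (S t (f k)) p - ip (S t g) p) \<longlongrightarrow> 0) F"
  proof (rule Lim_null_comparison)
    show "((\<lambda>k. C * L2_norm \<Omega> (\<lambda>x. f k x - g x) * L2_norm \<Omega> p) \<longlongrightarrow> 0) F"
      by (intro tendsto_mult_left_zero tendsto_mult_right_zero lim)
    show "\<forall>\<^sub>F k in F. norm (ip (S t (f k)) p - ip (S t g) p) \<le> C * L2_norm \<Omega> (\<lambda>x. f k x - g x) * L2_norm \<Omega> p"
      using f
    proof eventually_elim
      case (elim k)
      have d: "(\<lambda>x. f k x - g x) \<in> L2 \<Omega>" by (rule L2_diff[OF elim g])
      have "ip (S t (f k)) p - ip (S t g) p = ip (S t (\<lambda>x. f k x - g x)) p"
        using S_lin[OF t elim g p, of 1 "-1"] by simp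
      moreover have "\<bar>ip (S t (\<lambda>x. f k x - g x)) p\<bar> \<le> L2_norm \<Omega> (S t (\<lambda>x. f k x - g x)) * L2_norm \<Omega> p"
        by (rule ip_Cauchy_Schwarz[OF S_L2[OF t d] p])
      moreover have "\<dots> \<le> C * L2_norm \<Omega> (\<lambda>x. f k x - g x) * L2_norm \<Omega> p"
        by (intro mult_right_mono C[OF d] L2_norm_nonneg)
      ultimately show ?case by simp
    qed
  qed
  then show ?thesis using LIM_zero_iff by blast
qed

text \<open>\<open>S t\<close> is a map on representatives. That it respects equality almost
  everywhere, as tested by \<open>p\<close>, follows from the \<open>L2\<close> bound: the constant
  sequence \<open>u\<close> converges to \<open>v\<close> in \<open>L2\<close>.\<close>

lemma S_cong:
  assumes "t \<ge> 0" "L2_eq \<Omega> u v" "u \<in> L2 \<Omega>" "v \<in> L2 \<Omega>" "p \<in> L2 \<Omega>"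
  shows "ip (S t u) p = ip (S t v) p"
proof -
  have "L2_norm \<Omega> (\<lambda>x. u x - v x) = 0"
  proof -
    have "ip (\<lambda>x. u x - v x) (\<lambda>x. u x - v x) = ip (\<lambda>x. 0) (\<lambda>x. u x - v x)"
      using assms by (intro ip_cong_AE L2_diff L2_const) (auto simp: L2_eq_def)
    then show ?thesis by (simp add: L2_norm_def L2_inner_def)
  qed
  then have "(\<lambda>k::nat. ip (S t u) p) \<longlonglongrightarrow> ip (S t v) p"
    using assms(3) by (intro S_tendsto[OF assms(1) _ _ assms(4,5)]) auto
  then show ?thesis by (simp add: LIMSEQ_const_iff)
qed

definition C0_part :: "(real \<Rightarrow> ('a \<Rightarrow>\<^sub>C real) \<Rightarrow> 'a \<Rightarrow>\<^sub>C real) \<Rightarrow> bool" where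
  "C0_part P \<longleftrightarrow> (\<forall>t\<ge>0. \<forall>g\<in>C0 \<Omega>. P t g \<in> C0 \<Omega> \<and> norm (P t g) \<le> norm g \<and>
           L2_eq \<Omega> (ap (P t g)) (S t (ap g))) \<and>
        (\<forall>g\<in>C0 \<Omega>. ((\<lambda>t. P t g) \<longlongrightarrow> g) (at_right 0))"

text \<open>The choice is harmless: for \<open>t \<ge> 0\<close> and
  \<open>g \<in> C0 \<Omega>\<close> the value is the representative of \<open>S t (ap g)\<close> in
  \<open>C0 \<Omega>\<close>, and elements of \<open>C0 \<Omega>\<close> that agree almost
  everywhere in \<open>\<Omega>\<close> are equal.\<close>

definition P :: "real \<Rightarrow> ('a \<Rightarrow>\<^sub>C real) \<Rightarrow> 'a \<Rightarrow>\<^sub>C real" where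
  "P = (SOME P. C0_part P)"

lemma P_spec: "C0_part P"
proof -
  have "\<exists>P. C0_part P"
    using heat
    unfolding C0_part_def dirichlet_heat_semigroup_def acts_as_contractions_on_C0_def by blast
  then show ?thesis unfolding P_def by (rule someI_ex)
qed

lemma P_C0: "t \<ge> 0 \<Longrightarrow> g \<in> C0 \<Omega> \<Longrightarrow> P t g \<in> C0 \<Omega>"
  and P_norm: "t \<ge> 0 \<Longrightarrow> g \<in> C0 \<Omega> \<Longrightarrow> norm (P t g) \<le> norm g"
  and P_S: "t \<ge> 0 \<Longrightarrow> g \<in> C0 \<Omega> \<Longrightarrow> L2_eq \<Omega> (ap (P t g)) (S t (ap g))"
  and P_right_continuous_0: "g \<in> C0 \<Omega> \<Longrightarrow> ((\<lambda>t. P t g) \<longlongrightarrow> g) (at_right 0)"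
  using P_spec by (auto simp: C0_part_def)

lemma ip_P: "t \<ge> 0 \<Longrightarrow> g \<in> C0 \<Omega> \<Longrightarrow> p \<in> L2 \<Omega> \<Longrightarrow>
    ip (ap (P t g)) p = ip (S t (ap g)) p"
  by (intro ip_cong_AE P_S L2_bcontfun S_L2)

lemma C0_lin: "g \<in> C0 \<Omega> \<Longrightarrow> h \<in> C0 \<Omega> \<Longrightarrow> a *\<^sub>R g + b *\<^sub>R h \<in> C0 \<Omega>"
  using subspace_C0 by (simp add: subspace_add subspace_scale)

lemma C0_diff: "g \<in> C0 \<Omega> \<Longrightarrow> h \<in> C0 \<Omega> \<Longrightarrow> g - h \<in> C0 \<Omega>"
  using subspace_C0 by (simp add: subspace_diff)

lemma P_lin:
  assumes "t \<ge> 0" "g \<in> C0 \<Omega>" "h \<in> C0 \<Omega>"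
  shows "P t (a *\<^sub>R g + b *\<^sub>R h) = a *\<^sub>R P t g + b *\<^sub>R P t h"
proof (rule C0_eqI)
  fix p assume p: "p \<in> L2 \<Omega>"
  show "ip (ap (P t (a *\<^sub>R g + b *\<^sub>R h))) p = ip (ap (a *\<^sub>R P t g + b *\<^sub>R P t h)) p"
    using assms p
    by (simp add: ip_P C0_lin plus_bcontfun.rep_eq scaleR_bcontfun.rep_eq S_lin L2_bcontfun ip_lin)
qed (use assms in \<open>auto intro!: C0_lin P_C0\<close>)

lemma P_diff: "t \<ge> 0 \<Longrightarrow> g \<in> C0 \<Omega> \<Longrightarrow> h \<in> C0 \<Omega> \<Longrightarrow> P t (g - h) = P t g - P t h"
  using P_lin[of t g h 1 "-1"] by simp

lemma P_add:
  assumes "s \<ge> 0" "t \<ge> 0" "g \<in> C0 \<Omega>"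
  shows "P (s + t) g = P s (P t g)"
proof (rule C0_eqI)
  fix p assume p: "p \<in> L2 \<Omega>"
  have "ip (S s (ap (P t g))) p = ip (S s (S t (ap g))) p"
    using assms p by (intro S_cong P_S) (auto intro: L2_bcontfun S_L2)
  then show "ip (ap (P (s + t) g)) p = ip (ap (P s (P t g))) p"
    using assms p by (simp add: ip_P P_C0 S_add L2_bcontfun)
qed (use assms in \<open>auto intro!: P_C0\<close>)

lemma P_0: "g \<in> C0 \<Omega> \<Longrightarrow> P 0 g = g"
  by (rule C0_eqI) (auto simp: ip_P P_C0 S_0 L2_bcontfun)

text \<open>For equal data, the semigroup law and contractivity reduce the difference between the
  times \<open>s\<close> and \<open>t\<close> to an increment from time 0; changing the datum costs
  at most \<open>norm (g - h)\<close>. As the increment concerns the single element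
  \<open>h\<close>, joint continuity follows from strong continuity at 0.\<close>

lemma P_mod:
  assumes "s \<ge> 0" "t \<ge> 0" "g \<in> C0 \<Omega>" "h \<in> C0 \<Omega>"
  shows "norm (P t g - P s h) \<le> norm (g - h) + norm (P \<bar>t - s\<bar> h - h)"
proof -
  have gen: "norm (P t h - P s h) \<le> norm (P (t - s) h - h)" if "s \<ge> 0" "s \<le> t" for s t
    using that assms P_add[of s "t - s" h] P_norm[of s "P (t - s) h - h"]
    by (simp add: P_diff P_C0 C0_diff)
  have "norm (P t h - P s h) \<le> norm (P \<bar>t - s\<bar> h - h)"
    using gen[of s t] gen[of t s] assms by (cases "s \<le> t") (auto simp: norm_minus_commute)
  moreover have "norm (P t g - P t h) \<le> norm (g - h)"
    using assms P_norm[of t "g - h"] by (simp add: P_diff C0_diff)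
  moreover have "norm (P t g - P s h) \<le> norm (P t g - P t h) + norm (P t h - P s h)"
    using norm_triangle_ineq[of "P t g - P t h" "P t h - P s h"] by simp
  ultimately show ?thesis by simp
qed

lemma tendsto_P:
  assumes g: "(g \<longlongrightarrow> g0) F" and r: "(r \<longlongrightarrow> r0) F" and r0: "r0 \<ge> 0" "\<forall>\<^sub>F z in F. r z \<ge> 0"
    and C: "g0 \<in> C0 \<Omega>" "\<forall>\<^sub>F z in F. g z \<in> C0 \<Omega>"
  shows "((\<lambda>z. P (r z) (g z)) \<longlongrightarrow> P r0 g0) F"
proof (rule LIM_zero_cancel, rule Lim_null_comparison)
  \<comment> \<open>Strong continuity is one-sided; inserting \<open>\<bar>t\<bar>\<close> turns it
    into a two-sided limit that can be composed with \<open>r z - r0\<close> of either sign.\<close>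
  have "((\<lambda>t. P \<bar>t\<bar> g0) \<longlongrightarrow> g0) (at 0)"
  proof (rule filterlim_split_at)
    show "((\<lambda>t. P \<bar>t\<bar> g0) \<longlongrightarrow> g0) (at_right 0)"
      by (rule Lim_transform_eventually[OF P_right_continuous_0[OF C(1)]])
        (auto simp: eventually_at_filter)
    have "((\<lambda>t. P (- t) g0) \<longlongrightarrow> g0) (at_left 0)"
      using P_right_continuous_0[OF C(1)] filterlim_at_left_to_right[of "\<lambda>t. P (- t) g0" "nhds g0" 0]
      by simp
    then show "((\<lambda>t. P \<bar>t\<bar> g0) \<longlongrightarrow> g0) (at_left 0)"
      by (rule Lim_transform_eventually) (auto simp: eventually_at_filter)
  qed
  then have "isCont (\<lambda>t. P \<bar>t\<bar> g0) 0"
    by (simp add: isCont_def P_0[OF C(1)])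
  moreover have "((\<lambda>z. r z - r0) \<longlongrightarrow> 0) F" using r by (simp add: LIM_zero_iff)
  ultimately have "((\<lambda>z. P \<bar>r z - r0\<bar> g0) \<longlongrightarrow> P \<bar>0\<bar> g0) F"
    by (rule isCont_tendsto_compose)
  then have "((\<lambda>z. norm (P \<bar>r z - r0\<bar> g0 - g0)) \<longlongrightarrow> 0) F"
    using tendsto_norm_zero LIM_zero by (simp add: P_0[OF C(1)]) blast
  moreover have "((\<lambda>z. norm (g z - g0)) \<longlongrightarrow> 0) F"
    using g tendsto_norm_zero LIM_zero by blast
  ultimately show "((\<lambda>z. norm (g z - g0) + norm (P \<bar>r z - r0\<bar> g0 - g0)) \<longlongrightarrow> 0) F"
    using tendsto_add by fastforce
  show "\<forall>\<^sub>F z in F. norm (P (r z) (g z) - P r0 g0) \<le> norm (g z - g0) + norm (P \<bar>r z - r0\<bar> g0 - g0)"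
    using r0(2) C(2) by eventually_elim (use P_mod r0(1) C(1) in blast)
qed

lemma continuous_on_P:
  assumes "continuous_on A r" "continuous_on A g" "\<And>z. z \<in> A \<Longrightarrow> r z \<ge> 0" "\<And>z. z \<in> A \<Longrightarrow> g z \<in> C0 \<Omega>"
  shows "continuous_on A (\<lambda>z. P (r z) (g z))"
  unfolding continuous_on_def
proof
  fix z assume "z \<in> A"
  then show "((\<lambda>z. P (r z) (g z)) \<longlongrightarrow> P (r z) (g z)) (at z within A)"
    using assms by (intro tendsto_P) (auto simp: continuous_on_def eventually_at_filter)
qed

text \<open>Contractivity beyond \<open>C0 \<Omega>\<close>: on that space it is the bound for
  \<open>P\<close>, and it passes to the limit along \<open>C0_dense\<close>, whose approximants do
  not exceed \<open>norm g\<close>.\<close>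

lemma ip_S_le:
  assumes t: "t \<ge> 0" and p: "p \<in> L2 \<Omega>"
  shows "\<bar>ip (S t (ap g)) p\<bar> \<le> norm g * L1 p"
proof -
  obtain g' where g': "\<And>k. g' k \<in> C0 \<Omega>" "\<And>k. norm (g' k :: 'a \<Rightarrow>\<^sub>C real) \<le> norm g"
    "(\<lambda>k. L2_norm \<Omega> (\<lambda>x. ap (g' k) x - ap g x)) \<longlonglongrightarrow> 0"
    using C0_dense by blast
  have "(\<lambda>k. ip (S t (ap (g' k))) p) \<longlonglongrightarrow> ip (S t (ap g)) p"
    by (rule S_tendsto[OF t g'(3)]) (auto simp: L2_bcontfun p)
  then have "(\<lambda>k. \<bar>ip (S t (ap (g' k))) p\<bar>) \<longlonglongrightarrow> \<bar>ip (S t (ap g)) p\<bar>"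
    by (rule tendsto_rabs)
  then show ?thesis
  proof (rule LIMSEQ_le_const2)
    have "\<bar>ip (S t (ap (g' k))) p\<bar> \<le> norm g * L1 p" for k
    proof -
      have "\<bar>ip (ap (P t (g' k))) p\<bar> \<le> norm (P t (g' k)) * L1 p"
        by (rule ip_bcontfun_le[OF p])
      also have "\<dots> \<le> norm g * L1 p"
        using P_norm[OF t g'(1)] g'(2) by (intro mult_right_mono L1_nonneg) (rule order_trans)
      finally show ?thesis using ip_P[OF t g'(1) p] by simp
    qed
    then show "\<exists>N. \<forall>n\<ge>N. \<bar>ip (S t (ap (g' n))) p\<bar> \<le> norm g * L1 p" by blast
  qed
qed

text \<open>The integrand is a pointwise limit of functions that come from
  \<open>C0 \<Omega>\<close> and are therefore continuous in \<open>s\<close>, with the common bound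
  \<open>norm g * L1 p\<close>.\<close>

lemma ip_S_integrable:
  assumes p: "p \<in> L2 \<Omega>" and "a \<ge> 0"
  shows "(\<lambda>s. ip (S s (ap g)) p) integrable_on {a..b}"
proof -
  obtain g' where g': "\<And>k. g' k \<in> C0 \<Omega>" "\<And>k. norm (g' k :: 'a \<Rightarrow>\<^sub>C real) \<le> norm g"
    "(\<lambda>k. L2_norm \<Omega> (\<lambda>x. ap (g' k) x - ap g x)) \<longlonglongrightarrow> 0"
    using C0_dense by blast
  show ?thesis
  proof (rule dominated_convergence(1))
    show "(\<lambda>s. ip (S s (ap (g' k))) p) integrable_on {a..b}" for k
    proof (rule integrable_eq)
      show "(\<lambda>s. ip (ap (P s (g' k))) p) integrable_on {a..b}"
        using g'(1) assms(2)
        by (intro integrable_continuous_real bounded_linear.continuous_on[OF bounded_linear_ip[OF p]]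
            continuous_on_P continuous_intros) auto
    qed (use g'(1) assms in \<open>auto simp: ip_P\<close>)
    show "(\<lambda>s. norm g * L1 p) integrable_on {a..b}" by (rule integrable_const_ivl)
    show "norm (ip (S s (ap (g' k))) p) \<le> norm g * L1 p" if "s \<in> {a..b}" for k s
      using ip_S_le[of s p "g' k"] that assms g'(2)[of k] L1_nonneg[of p]
      by (auto intro: order_trans mult_right_mono)
    show "(\<lambda>k. ip (S s (ap (g' k))) p) \<longlonglongrightarrow> ip (S s (ap g)) p"
      if "s \<in> {a..b}" for s
      using that assms by (intro S_tendsto[OF _ g'(3)]) (auto simp: L2_bcontfun)
  qed
qed

section \<open>Functions whose time-integrated orbit lies in \<open>C0 \<Omega>\<close>\<close>

abbreviation acc :: "real \<Rightarrow> ('a \<Rightarrow>\<^sub>C real) \<Rightarrow> ('a \<Rightarrow> real) \<Rightarrow> real" where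
  "acc t g p \<equiv> integral {0..t} (\<lambda>s. ip (S s (ap g)) p)"

text \<open>The time integral of the orbit of \<open>g\<close> is known only through its pairings
  \<open>acc t g p\<close>; the condition is that these come from an element of
  \<open>C0 \<Omega>\<close>, although \<open>g\<close> itself need not vanish on the
  boundary.\<close>

definition X :: "('a \<Rightarrow>\<^sub>C real) set" where
  "X = {g. \<forall>t\<ge>0. \<exists>W\<in>C0 \<Omega>. \<forall>p\<in>L2 \<Omega>.
         acc t g p = ip (ap W) p}"

lemma integral_C0:
  assumes "f integrable_on A" "\<And>s. s \<in> A \<Longrightarrow> f s \<in> C0 \<Omega>"
  shows "integral A f \<in> C0 \<Omega>"
  unfolding C0_iff[OF open_dom]
proof (intro allI impI)
  fix x assume x: "x \<notin> \<Omega>"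
  have "ap (integral A f) x = integral A (\<lambda>s. ap (f s) x)"
    using integral_linear[OF assms(1) bounded_linear_apply_bcontfun] by (simp add: o_def)
  also have "\<dots> = integral A (\<lambda>s. 0)"
    using assms(2) x C0_zero[OF _ open_dom] by (intro integral_cong) blast
  finally show "ap (integral A f) x = 0" by simp
qed

text \<open>Here the orbit \<open>P s g\<close> is norm continuous, and its ordinary integral is the
  required element.\<close>

lemma X_C0: "C0 \<Omega> \<subseteq> X"
  unfolding X_def
proof (intro subsetI CollectI allI impI)
  fix g t assume g: "g \<in> C0 \<Omega>" and t: "(t::real) \<ge> 0"
  have i: "(\<lambda>s. P s g) integrable_on {0..t}"
    using g by (intro integrable_continuous_real continuous_on_P continuous_intros) auto
  show "\<exists>W\<in>C0 \<Omega>. \<forall>p\<in>L2 \<Omega>. acc t g p = ip (ap W) p"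
  proof (intro bexI ballI)
    show "integral {0..t} (\<lambda>s. P s g) \<in> C0 \<Omega>"
      by (rule integral_C0[OF i]) (use g P_C0 in auto)
    fix p assume p: "p \<in> L2 \<Omega>"
    have "acc t g p = integral {0..t} (\<lambda>s. ip (ap (P s g)) p)"
      using g p by (intro integral_cong) (simp add: ip_P)
    also have "\<dots> = ip (ap (integral {0..t} (\<lambda>s. P s g))) p"
      using integral_linear[OF i bounded_linear_ip[OF p]] by (simp add: o_def)
    finally show "acc t g p = \<dots>" .
  qed
qed

lemma ip_S_bcontfun_lin:
  assumes "t \<ge> 0" "p \<in> L2 \<Omega>"
  shows "ip (S t (ap (a *\<^sub>R g + b *\<^sub>R h))) p =
     a * ip (S t (ap g)) p + b * ip (S t (ap h)) p"
  using S_lin[OF assms(1) L2_bcontfun[of g] L2_bcontfun[of h] assms(2)]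
  by (simp add: plus_bcontfun.rep_eq scaleR_bcontfun.rep_eq)

lemma integral_ip_S_lin:
  assumes "p \<in> L2 \<Omega>"
  shows "acc t (a *\<^sub>R g + b *\<^sub>R h) p =
     a * acc t g p + b * acc t h p"
proof -
  have "acc t (a *\<^sub>R g + b *\<^sub>R h) p =
      integral {0..t} (\<lambda>s. a * ip (S s (ap g)) p + b * ip (S s (ap h)) p)"
    using assms by (intro integral_cong ip_S_bcontfun_lin) auto
  also have "\<dots> = a * acc t g p + b * acc t h p"
    using ip_S_integrable[OF assms]
    by (subst integral_add) (auto intro: integrable_on_mult_right)
  finally show ?thesis .
qed

lemma X_lin:
  assumes "g \<in> X" "h \<in> X"
  shows "a *\<^sub>R g + b *\<^sub>R h \<in> X"
  unfolding X_def
proof (intro CollectI allI impI)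
  fix t :: real assume t: "t \<ge> 0"
  obtain W V where "W \<in> C0 \<Omega>" "V \<in> C0 \<Omega>"
    "\<forall>p\<in>L2 \<Omega>. acc t g p = ip (ap W) p"
    "\<forall>p\<in>L2 \<Omega>. acc t h p = ip (ap V) p"
    using assms t unfolding X_def by blast
  then show "\<exists>W\<in>C0 \<Omega>. \<forall>p\<in>L2 \<Omega>.
      acc t (a *\<^sub>R g + b *\<^sub>R h) p = ip (ap W) p"
    by (intro bexI[of _ "a *\<^sub>R W + b *\<^sub>R V"] ballI)
      (simp_all add: integral_ip_S_lin ip_lin L2_bcontfun C0_lin del: plus_bcontfun.rep_eq scaleR_bcontfun.rep_eq,
       simp add: ip_lin L2_bcontfun)
qed

lemma subspace_X: "subspace X"
proof (rule subspaceI)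
  have z: "0 \<in> X" using X_C0 subspace_C0 subspace_0 by blast
  then show "0 \<in> X" .
  show "x + y \<in> X" if "x \<in> X" "y \<in> X" for x y using X_lin[OF that, of 1 1] by simp
  show "c *\<^sub>R x \<in> X" if "x \<in> X" for x c using X_lin[OF that z, of c 0] by simp
qed

lemma integral_ip_S_le:
  assumes "p \<in> L2 \<Omega>" "0 \<le> a" "a \<le> b"
  shows "\<bar>integral {a..b} (\<lambda>s. ip (S s (ap g)) p)\<bar> \<le> (b - a) * norm g * L1 p"
proof -
  have "norm (integral {a..b} (\<lambda>s. ip (S s (ap g)) p)) \<le> integral {a..b} (\<lambda>s. norm g * L1 p)"
    using assms by (intro integral_norm_bound_integral ip_S_integrable) (auto intro: ip_S_le)
  also have "\<dots> = (b - a) * norm g * L1 p" using assms by simp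
  finally show ?thesis by simp
qed

text \<open>By \<open>norm_le_of_ip\<close>, the representing element depends on \<open>g\<close>
  with norm at most \<open>t\<close>. For a convergent sequence in \<open>X\<close> the representing
  elements are thus Cauchy in the sup norm, and their limit represents the limit.\<close>

lemma closed_X: "closed X"
  unfolding closed_sequential_limits
proof (intro allI impI)
  fix g l assume "(\<forall>n. g n \<in> X) \<and> g \<longlonglongrightarrow> l"
  then have gX: "\<And>n. g n \<in> X" and lim: "g \<longlonglongrightarrow> l" by auto
  show "l \<in> X"
    unfolding X_def
  proof (intro CollectI allI impI)
    fix t :: real assume t: "t \<ge> 0"
    have "\<exists>W. W \<in> C0 \<Omega> \<and> (\<forall>p\<in>L2 \<Omega>. acc t (g n) p = ip (ap W) p)" for n
      using gX[of n] t unfolding X_def by blast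
    then obtain W where W: "\<And>n. W n \<in> C0 \<Omega>"
      "\<And>n p. p \<in> L2 \<Omega> \<Longrightarrow> acc t (g n) p = ip (ap (W n)) p"
      by metis
    have d: "norm (W m - W n) \<le> t * norm (g m - g n)" for m n
    proof (rule norm_le_of_ip)
      fix p assume p: "p \<in> L2 \<Omega>"
      have "ip (ap (W m - W n)) p = acc t (g m - g n) p"
        using integral_ip_S_lin[OF p, of t 1 "g m" "-1" "g n"] W(2)[OF p]
        by (simp add: minus_bcontfun.rep_eq ip_diff L2_bcontfun p)
      then show "\<bar>ip (ap (W m - W n)) p\<bar> \<le> t * norm (g m - g n) * L1 p"
        using integral_ip_S_le[OF p order_refl t, of "g m - g n"] by simp
    qed (use W(1) t in \<open>auto intro: C0_diff\<close>)
    have "Cauchy W"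
    proof (rule CauchyI)
      fix e :: real assume e: "e > 0"
      have "Cauchy g" using lim by (rule LIMSEQ_imp_Cauchy)
      then obtain M where M: "\<And>m n. m \<ge> M \<Longrightarrow> n \<ge> M \<Longrightarrow> norm (g m - g n) < e / (t + 1)"
        using CauchyD[of g "e / (t + 1)"] e t by auto
      show "\<exists>M. \<forall>m\<ge>M. \<forall>n\<ge>M. norm (W m - W n) < e"
      proof (intro exI allI impI)
        fix m n assume "m \<ge> M" "n \<ge> M"
        have "norm (W m - W n) \<le> t * norm (g m - g n)" by (rule d)
        also have "\<dots> \<le> t * (e / (t + 1))"
          using M[OF \<open>m \<ge> M\<close> \<open>n \<ge> M\<close>] t by (intro mult_left_mono) auto
        also have "\<dots> < e" using e t by (simp add: field_simps)
        finally show "norm (W m - W n) < e" .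
      qed
    qed
    then obtain V where V: "W \<longlonglongrightarrow> V" by (auto simp: Cauchy_convergent_iff convergent_def)
    show "\<exists>W\<in>C0 \<Omega>. \<forall>p\<in>L2 \<Omega>. acc t l p = ip (ap W) p"
    proof (intro bexI ballI)
      show "V \<in> C0 \<Omega>"
        using closed_C0 V W(1) by (auto simp: closed_sequential_limits)
      fix p assume p: "p \<in> L2 \<Omega>"
      have "(\<lambda>n. acc t (g n) p) \<longlonglongrightarrow> ip (ap V) p"
        unfolding W(2)[OF p] by (rule bounded_linear.tendsto[OF bounded_linear_ip[OF p] V])
      moreover have "(\<lambda>n. acc t (g n) p) \<longlonglongrightarrow>
          acc t l p"
      proof (rule LIM_zero_cancel, rule Lim_null_comparison)
        have "(\<lambda>n. norm (g n - l)) \<longlonglongrightarrow> 0"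
          using lim LIM_zero tendsto_norm_zero by blast
        then show "(\<lambda>n. (t - 0) * norm (g n - l) * L1 p) \<longlonglongrightarrow> 0"
          by (intro tendsto_mult_left_zero tendsto_mult_right_zero)
        show "\<forall>\<^sub>F n in sequentially. norm (acc t (g n) p -
          acc t l p) \<le> (t - 0) * norm (g n - l) * L1 p"
        proof (intro always_eventually allI)
          fix n
          have "acc t (g n - l) p =
            acc t (g n) p - acc t l p"
            using integral_ip_S_lin[OF p, of t 1 "g n" "-1" l] by simp
          then show "norm (acc t (g n) p -
            acc t l p) \<le> (t - 0) * norm (g n - l) * L1 p"
            using integral_ip_S_le[OF p order_refl t, of "g n - l"] by simp
        qed
      qed
      ultimately show "acc t l p = ip (ap V) p"
        by (rule LIMSEQ_unique[symmetric])
    qed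
  qed
qed

text \<open>The fundamental theorem of calculus in weak form, with \<open>P T u - u\<close> as the
  integral. Paired with \<open>p\<close>, the orbit of \<open>u\<close> has right derivative
  \<open>G\<close>; so has the indefinite integral of \<open>G\<close>, because \<open>G\<close> is
  right-continuous. The difference is constant by
  \<open>right_derivative_zero_imp_const\<close>.\<close>

lemma X_generator:
  assumes u: "u \<in> C0 \<Omega>" and gen: "L2_generator \<Omega> S (ap u) (ap g)"
  shows "g \<in> X"
  unfolding X_def
proof (intro CollectI allI impI)
  fix T :: real assume T: "T \<ge> 0"
  show "\<exists>W\<in>C0 \<Omega>. \<forall>p\<in>L2 \<Omega>. acc T g p = ip (ap W) p"
  proof (intro bexI ballI)
    show "P T u - u \<in> C0 \<Omega>" by (intro C0_diff P_C0 T u)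
    fix p assume p: "p \<in> L2 \<Omega>"
    define G where "G s = ip (S s (ap g)) p" for s
    define F where "F s = ip (ap (P s u)) p" for s
    have Gi: "G integrable_on {a..b}" if "a \<ge> 0" for a b
      unfolding G_def by (rule ip_S_integrable[OF p that])
    have Fd: "(F has_real_derivative G s) (at_right s)" if s: "s \<ge> 0" for s
      unfolding has_field_derivative_iff filterlim_at_right_to_0[of _ _ s]
    proof (rule Lim_transform_eventually)
      show "((\<lambda>h. ip (S s (\<lambda>x. (S h (ap u) x - ap u x) / h)) p) \<longlongrightarrow> G s) (at_right 0)"
        unfolding G_def
      proof (rule S_tendsto[OF s _ _ L2_bcontfun p])
        show "((\<lambda>h. L2_norm \<Omega> (\<lambda>x. (S h (ap u) x - ap u x) / h - ap g x)) \<longlongrightarrow> 0) (at_right 0)"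
          using gen by (simp add: L2_generator_def)
        show "\<forall>\<^sub>F h in at_right 0. (\<lambda>x. (S h (ap u) x - ap u x) / h) \<in> L2 \<Omega>"
          unfolding eventually_at_filter
          by (intro always_eventually allI impI)
            (use L2_cmult[OF L2_diff[OF S_L2[OF _ L2_bcontfun] L2_bcontfun]] in \<open>auto simp: divide_inverse mult.commute\<close>)
      qed
      show "\<forall>\<^sub>F h in at_right 0. ip (S s (\<lambda>x. (S h (ap u) x - ap u x) / h)) p =
          (F (h + s) - F s) / (h + s - s)"
        unfolding eventually_at_filter
      proof (intro always_eventually allI impI)
        fix h :: real assume "h \<noteq> 0" "h \<in> {0<..}"
        then have h: "h > 0" by simp
        have "(\<lambda>x. (S h (ap u) x - ap u x) / h) =
           (\<lambda>x. (1 / h) * S h (ap u) x + (- 1 / h) * ap u x)"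
          using h by (auto simp: field_simps)
        then have "ip (S s (\<lambda>x. (S h (ap u) x - ap u x) / h)) p =
            (1 / h) * ip (S s (S h (ap u))) p + (- 1 / h) * ip (S s (ap u)) p"
          using S_lin[OF s S_L2[OF _ L2_bcontfun] L2_bcontfun p, of h "1 / h" u "- 1 / h" u] h by simp
        also have "ip (S s (S h (ap u))) p = F (h + s)"
          using S_add[OF s, of h "ap u" p] h s p u
          by (simp add: F_def ip_P L2_bcontfun add.commute)
        also have "ip (S s (ap u)) p = F s"
          using s u p by (simp add: F_def ip_P)
        finally show "ip (S s (\<lambda>x. (S h (ap u) x - ap u x) / h)) p =
          (F (h + s) - F s) / (h + s - s)"
          by (simp add: diff_divide_distrib)
      qed
    qed
    have Gr: "(G \<longlongrightarrow> G s) (at_right s)" if s: "s \<ge> 0" for s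
      unfolding filterlim_at_right_to_0[of _ _ s]
    proof (rule Lim_transform_eventually)
      show "((\<lambda>h. ip (S s (S h (ap g))) p) \<longlongrightarrow> G s) (at_right 0)"
        unfolding G_def
        by (rule S_tendsto[OF s S_right_continuous_0[OF L2_bcontfun] _ L2_bcontfun p])
          (auto simp: eventually_at_filter S_L2 L2_bcontfun)
      show "\<forall>\<^sub>F h in at_right 0. ip (S s (S h (ap g))) p = G (h + s)"
        using s p by (auto simp: eventually_at_filter G_def S_add[symmetric] L2_bcontfun add.commute)
    qed
    define J where "J x = integral {0..x} G" for x
    have "F T - J T = F 0 - J 0"
    proof (rule right_derivative_zero_imp_const[OF T])
      have "continuous_on {0..T} F"
        unfolding F_def using u
        by (intro bounded_linear.continuous_on[OF bounded_linear_ip[OF p]] continuous_on_P continuous_intros) auto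
      moreover have "continuous_on {0..T} J"
        unfolding J_def by (rule indefinite_integral_continuous_1[OF Gi]) simp
      ultimately show "continuous_on {0..T} (\<lambda>x. F x - J x)"
        by (rule continuous_on_diff)
      fix s assume s: "0 \<le> s" "s < T"
      have "((\<lambda>x. integral {s..x} G) has_vector_derivative G s) (at s within ({s..T} - {}))"
        by (rule integral_has_vector_derivative_continuous_at[OF Gi])
          (use s Gr[OF s(1)] in \<open>auto simp: continuous_within at_within_Icc_at_right\<close>)
      then have "((\<lambda>x. J s + integral {s..x} G) has_real_derivative 0 + G s) (at s within {s..T})"
        by (intro DERIV_add DERIV_const) (simp add: has_real_derivative_iff_has_vector_derivative)
      then have "(J has_real_derivative 0 + G s) (at s within {s..T})"
      proof (rule has_field_derivative_transform_within[of _ _ _ _ 1])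
        show "J s + integral {s..x} G = J x" if "x \<in> {s..T}" for x
          unfolding J_def using that s by (intro Henstock_Kurzweil_Integration.integral_combine Gi) auto
      qed (use s in auto)
      then have "(J has_real_derivative 0 + G s) (at_right s)"
        using s by (simp add: at_within_Icc_at_right)
      from DERIV_diff[OF Fd[OF s(1)] this]
      show "((\<lambda>x. F x - J x) has_real_derivative 0) (at_right s)" by simp
    qed
    then have "J T = F T - F 0" by (simp add: J_def)
    then show "acc T g p = ip (ap (P T u - u)) p"
      by (simp add: J_def G_def[abs_def] F_def P_0[OF u] minus_bcontfun.rep_eq ip_diff L2_bcontfun p)
  qed
qed

end

section \<open>Boundary charts\<close>

lemma compact_support_bounded:
  fixes f :: "'a::euclidean_space \<Rightarrow> real"
  assumes "continuous_on UNIV f" "compact K" "\<And>x. x \<notin> K \<Longrightarrow> f x = 0"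
  shows "\<exists>M\<ge>0. \<forall>x. \<bar>f x\<bar> \<le> M"
proof -
  have "bounded (f ` K)"
    using assms by (intro compact_imp_bounded compact_continuous_image continuous_on_subset[OF assms(1)]) auto
  then obtain M where M: "\<And>x. x \<in> K \<Longrightarrow> \<bar>f x\<bar> \<le> M" by (auto simp: bounded_iff)
  show ?thesis
  proof (intro exI conjI allI)
    show "\<bar>f x\<bar> \<le> max M 0" for x using M[of x] assms(3)[of x] by (cases "x \<in> K") auto
  qed simp
qed

lemma compact_support_bcontfun:
  fixes f :: "'a::euclidean_space \<Rightarrow> real"
  assumes "continuous_on UNIV f" "compact K" "\<And>x. x \<notin> K \<Longrightarrow> f x = 0"
  shows "f \<in> bcontfun"
proof -
  obtain M where "\<And>x. \<bar>f x\<bar> \<le> M" using compact_support_bounded[OF assms] by blast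
  then show ?thesis by (intro bcontfun_normI[OF assms(1), of M]) simp
qed

lemma apply_Bcontfun: "f \<in> bcontfun \<Longrightarrow> ap (Bcontfun f) = f"
  by (rule Bcontfun_inverse)

lemma grad_inner: "b \<in> Basis \<Longrightarrow> grad f x \<bullet> b = pd b f x"
  by (simp add: grad_def)

lemma test_fun_support:
  assumes "\<phi> \<in> test_fun V"
  shows "\<exists>K. compact K \<and> K \<subseteq> V \<and> (\<forall>x. x \<notin> K \<longrightarrow> \<phi> x = 0)"
  using assms closure_subset[of "{x. \<phi> x \<noteq> 0}"]
  by (intro exI[of _ "closure {x. \<phi> x \<noteq> 0}"]) (auto simp: test_fun_def)

text \<open>The derivative is continuous across 0, which makes the truncated functions
  \<open>w\<close> of a chart continuously differentiable on the whole space.\<close>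

lemma half_square_pos_derivative:
  "((\<lambda>s::real. (max 0 s)\<^sup>2 / 2) has_real_derivative max 0 s) (at s)"
proof -
  consider "s < 0" | "s = 0" | "s > 0" by linarith
  then show ?thesis
  proof cases
    case 1
    show ?thesis
      by (rule has_field_derivative_transform_within_open[of "\<lambda>s. 0" _ _ "{..<0}"]) (use 1 in auto)
  next
    case 2
    have "((\<lambda>h::real. max 0 h / 2) \<longlongrightarrow> max 0 0 / 2) (at 0)"
      by (intro tendsto_intros) auto
    then have "((\<lambda>h::real. ((max 0 (0 + h))\<^sup>2 / 2 - (max 0 0)\<^sup>2 / 2) / h) \<longlongrightarrow> max 0 0 / 2) (at 0)"
      by (rule Lim_transform_eventually) (auto simp: eventually_at_filter max_def power2_eq_square)
    with 2 show ?thesis by (simp add: DERIV_def)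
  next
    case 3
    show ?thesis
      by (rule has_field_derivative_transform_within_open[of "\<lambda>s. s\<^sup>2 / 2" _ _ "{0<..}"])
        (use 3 in \<open>auto intro!: derivative_eq_intros\<close>)
  qed
qed

definition laplacian :: "('a::euclidean_space \<Rightarrow> real) \<Rightarrow> 'a \<Rightarrow> real" where
  "laplacian q x = (\<Sum>b\<in>Basis. pd b (pd b q) x)"

lemma Ck2_laplacian_continuous: "Ck 2 q \<Longrightarrow> continuous_on S (laplacian q)"
  unfolding laplacian_def[abs_def]
proof (rule continuous_on_sum)
  fix b :: 'a assume "Ck 2 q" "b \<in> Basis"
  then show "continuous_on S (pd b (pd b q))"
    by (intro Ck_continuous[of 0]) (simp add: numeral_2_eq_2)
qed

context bounded_domain
begin

lemma integral_dom_compact_support: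
  fixes f :: "'a \<Rightarrow> real"
  assumes "continuous_on UNIV f" "compact K" "K \<subseteq> \<Omega>" "\<And>x. x \<notin> K \<Longrightarrow> f x = 0"
  shows "(\<integral>x. f x \<partial>leb) = integral UNIV f"
proof -
  have "integrable leb f"
    using compact_support_bounded[OF assms(1,2,4)] assms(1)
    by (auto intro: integrable_bounded continuous_measurable continuous_on_subset)
  then have "(\<integral>x. f x \<partial>leb) = integral \<Omega> f"
    by (rule lebesgue_integral_eq_integral) simp
  also have "\<dots> = integral UNIV (\<lambda>x. if x \<in> \<Omega> then f x else 0)"
    by (rule integral_restrict_UNIV[symmetric])
  also have "(\<lambda>x. if x \<in> \<Omega> then f x else 0) = f"
    using assms(3,4) by (intro ext) auto
  finally show ?thesis .
qed

text \<open>Summed over the basis, the integrand is the divergence of \<open>\<phi>\<close> times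
  the gradient of \<open>q\<close>. Its integral vanishes because \<open>\<phi>\<close> has compact
  support in \<open>\<Omega>\<close>.\<close>

lemma weak_laplacian:
  assumes q: "Ck 2 q" and \<phi>: "\<phi> \<in> test_fun \<Omega>"
  shows "(\<integral>x. grad q x \<bullet> grad \<phi> x \<partial>leb) = - (\<integral>x. laplacian q x * \<phi> x \<partial>leb)"
proof -
  obtain K where K: "compact K" "K \<subseteq> \<Omega>" "\<And>x. x \<notin> K \<Longrightarrow> \<phi> x = 0"
    using test_fun_support[OF \<phi>] by blast
  have \<phi>k: "Ck k \<phi>" for k using \<phi> by (simp add: test_fun_def)
  have q1: "Ck (Suc 0) (pd b q)" if "b \<in> Basis" for b
    using q that by (simp add: numeral_2_eq_2)
  have q0: "Ck (Suc 0) q" using q by (rule Ck_mono) simp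
  have \<phi>0: "pd b \<phi> x = 0" if "x \<notin> K" for b x
    using that K by (intro pd_eq_0_outside[of K]) (auto simp: compact_imp_closed)
  have prod: "pd b (\<lambda>x. \<phi> x * pd b q x) x = \<phi> x * pd b (pd b q) x + pd b \<phi> x * pd b q x" if "b \<in> Basis" for b x
    by (rule pd_mult[OF Ck_differentiable[OF \<phi>k] Ck_differentiable[OF q1[OF that]]])
  have c: "continuous_on UNIV (pd b \<phi>)" "continuous_on UNIV (pd b q)" "continuous_on UNIV (pd b (pd b q))" if "b \<in> Basis" for b
    using Ck_continuous[OF Ck_pd[OF \<phi>k that]] Ck_continuous[OF q1[OF that]] Ck_continuous[OF Ck_pd[OF q1[OF that] that]] by auto
  have z: "(\<integral>x. pd b \<phi> x * pd b q x + \<phi> x * pd b (pd b q) x \<partial>leb) = 0" if b: "b \<in> Basis" for b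
  proof -
    have "(\<integral>x. pd b \<phi> x * pd b q x + \<phi> x * pd b (pd b q) x \<partial>leb) =
        integral UNIV (\<lambda>x. pd b \<phi> x * pd b q x + \<phi> x * pd b (pd b q) x)"
      using K \<phi>0 c[OF b] Ck_continuous[OF \<phi>k[of 0]]
      by (intro integral_dom_compact_support[of _ K] continuous_intros) auto
    also have "\<dots> = integral UNIV (pd b (\<lambda>x. \<phi> x * pd b q x))"
      using prod[OF b] by (simp add: add.commute)
    also have "\<dots> = 0"
      by (rule integral_unique, rule integral_pd_eq_0[OF Ck_mult[OF \<phi>k q1[OF b]] compact_imp_bounded[OF K(1)] _ b])
        (simp add: K(3))
    finally show ?thesis .
  qed
  have i: "integrable leb f" if "continuous_on UNIV f" "\<And>x. x \<notin> K \<Longrightarrow> f x = 0" for f :: "'a \<Rightarrow> real"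
    using compact_support_bounded[OF that(1) K(1) that(2)] that(1)
    by (auto intro: integrable_bounded continuous_measurable continuous_on_subset)
  have "grad q x \<bullet> grad \<phi> x + laplacian q x * \<phi> x = (\<Sum>b\<in>Basis. pd b \<phi> x * pd b q x + \<phi> x * pd b (pd b q) x)" for x
    by (subst euclidean_inner)
      (simp add: grad_inner laplacian_def sum.distrib sum_distrib_left sum_distrib_right mult.commute)
  moreover have "(\<integral>x. (\<Sum>b\<in>Basis. pd b \<phi> x * pd b q x + \<phi> x * pd b (pd b q) x) \<partial>leb) = 0"
  proof (subst Bochner_Integration.integral_sum)
    fix b :: 'a assume b: "b \<in> Basis"
    show "integrable leb (\<lambda>x. pd b \<phi> x * pd b q x + \<phi> x * pd b (pd b q) x)"
      using K(3) \<phi>0 c[OF b] Ck_continuous[OF \<phi>k[of 0]] by (intro i continuous_intros) auto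
  qed (simp add: z)
  ultimately have "(\<integral>x. grad q x \<bullet> grad \<phi> x + laplacian q x * \<phi> x \<partial>leb) = 0" by simp
  moreover have "integrable leb (\<lambda>x. grad q x \<bullet> grad \<phi> x)"
  proof (rule i)
    have "(\<lambda>x. grad q x \<bullet> grad \<phi> x) = (\<lambda>x. \<Sum>b\<in>Basis. pd b q x * pd b \<phi> x)"
      by (rule ext, subst euclidean_inner) (simp add: grad_inner)
    then show "continuous_on UNIV (\<lambda>x. grad q x \<bullet> grad \<phi> x)"
      by (simp only:) (intro continuous_intros c; simp)
    show "grad q x \<bullet> grad \<phi> x = 0" if "x \<notin> K" for x
      using that by (simp add: grad_def[of \<phi>] \<phi>0)
  qed
  moreover have "integrable leb (\<lambda>x. laplacian q x * \<phi> x)"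
    using K(3) Ck2_laplacian_continuous[OF q] Ck_continuous[OF \<phi>k[of 0]] by (intro i continuous_intros) auto
  ultimately show ?thesis by simp
qed

text \<open>\<open>\<Omega>\<close> has finite measure, so uniform convergence on it implies
  convergence in \<open>L2\<close>. The functions are compared inside \<open>\<Omega>\<close> only,
  hence \<open>G\<close> may be the gradient of another function that coincides with
  \<open>u\<close> there.\<close>

lemma H01_uniform_limit:
  assumes u: "continuous_on \<Omega> u" "u \<in> L2 \<Omega>" and G: "\<And>b. b \<in> Basis \<Longrightarrow> continuous_on \<Omega> (\<lambda>x. G x \<bullet> b)"
    "\<And>b. b \<in> Basis \<Longrightarrow> (\<lambda>x. G x \<bullet> b) \<in> L2 \<Omega>"
    and approx: "\<And>e. e > 0 \<Longrightarrow> \<exists>\<phi>\<in>test_fun \<Omega>. \<forall>x\<in>\<Omega>. \<bar>\<phi> x - u x\<bar> \<le> e \<and>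
        (\<forall>b\<in>Basis. \<bar>pd b \<phi> x - G x \<bullet> b\<bar> \<le> e)"
  shows "H01 \<Omega> u G"
proof -
  have "\<exists>\<phi>. \<phi> \<in> test_fun \<Omega> \<and> (\<forall>x\<in>\<Omega>. \<bar>\<phi> x - u x\<bar> \<le> 1 / real (Suc k) \<and>
        (\<forall>b\<in>Basis. \<bar>pd b \<phi> x - G x \<bullet> b\<bar> \<le> 1 / real (Suc k)))" for k
    using approx[of "1 / real (Suc k)"] by auto
  then obtain \<phi> where \<phi>: "\<And>k. \<phi> k \<in> test_fun \<Omega>"
    "\<And>k x. x \<in> \<Omega> \<Longrightarrow> \<bar>\<phi> k x - u x\<bar> \<le> 1 / real (Suc k)"
    "\<And>k x b. x \<in> \<Omega> \<Longrightarrow> b \<in> Basis \<Longrightarrow> \<bar>pd b (\<phi> k) x - G x \<bullet> b\<bar> \<le> 1 / real (Suc k)"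
    by metis
  have \<phi>k: "Ck j (\<phi> k)" for j k using \<phi>(1) by (simp add: test_fun_def)
  define m where "m = sqrt (measure lebesgue \<Omega>)"
  have lim: "(\<lambda>k. 1 / real (Suc k) * m) \<longlonglongrightarrow> 0"
    by (intro tendsto_mult_left_zero LIMSEQ_Suc lim_const_over_n)
  have conv: "(\<lambda>k. L2_norm \<Omega> (f k)) \<longlonglongrightarrow> 0"
    if "\<And>k. continuous_on \<Omega> (f k)" "\<And>k x. x \<in> \<Omega> \<Longrightarrow> \<bar>f k x\<bar> \<le> 1 / real (Suc k)" for f
    unfolding m_def[symmetric]
  proof (rule Lim_null_comparison[OF always_eventually lim], rule allI)
    fix k
    have "L2_norm \<Omega> (f k) \<le> 1 / real (Suc k) * m"
      unfolding m_def by (intro L2_norm_le_sup continuous_measurable that) auto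
    then show "norm (L2_norm \<Omega> (f k)) \<le> 1 / real (Suc k) * m"
      using L2_norm_nonneg by simp
  qed
  show ?thesis
    unfolding H01_def
  proof (intro conjI exI[of _ \<phi>] allI ballI u G \<phi>)
    show "(\<lambda>k. L2_norm \<Omega> (\<lambda>x. \<phi> k x - u x)) \<longlonglongrightarrow> 0"
      by (rule conv) (auto intro!: continuous_intros Ck_continuous[OF \<phi>k] u \<phi> simp del: of_nat_Suc)
    show "(\<lambda>k. L2_norm \<Omega> (\<lambda>x. grad (\<phi> k) x \<bullet> b - G x \<bullet> b)) \<longlonglongrightarrow> 0" if "b \<in> Basis" for b
      by (rule conv) (use that in \<open>auto simp: grad_inner intro!: continuous_intros Ck_continuous[OF Ck_pd[OF \<phi>k]] G \<phi> simp del: of_nat_Suc\<close>)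
  qed
qed

end

section \<open>Auxiliary functions in a boundary chart\<close>

locale graph_boundary_chart = bounded_domain \<Omega> for \<Omega> :: "'a::euclidean_space set" +
  fixes z e :: 'a and r :: real and \<gamma> :: "'a \<Rightarrow> real"
  assumes r: "r > 0" and e: "norm e = 1" and \<gamma>: "Ck 2 \<gamma>"
    and chart: "\<Omega> \<inter> ball z r = {x \<in> ball z r. \<gamma> (x - (x \<bullet> e) *\<^sub>R e) < x \<bullet> e}"
begin

definition rho :: "'a \<Rightarrow> real" where "rho x = x \<bullet> e - \<gamma> (x - (x \<bullet> e) *\<^sub>R e)"

lemma bounded_linear_proj: "bounded_linear (\<lambda>x. x - (x \<bullet> e) *\<^sub>R e)"
  unfolding linear_conv_bounded_linear[symmetric]
  by (auto intro!: linearI simp: algebra_simps inner_add_left)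

lemma Ck_rho: "Ck 2 rho"
  unfolding rho_def[abs_def] by (intro Ck_diff Ck_inner Ck_compose_linear[OF bounded_linear_proj \<gamma>])

lemma rho_pos_iff: "x \<in> ball z r \<Longrightarrow> rho x > 0 \<longleftrightarrow> x \<in> \<Omega>"
proof -
  assume x: "x \<in> ball z r"
  have "x \<in> \<Omega> \<inter> ball z r \<longleftrightarrow> \<gamma> (x - (x \<bullet> e) *\<^sub>R e) < x \<bullet> e"
    unfolding chart using x by simp
  then show ?thesis using x by (simp add: rho_def)
qed

text \<open>A positive value would put \<open>x\<close> into the open set \<open>\<Omega>\<close>,
  off its frontier; a negative value would persist in a neighbourhood, which would then miss
  \<open>\<Omega>\<close>.\<close>

lemma rho_frontier:
  assumes "x \<in> frontier \<Omega>" "x \<in> ball z r"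
  shows "rho x = 0"
proof (rule antisym)
  show "rho x \<le> 0"
    using assms open_dom rho_pos_iff[OF assms(2)] by (auto simp: frontier_def interior_open not_less[symmetric])
  show "0 \<le> rho x"
  proof (rule ccontr)
    assume "\<not> 0 \<le> rho x"
    have "open {y. rho y < 0}"
      using Ck_continuous[OF Ck_rho] by (intro open_Collect_less continuous_on_const) auto
    then have "open (ball z r \<inter> {y. rho y < 0})" by (intro open_Int open_ball)
    moreover have "x \<in> ball z r \<inter> {y. rho y < 0}" using assms(2) \<open>\<not> 0 \<le> rho x\<close> by auto
    moreover have "(ball z r \<inter> {y. rho y < 0}) \<inter> \<Omega> = {}" using rho_pos_iff by fastforce
    moreover have "x \<in> closure \<Omega>" using assms(1) by (simp add: frontier_def)
    ultimately show False by (metis disjoint_iff open_Int_closure_eq_empty)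
  qed
qed

definition sigma :: "'a \<Rightarrow> real" where "sigma x = (\<Sum>b\<in>Basis. (pd b rho x)\<^sup>2)"

lemma rho1: "Ck (Suc 0) rho"
  using Ck_rho by (rule Ck_mono) simp

lemma rho_differentiable: "rho differentiable at x"
  by (rule Ck_differentiable[OF rho1])

lemma continuous_sigma: "continuous_on S sigma"
  unfolding sigma_def[abs_def] by (intro continuous_intros Ck_continuous[OF Ck_pd[OF rho1]])

text \<open>The projection along \<open>e\<close> maps \<open>e\<close> to 0, so \<open>rho\<close>
  has derivative 1 in the direction \<open>e\<close>. This holds at every point, not only on the
  boundary, and permits division by \<open>sigma\<close> on the whole space.\<close>

lemma sigma_pos: "sigma x > 0"
proof (rule ccontr)
  assume "\<not> sigma x > 0"
  moreover have "sigma x \<ge> 0" unfolding sigma_def by (intro sum_nonneg) auto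
  ultimately have "sigma x = 0" by simp
  then have "pd b rho x = 0" if "b \<in> Basis" for b
    using that unfolding sigma_def by (subst (asm) sum_nonneg_eq_0_iff) auto
  then have "frechet_derivative rho (at x) e = 0"
    by (subst frechet_derivative_Basis[OF rho_differentiable]) simp
  moreover have "frechet_derivative rho (at x) e = 1"
  proof -
    define L where "L x = x - (x \<bullet> e) *\<^sub>R e" for x
    have L: "bounded_linear L" using bounded_linear_proj by (simp add: L_def[abs_def])
    have d\<gamma>: "\<gamma> differentiable at y" for y
      using \<gamma> by (simp add: numeral_2_eq_2)
    have "((\<lambda>x. x \<bullet> e - \<gamma> (L x)) has_derivative (\<lambda>h. h \<bullet> e - frechet_derivative \<gamma> (at (L x)) (L h))) (at x)"
      by (intro has_derivative_diff has_derivative_inner_left has_derivative_ident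
          has_derivative_compose[OF bounded_linear_imp_has_derivative[OF L] has_derivative_pd[OF d\<gamma>]])
    then have "frechet_derivative rho (at x) e = e \<bullet> e - frechet_derivative \<gamma> (at (L x)) (L e)"
      by (simp add: rho_def[abs_def] L_def frechet_derivative_eq)
    also have "e \<bullet> e = 1" using e by (simp add: dot_square_norm)
    also have "L e = 0" using \<open>e \<bullet> e = 1\<close> by (simp add: L_def)
    also have "frechet_derivative \<gamma> (at (L x)) 0 = 0"
      by (rule linear_0[OF linear_frechet_derivative[OF d\<gamma>]])
    finally show ?thesis by simp
  qed
  ultimately show False by simp
qed

definition q :: "('a \<Rightarrow> real) \<Rightarrow> 'a \<Rightarrow> real" where
  "q \<zeta> x = \<zeta> x * ((rho x)\<^sup>2 / 2)"

text \<open>Inside \<open>\<Omega>\<close> the function \<open>w \<zeta> 0\<close> coincides with the \<open>C\<^sup>2\<close> function \<open>q \<zeta>\<close>; for \<open>d > 0\<close> the support of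
  \<open>w \<zeta> d\<close> is a compact subset of \<open>\<Omega>\<close>, which gives \<open>w \<zeta> 0 \<in> H\<^sup>1\<^sub>0(\<Omega>)\<close> as \<open>d\<close> tends to 0.\<close>

definition w :: "('a \<Rightarrow> real) \<Rightarrow> real \<Rightarrow> 'a \<Rightarrow> real" where
  "w \<zeta> d x = \<zeta> x * ((max 0 (rho x - d))\<^sup>2 / 2)"

lemma square_rho:
  "pd b (\<lambda>x. (rho x)\<^sup>2 / 2) x = rho x * pd b rho x" "(\<lambda>x. (rho x)\<^sup>2 / 2) differentiable at x"
proof -
  have "((\<lambda>s::real. s\<^sup>2 / 2) has_real_derivative s) (at s)" for s
    by (auto intro!: derivative_eq_intros)
  from pd_compose_real[OF this rho_differentiable]
  show "pd b (\<lambda>x. (rho x)\<^sup>2 / 2) x = rho x * pd b rho x" "(\<lambda>x. (rho x)\<^sup>2 / 2) differentiable at x" .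
qed

lemma half_square_rho:
  "pd b (\<lambda>x. (max 0 (rho x - d))\<^sup>2 / 2) x = max 0 (rho x - d) * pd b rho x"
  "(\<lambda>x. (max 0 (rho x - d))\<^sup>2 / 2) differentiable at x"
proof -
  have "((\<lambda>s::real. (max 0 (s - d))\<^sup>2 / 2) has_real_derivative max 0 (s - d) * 1) (at s)" for s
    by (rule DERIV_chain2[OF half_square_pos_derivative]) (auto intro!: derivative_eq_intros)
  from pd_compose_real[OF this rho_differentiable]
  show "pd b (\<lambda>x. (max 0 (rho x - d))\<^sup>2 / 2) x = max 0 (rho x - d) * pd b rho x"
    "(\<lambda>x. (max 0 (rho x - d))\<^sup>2 / 2) differentiable at x" by simp_all
qed

context
  fixes \<zeta> :: "'a \<Rightarrow> real"
  assumes \<zeta>: "\<zeta> \<in> test_fun (ball z r)"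
begin

lemma Ck_zeta: "Ck k \<zeta>"
  using \<zeta> by (simp add: test_fun_def)

lemma zeta_differentiable: "\<zeta> differentiable at x"
  by (rule Ck_differentiable[OF Ck_zeta])

lemma pd_q: "pd b (q \<zeta>) x = \<zeta> x * (rho x * pd b rho x) + pd b \<zeta> x * ((rho x)\<^sup>2 / 2)"
  unfolding q_def[abs_def] by (subst pd_mult[OF zeta_differentiable square_rho(2)]) (simp only: square_rho(1))

lemma pd_w: "pd b (w \<zeta> d) x = \<zeta> x * (max 0 (rho x - d) * pd b rho x) + pd b \<zeta> x * ((max 0 (rho x - d))\<^sup>2 / 2)"
  unfolding w_def[abs_def] by (subst pd_mult[OF zeta_differentiable half_square_rho(2)]) (simp only: half_square_rho(1))

lemma Ck_q: "Ck 2 (q \<zeta>)"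
proof -
  have "Ck 2 (\<lambda>x. \<zeta> x * (rho x * rho x * (1 / 2)))"
    by (intro Ck_mult Ck_zeta Ck_rho Ck_const)
  then show ?thesis by (simp add: q_def[abs_def] power2_eq_square)
qed

lemma Ck_w: "Ck (Suc 0) (w \<zeta> d)"
proof -
  have "(w \<zeta> d) differentiable at x" for x
    unfolding w_def[abs_def] by (intro differentiable_mult zeta_differentiable half_square_rho)
  moreover have "continuous_on UNIV (pd b (w \<zeta> d))" if b: "b \<in> Basis" for b
    unfolding pd_w
    by (intro continuous_intros Ck_continuous[OF Ck_zeta] Ck_continuous[OF Ck_rho]
        Ck_continuous[OF Ck_pd[OF rho1 b]] Ck_continuous[OF Ck_pd[OF Ck_zeta b]]) auto
  ultimately show ?thesis by simp
qed

definition supp :: "'a set" where "supp = closure {x. \<zeta> x \<noteq> 0}"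

lemma supp: "compact supp" "supp \<subseteq> ball z r" "x \<notin> supp \<Longrightarrow> \<zeta> x = 0"
  using \<zeta> closure_subset[of "{x. \<zeta> x \<noteq> 0}"] by (auto simp: test_fun_def supp_def)

lemma laplacian_q_outside:
  assumes "x \<notin> supp"
  shows "laplacian (q \<zeta>) x = 0"
proof -
  have cl: "closed supp" using supp(1) by (rule compact_imp_closed)
  have "pd b (q \<zeta>) x = 0" if "x \<notin> supp" for b x
    by (rule pd_eq_0_outside[OF cl _ that]) (simp add: q_def supp(3))
  then have "pd b (pd b (q \<zeta>)) x = 0" for b
    by (rule pd_eq_0_outside[OF cl _ assms])
  then show ?thesis by (simp add: laplacian_def)
qed

text \<open>Every term of the product rule other than \<open>\<zeta>\<close> times the squared
  gradient keeps a factor \<open>rho\<close>, which is 0 on the frontier inside the chart. Outside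
  the chart both sides vanish with \<open>\<zeta>\<close>.\<close>

lemma laplacian_q_frontier:
  assumes x: "x \<in> frontier \<Omega>"
  shows "laplacian (q \<zeta>) x = \<zeta> x * sigma x"
proof (cases "x \<in> ball z r")
  case True
  have rx: "rho x = 0" by (rule rho_frontier[OF x True])
  have "pd b (pd b (q \<zeta>)) x = \<zeta> x * (pd b rho x)\<^sup>2" if b: "b \<in> Basis" for b
  proof -
    have d: "pd b rho differentiable at x" "pd b \<zeta> differentiable at x"
      using Ck_rho Ck_zeta[of "Suc (Suc 0)"] b by (simp_all add: numeral_2_eq_2)
    have d1: "(\<lambda>x. rho x * pd b rho x) differentiable at x"
      by (intro differentiable_mult rho_differentiable d)
    have "pd b (pd b (q \<zeta>)) x = pd b (\<lambda>x. \<zeta> x * (rho x * pd b rho x) + pd b \<zeta> x * ((rho x)\<^sup>2 / 2)) x"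
      by (simp add: pd_q)
    also have "\<dots> = pd b (\<lambda>x. \<zeta> x * (rho x * pd b rho x)) x + pd b (\<lambda>x. pd b \<zeta> x * ((rho x)\<^sup>2 / 2)) x"
      by (intro pd_add differentiable_mult zeta_differentiable d d1 square_rho)
    also have "pd b (\<lambda>x. pd b \<zeta> x * ((rho x)\<^sup>2 / 2)) x = 0"
      by (subst pd_mult[OF d(2) square_rho(2)]) (simp add: square_rho(1) rx)
    also have "pd b (\<lambda>x. \<zeta> x * (rho x * pd b rho x)) x = \<zeta> x * (pd b rho x)\<^sup>2"
      by (subst pd_mult[OF zeta_differentiable d1], subst pd_mult[OF rho_differentiable d(1)])
        (simp add: rx power2_eq_square)
    finally show ?thesis by simp
  qed
  then show ?thesis by (simp add: laplacian_def sigma_def sum_distrib_left)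
next
  case False
  have "x \<notin> supp" using False supp(2) by blast
  then show ?thesis using laplacian_q_outside[of x] supp(3)[of x] by simp
qed

lemma w_eq_q: "x \<in> \<Omega> \<Longrightarrow> w \<zeta> 0 x = q \<zeta> x"
proof -
  assume x: "x \<in> \<Omega>"
  show ?thesis
  proof (cases "x \<in> ball z r")
    case True
    then show ?thesis using rho_pos_iff[OF True] x by (simp add: w_def q_def)
  next
    case False
    then have "x \<notin> supp" using supp(2) by blast
    then show ?thesis using supp(3) by (simp add: w_def q_def)
  qed
qed

lemma w_outside: "x \<notin> \<Omega> \<Longrightarrow> w \<zeta> 0 x = 0"
proof -
  assume x: "x \<notin> \<Omega>"
  show ?thesis
  proof (cases "x \<in> ball z r")
    case True
    then show ?thesis using rho_pos_iff[OF True] x by (simp add: w_def)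
  next
    case False
    then have "x \<notin> supp" using supp(2) by blast
    then show ?thesis using supp(3) by (simp add: w_def)
  qed
qed

text \<open>Where \<open>rho \<ge> 0\<close>, lowering it by \<open>d\<close> changes its positive
  part by at most \<open>d\<close> and half the square by at most \<open>d * rho\<close>; the
  remaining factors are bounded because \<open>\<zeta>\<close> has compact support. In
  \<open>\<Omega>\<close> the function \<open>rho\<close> is positive on that support, so no other
  case arises.\<close>

lemma w_approx:
  assumes eps: "eps > 0"
  shows "\<exists>d>0. \<forall>x\<in>\<Omega>. \<bar>w \<zeta> d x - q \<zeta> x\<bar> \<le> eps \<and> (\<forall>b\<in>Basis. \<bar>pd b (w \<zeta> d) x - pd b (q \<zeta>) x\<bar> \<le> eps)"
proof -
  have dz: "pd b \<zeta> x = 0" if "x \<notin> supp" for b x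
    using that supp by (intro pd_eq_0_outside[of supp]) (auto simp: compact_imp_closed)
  have cr: "continuous_on UNIV rho" by (rule Ck_continuous[OF Ck_rho])
  have cz: "continuous_on UNIV \<zeta>" by (rule Ck_continuous[OF Ck_zeta])
  obtain M0 where M0: "M0 \<ge> 0" "\<And>x. \<bar>\<zeta> x * rho x\<bar> \<le> M0"
    using compact_support_bounded[OF continuous_on_mult[OF cz cr] supp(1)] supp(3) by (metis mult_zero_left)
  have "\<exists>M\<ge>0. \<forall>x. \<bar>\<bar>\<zeta> x * pd b rho x\<bar> + \<bar>pd b \<zeta> x * rho x\<bar>\<bar> \<le> M" if b: "b \<in> Basis" for b
    by (rule compact_support_bounded[OF _ supp(1)])
      (use supp dz in \<open>auto intro!: continuous_intros cr cz Ck_continuous[OF Ck_pd[OF rho1 b]] Ck_continuous[OF Ck_pd[OF Ck_zeta b]]\<close>)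
  then obtain Mb where Mb: "\<And>b. b \<in> Basis \<Longrightarrow> Mb b \<ge> 0"
    "\<And>b x. b \<in> Basis \<Longrightarrow> \<bar>\<zeta> x * pd b rho x\<bar> + \<bar>pd b \<zeta> x * rho x\<bar> \<le> Mb b"
    by (metis abs_of_nonneg abs_ge_zero add_nonneg_nonneg)
  \<comment> \<open>\<open>M\<close> dominates all the bounds at once, and the summand 1 makes it
    positive, so that \<open>d = eps / M\<close> is positive as well.\<close>
  define M where "M = M0 + (\<Sum>b\<in>Basis. Mb b) + 1"
  have M1: "M0 \<le> M" "M > 0" using Mb(1) M0(1) sum_nonneg[of Basis Mb] by (auto simp: M_def)
  have M2: "Mb b \<le> M" if "b \<in> Basis" for b
    using member_le_sum[of b Basis Mb] Mb(1) M0(1) that by (simp add: M_def)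
  define d where "d = eps / M"
  have d: "d > 0" "d * M = eps" using eps M1 by (auto simp: d_def)
  have sq: "\<bar>(max 0 (s - d))\<^sup>2 / 2 - s\<^sup>2 / 2\<bar> \<le> d * \<bar>s\<bar>" "\<bar>max 0 (s - d) - s\<bar> \<le> d" if "s \<ge> 0" for s
  proof -
    define a where "a = max 0 (s - d)"
    have a: "0 \<le> a" "a \<le> s" "s - a \<le> d" using that d by (auto simp: a_def)
    have "a\<^sup>2 / 2 - s\<^sup>2 / 2 = - ((s - a) * ((s + a) / 2))"
      by (simp add: power2_eq_square field_simps)
    moreover have "(s - a) * ((s + a) / 2) \<le> d * s"
      using a d by (intro mult_mono) auto
    moreover have "0 \<le> (s - a) * ((s + a) / 2)" using a by simp
    ultimately show "\<bar>(max 0 (s - d))\<^sup>2 / 2 - s\<^sup>2 / 2\<bar> \<le> d * \<bar>s\<bar>"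
      using that by (simp add: a_def[symmetric])
    show "\<bar>max 0 (s - d) - s\<bar> \<le> d" using a by (simp add: a_def[symmetric])
  qed
  show ?thesis
  proof (intro exI[of _ d] conjI ballI d)
    fix x assume x: "x \<in> \<Omega>"
    consider "x \<notin> supp" | "rho x \<ge> 0"
    proof (cases "x \<in> supp")
      case True
      then have "rho x > 0" using rho_pos_iff[of x] x supp(2) by blast
      then show ?thesis using that by simp
    qed (use that in blast)
    note cases = this
    show "\<bar>w \<zeta> d x - q \<zeta> x\<bar> \<le> eps"
    proof (cases rule: cases)
      case 1
      then show ?thesis using supp(3) eps by (simp add: w_def q_def)
    next
      case 2
      have "\<bar>w \<zeta> d x - q \<zeta> x\<bar> = \<bar>\<zeta> x\<bar> * \<bar>(max 0 (rho x - d))\<^sup>2 / 2 - (rho x)\<^sup>2 / 2\<bar>"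
        by (simp add: w_def q_def abs_mult[symmetric] right_diff_distrib)
      also have "\<dots> \<le> \<bar>\<zeta> x\<bar> * (d * \<bar>rho x\<bar>)"
        by (intro mult_left_mono sq 2) auto
      also have "\<dots> = d * \<bar>\<zeta> x * rho x\<bar>" by (simp add: abs_mult)
      also have "\<dots> \<le> d * M" using M0(2)[of x] M1 d by (intro mult_left_mono) auto
      finally show ?thesis using d by simp
    qed
    fix b :: 'a assume b: "b \<in> Basis"
    show "\<bar>pd b (w \<zeta> d) x - pd b (q \<zeta>) x\<bar> \<le> eps"
    proof (cases rule: cases)
      case 1
      then show ?thesis using supp(3) dz eps by (simp add: pd_w pd_q)
    next
      case 2
      have "pd b (w \<zeta> d) x - pd b (q \<zeta>) x = (\<zeta> x * pd b rho x) * (max 0 (rho x - d) - rho x) +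
          pd b \<zeta> x * ((max 0 (rho x - d))\<^sup>2 / 2 - (rho x)\<^sup>2 / 2)"
        unfolding pd_w pd_q by (simp add: algebra_simps)
      also have "\<bar>\<dots>\<bar> \<le> \<bar>\<zeta> x * pd b rho x\<bar> * \<bar>max 0 (rho x - d) - rho x\<bar> +
          \<bar>pd b \<zeta> x\<bar> * \<bar>(max 0 (rho x - d))\<^sup>2 / 2 - (rho x)\<^sup>2 / 2\<bar>"
        unfolding abs_mult[symmetric] by (rule abs_triangle_ineq)
      also have "\<dots> \<le> \<bar>\<zeta> x * pd b rho x\<bar> * d + \<bar>pd b \<zeta> x\<bar> * (d * \<bar>rho x\<bar>)"
        by (intro add_mono mult_left_mono sq 2) auto
      also have "\<dots> = d * (\<bar>\<zeta> x * pd b rho x\<bar> + \<bar>pd b \<zeta> x * rho x\<bar>)"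
        by (simp add: abs_mult algebra_simps)
      also have "\<dots> \<le> d * M" using order_trans[OF Mb(2)[OF b, of x] M2[OF b]] d by (intro mult_left_mono) auto
      finally show ?thesis using d by simp
    qed
  qed
qed

text \<open>Membership in H^1_0 adds two errors of size \<open>e / 2\<close>: the passage from
  \<open>w \<zeta> 0\<close> to \<open>w \<zeta> d\<close>, and the mollification of
  \<open>w \<zeta> d\<close>. Inside \<open>\<Omega>\<close> the function \<open>w \<zeta> 0\<close>
  is \<open>q \<zeta>\<close>, so the gradient and the Laplacian may be taken from the
  \<open>C^2\<close> function \<open>q \<zeta>\<close>, for which \<open>weak_laplacian\<close> is
  available.\<close>

lemma dirichlet_laplacian_w: "dirichlet_laplacian \<Omega> (w \<zeta> 0) (laplacian (q \<zeta>))"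
proof -
  have bL2: "f \<in> L2 \<Omega>" if f: "continuous_on UNIV f" "\<And>x. x \<notin> supp \<Longrightarrow> f x = 0" for f :: "'a \<Rightarrow> real"
  proof -
    obtain M where "\<And>x. \<bar>f x\<bar> \<le> M" using compact_support_bounded[OF f(1) supp(1) f(2)] by blast
    then show ?thesis
      by (intro L2_bounded[of _ M] continuous_measurable continuous_on_subset[OF f(1)]) auto
  qed
  have pq: "continuous_on UNIV (pd b (q \<zeta>))" "pd b (q \<zeta>) \<in> L2 \<Omega>" if b: "b \<in> Basis" for b
  proof -
    show c: "continuous_on UNIV (pd b (q \<zeta>))"
      by (rule Ck_continuous[OF Ck_pd[OF Ck_mono[OF Ck_q, of "Suc 0"] b]]) simp
    show "pd b (q \<zeta>) \<in> L2 \<Omega>"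
      by (rule bL2[OF c]) (use supp in \<open>auto intro!: pd_eq_0_outside[of supp] compact_imp_closed simp: q_def\<close>)
  qed
  have cw: "continuous_on UNIV (w \<zeta> 0)" by (rule Ck_continuous[OF Ck_w])
  have "H01 \<Omega> (w \<zeta> 0) (grad (q \<zeta>))"
  proof (rule H01_uniform_limit)
    show "continuous_on \<Omega> (w \<zeta> 0)" by (rule continuous_on_subset[OF cw]) simp
    show "w \<zeta> 0 \<in> L2 \<Omega>" by (rule bL2[OF cw]) (simp add: w_def supp)
    show "continuous_on \<Omega> (\<lambda>x. grad (q \<zeta>) x \<bullet> b)" "(\<lambda>x. grad (q \<zeta>) x \<bullet> b) \<in> L2 \<Omega>" if "b \<in> Basis" for b
      using pq[OF that] that by (auto simp: grad_inner intro: continuous_on_subset)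
    fix e :: real assume e: "e > 0"
    obtain d where d: "d > 0" "\<And>x. x \<in> \<Omega> \<Longrightarrow> \<bar>w \<zeta> d x - q \<zeta> x\<bar> \<le> e / 2"
      "\<And>x b. x \<in> \<Omega> \<Longrightarrow> b \<in> Basis \<Longrightarrow> \<bar>pd b (w \<zeta> d) x - pd b (q \<zeta>) x\<bar> \<le> e / 2"
      using w_approx[of "e / 2"] e by auto
    have "closed {x. d \<le> rho x}"
      by (intro closed_Collect_le continuous_on_const Ck_continuous[OF Ck_rho])
    then have cK: "compact (supp \<inter> {x. d \<le> rho x})"
      by (rule compact_Int_closed[OF supp(1)])
    have sub: "supp \<inter> {x. d \<le> rho x} \<subseteq> \<Omega>"
    proof
      fix x assume "x \<in> supp \<inter> {x. d \<le> rho x}"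
      then show "x \<in> \<Omega>" using rho_pos_iff[of x] d(1) supp(2) by auto
    qed
    have w0: "w \<zeta> d x = 0" if "x \<notin> supp \<inter> {x. d \<le> rho x}" for x
      using that supp(3) by (auto simp: w_def max_def)
    obtain \<phi> where \<phi>: "\<phi> \<in> test_fun \<Omega>" "\<And>x. \<bar>\<phi> x - w \<zeta> d x\<bar> \<le> e / 2"
      "\<And>b x. b \<in> Basis \<Longrightarrow> \<bar>pd b \<phi> x - pd b (w \<zeta> d) x\<bar> \<le> e / 2"
      using test_fun_approx[OF cK sub open_dom Ck_continuous[OF Ck_w] w0, of "e / 2"] e Ck_w by auto
    show "\<exists>\<phi>\<in>test_fun \<Omega>. \<forall>x\<in>\<Omega>. \<bar>\<phi> x - w \<zeta> 0 x\<bar> \<le> e \<and>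
        (\<forall>b\<in>Basis. \<bar>pd b \<phi> x - grad (q \<zeta>) x \<bullet> b\<bar> \<le> e)"
    proof (intro bexI[OF _ \<phi>(1)] ballI conjI)
      fix x assume x: "x \<in> \<Omega>"
      show "\<bar>\<phi> x - w \<zeta> 0 x\<bar> \<le> e"
        using \<phi>(2)[of x] d(2)[OF x] w_eq_q[OF x] by linarith
      show "\<bar>pd b \<phi> x - grad (q \<zeta>) x \<bullet> b\<bar> \<le> e" if b: "b \<in> Basis" for b
        using \<phi>(3)[OF b, of x] d(3)[OF x b] grad_inner[OF b, of "q \<zeta>" x] by linarith
    qed
  qed
  moreover have "laplacian (q \<zeta>) \<in> L2 \<Omega>"
    by (rule bL2[OF Ck2_laplacian_continuous[OF Ck_q]]) (rule laplacian_q_outside)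
  ultimately show ?thesis
    unfolding dirichlet_laplacian_def using weak_laplacian[OF Ck_q] by blast
qed

end

end

section \<open>From charts to the constant 1\<close>

context heat_semigroup
begin

lemma X_cong:
  assumes "g \<in> X" "\<And>x. x \<in> \<Omega> \<Longrightarrow> ap g x = ap h x"
  shows "h \<in> X"
proof -
  have "ip (S s (ap h)) p = ip (S s (ap g)) p" if "s \<ge> 0" "p \<in> L2 \<Omega>" for s p
    using that assms(2) by (intro S_cong L2_bcontfun) (auto simp: L2_eq_def)
  then have "acc t h p = acc t g p"
    if "p \<in> L2 \<Omega>" for t p
    using that by (intro integral_cong) auto
  then show ?thesis using assms(1) by (simp add: X_def)
qed

text \<open>Replacing \<open>g\<close> by 0 outside the closure gives an element of
  \<open>C0 \<Omega>\<close> that agrees with \<open>g\<close> in \<open>\<Omega>\<close>, and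
  membership in \<open>X\<close> sees only the values there. Modulo \<open>X\<close>, a function is
  thus determined by its boundary values.\<close>

lemma X_frontier:
  assumes "\<And>x. x \<in> frontier \<Omega> \<Longrightarrow> ap g x = 0"
  shows "g \<in> X"
proof -
  define f where "f x = (if x \<in> closure \<Omega> then ap g x else 0)" for x
  have "continuous_on (closure \<Omega> \<union> - \<Omega>) f"
    unfolding f_def
  proof (rule continuous_on_cases)
    show "\<forall>x. x \<in> closure \<Omega> \<and> x \<notin> closure \<Omega> \<or> x \<in> - \<Omega> \<and> x \<in> closure \<Omega> \<longrightarrow> ap g x = 0"
      using assms open_dom by (auto simp: frontier_def interior_open)
  qed (auto simp: open_dom closed_Compl)
  moreover have "closure \<Omega> \<union> - \<Omega> = UNIV" using closure_subset by blast
  ultimately have "continuous_on UNIV f" by simp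
  then have fb: "f \<in> bcontfun"
    by (rule bcontfun_normI[of _ "norm g"]) (use norm_bounded[of g] in \<open>auto simp: f_def\<close>)
  have "Bcontfun f \<in> C0 \<Omega>"
    using assms by (auto simp: C0_def apply_Bcontfun[OF fb] f_def)
  then have "Bcontfun f \<in> X" using X_C0 by blast
  then show ?thesis
    by (rule X_cong) (use closure_subset[of \<Omega>] in \<open>auto simp: apply_Bcontfun[OF fb] f_def\<close>)
qed

end

locale heat_chart = heat_semigroup \<Omega> \<kappa> S + graph_boundary_chart \<Omega> z e r \<gamma>
  for \<Omega> :: "'a::euclidean_space set" and \<kappa> S z e r \<gamma>
begin

text \<open>The generator maps \<open>w \<zeta> 0\<close> to \<open>\<kappa>\<close> times the
  Laplacian of \<open>q \<zeta>\<close>, so the latter lies in \<open>X\<close> after division by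
  \<open>\<kappa>\<close>. The product of \<open>\<zeta>\<close> and \<open>sigma\<close> has the
  same boundary values, and \<open>X_frontier\<close> covers the difference.\<close>

lemma X_test_fun_sigma:
  assumes \<zeta>: "\<zeta> \<in> test_fun (ball z r)"
  shows "Bcontfun (\<lambda>x. \<zeta> x * sigma x) \<in> X" "(\<lambda>x. \<zeta> x * sigma x) \<in> bcontfun"
proof -
  note K = supp[OF \<zeta>]
  have wb: "w \<zeta> 0 \<in> bcontfun"
    by (rule compact_support_bcontfun[OF Ck_continuous[OF Ck_w[OF \<zeta>]] K(1)]) (simp add: w_def K)
  have lb: "laplacian (q \<zeta>) \<in> bcontfun"
    by (rule compact_support_bcontfun[OF Ck2_laplacian_continuous[OF Ck_q[OF \<zeta>]] K(1)])
      (rule laplacian_q_outside[OF \<zeta>])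
  show sb: "(\<lambda>x. \<zeta> x * sigma x) \<in> bcontfun"
    by (rule compact_support_bcontfun[OF _ K(1)])
      (auto intro!: continuous_intros Ck_continuous[OF Ck_zeta[OF \<zeta>]] continuous_sigma simp: K)
  have "Bcontfun (w \<zeta> 0) \<in> C0 \<Omega>"
    unfolding C0_iff[OF open_dom] apply_Bcontfun[OF wb] using w_outside[OF \<zeta>] by blast
  moreover have "L2_generator \<Omega> S (w \<zeta> 0) (\<lambda>x. \<kappa> * laplacian (q \<zeta>) x)"
    using heat dirichlet_laplacian_w[OF \<zeta>] unfolding dirichlet_heat_semigroup_def by blast
  ultimately have "\<kappa> *\<^sub>R Bcontfun (laplacian (q \<zeta>)) \<in> X"
    by (intro X_generator[of "Bcontfun (w \<zeta> 0)"]) (simp_all add: apply_Bcontfun wb lb)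
  then have "(1 / \<kappa>) *\<^sub>R \<kappa> *\<^sub>R Bcontfun (laplacian (q \<zeta>)) \<in> X"
    by (rule subspace_scale[OF subspace_X])
  then have l: "Bcontfun (laplacian (q \<zeta>)) \<in> X" using \<kappa> by simp
  have "Bcontfun (\<lambda>x. \<zeta> x * sigma x) - Bcontfun (laplacian (q \<zeta>)) \<in> X"
    by (rule X_frontier) (simp add: apply_Bcontfun sb lb laplacian_q_frontier[OF \<zeta>])
  from subspace_add[OF subspace_X this l]
  show "Bcontfun (\<lambda>x. \<zeta> x * sigma x) \<in> X" by simp
qed

text \<open>\<open>X_test_fun_sigma\<close> demands a smooth factor, whereas
  \<open>\<eta> / sigma\<close> is in general only continuous. It is approximated uniformly by test
  functions of the ball, multiplied back by \<open>sigma\<close>, and the limit stays in the closed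
  set \<open>X\<close>.\<close>

lemma X_chart_support:
  assumes K: "compact K" "K \<subseteq> ball z r" and \<eta>: "continuous_on UNIV \<eta>" "\<And>x. x \<notin> K \<Longrightarrow> \<eta> x = 0"
  shows "Bcontfun \<eta> \<in> X"
proof -
  have \<eta>b: "\<eta> \<in> bcontfun" by (rule compact_support_bcontfun[OF \<eta>(1) K(1) \<eta>(2)])
  have "bounded (sigma ` cball z r)"
    by (intro compact_imp_bounded compact_continuous_image continuous_sigma) auto
  then obtain M where "\<forall>y\<in>sigma ` cball z r. norm y \<le> M" unfolding bounded_iff by blast
  then have M: "\<bar>sigma x\<bar> \<le> M" if "x \<in> cball z r" for x using that by simp
  have M0: "M > 0" using M[of z] sigma_pos[of z] r by simp
  have "Bcontfun \<eta> \<in> closure X"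
    unfolding closure_approachable
  proof (intro allI impI)
    fix d :: real assume d: "d > 0"
    have c0: "continuous_on UNIV (\<lambda>x. \<eta> x / sigma x)"
      by (intro continuous_on_divide \<eta>(1) continuous_sigma) (metis sigma_pos less_irrefl)
    have z0: "\<eta> x / sigma x = 0" if "x \<notin> K" for x using \<eta>(2)[OF that] by simp
    \<comment> \<open>\<open>sigma\<close> is at most \<open>M\<close> on the closed ball, so an
      error \<open>d / (2 * M)\<close> in the quotient becomes at most \<open>d / 2\<close> after
      multiplication.\<close>
    have dp: "d / (2 * M) > 0" using d M0 by simp
    obtain \<zeta> where \<zeta>: "\<zeta> \<in> test_fun (ball z r)" "\<And>x. \<bar>\<zeta> x - \<eta> x / sigma x\<bar> \<le> d / (2 * M)"
      by (rule test_fun_approx[OF K open_ball c0 z0 dp], assumption, rule that)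
    note K' = supp[OF \<zeta>(1)]
    note sb = X_test_fun_sigma[OF \<zeta>(1)]
    have le: "\<bar>\<zeta> x * sigma x - \<eta> x\<bar> \<le> d / 2" for x
    proof (cases "x \<in> ball z r")
      case True
      have "\<zeta> x * sigma x - \<eta> x = (\<zeta> x - \<eta> x / sigma x) * sigma x"
        using sigma_pos[of x] by (simp add: field_simps)
      then have "\<bar>\<zeta> x * sigma x - \<eta> x\<bar> = \<bar>\<zeta> x - \<eta> x / sigma x\<bar> * \<bar>sigma x\<bar>"
        by (simp add: abs_mult)
      also have "\<dots> \<le> d / (2 * M) * M"
        using True d M0 by (intro mult_mono \<zeta> M) auto
      finally show ?thesis using M0 by simp
    next
      case False
      then have "x \<notin> K" "x \<notin> supp \<zeta>" using K(2) K'(2) by auto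
      then show ?thesis using \<eta>(2) K'(3) d by simp
    qed
    have "norm (Bcontfun (\<lambda>x. \<zeta> x * sigma x) - Bcontfun \<eta>) \<le> d / 2"
      by (rule norm_bound) (use le in \<open>simp add: apply_Bcontfun sb \<eta>b\<close>)
    then show "\<exists>y\<in>X. dist y (Bcontfun \<eta>) < d"
      using sb(1) d by (intro bexI[of _ "Bcontfun (\<lambda>x. \<zeta> x * sigma x)"]) (auto simp: dist_norm)
  qed
  then show ?thesis using closed_X by (simp add: closure_closed)
qed

end

context heat_semigroup
begin

text \<open>By \<open>X_frontier\<close> only the boundary values of 1 have to be matched, which is
  done by a finite sum \<open>Y\<close> of functions supported in charts. Nothing is required of
  \<open>Y\<close> in the interior.\<close>

lemma one_in_X:
  assumes C2: "C2_boundary \<Omega>"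
  shows "const_bcontfun 1 \<in> X"
proof -
  let ?chart = "\<lambda>z r. \<exists>e \<gamma>. norm e = 1 \<and> Ck 2 \<gamma> \<and>
        \<Omega> \<inter> ball z r = {x \<in> ball z r. \<gamma> (x - (x \<bullet> e) *\<^sub>R e) < x \<bullet> e}"
  have "\<forall>z\<in>frontier \<Omega>. \<exists>r>0. ?chart z r"
    using C2 by (simp add: C2_boundary_def)
  from bchoice[OF this] obtain r where "\<forall>z\<in>frontier \<Omega>. r z > 0 \<and> ?chart z (r z)" ..
  then have r: "r z > 0" "?chart z (r z)" if "z \<in> frontier \<Omega>" for z
    using that by blast+
  have loc: "Bcontfun \<eta> \<in> X" if z: "z \<in> frontier \<Omega>" and K: "compact K" "K \<subseteq> ball z (r z)" "continuous_on UNIV \<eta>"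
    "\<And>x. x \<notin> K \<Longrightarrow> \<eta> x = 0" for z K \<eta>
  proof -
    obtain e \<gamma> where chart: "norm e = 1" "Ck 2 \<gamma>"
        "\<Omega> \<inter> ball z (r z) = {x \<in> ball z (r z). \<gamma> (x - (x \<bullet> e) *\<^sub>R e) < x \<bullet> e}"
      using r(2)[OF z] by blast
    interpret heat_chart \<Omega> \<kappa> S z e "r z" \<gamma>
      by unfold_locales (rule r(1)[OF z] chart)+
    show ?thesis by (rule X_chart_support[OF K])
  qed
  have cF: "compact (frontier \<Omega>)" by (rule compact_frontier_bounded[OF bounded_dom])
  \<comment> \<open>With half radii, the tents \<open>h z\<close> below vanish outside the closed
    ball of radius \<open>r z / 2\<close>, a compact subset of the chart.\<close>
  have "frontier \<Omega> \<subseteq> (\<Union>z\<in>frontier \<Omega>. ball z (r z / 2))" using r(1) by fastforce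
  then obtain D where D: "D \<subseteq> frontier \<Omega>" "finite D" "frontier \<Omega> \<subseteq> (\<Union>z\<in>D. ball z (r z / 2))"
    using compactE_image[OF cF, of "frontier \<Omega>" "\<lambda>z. ball z (r z / 2)"] by auto
  define h where "h z x = max 0 (r z / 2 - dist z x)" for z x
  define H where "H x = (\<Sum>z\<in>D. h z x)" for x
  have ch: "continuous_on S (h z)" for S z unfolding h_def by (intro continuous_intros)
  have cH: "continuous_on S H" for S unfolding H_def by (intro continuous_intros ch)
  have h0: "h z x \<ge> 0" for z x by (simp add: h_def)
  have Hpos: "H x > 0" if x: "x \<in> frontier \<Omega>" for x
  proof -
    obtain z where z: "z \<in> D" "x \<in> ball z (r z / 2)" using D(3) x by blast
    then have "0 < h z x" by (simp add: h_def)
    also have "h z x \<le> H x" unfolding H_def by (rule member_le_sum[OF z(1)]) (auto simp: h0 D)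
    finally show ?thesis .
  qed
  obtain m where m: "m > 0" "\<And>x. x \<in> frontier \<Omega> \<Longrightarrow> m \<le> H x"
  proof (cases "frontier \<Omega> = {}")
    case False
    obtain x where "x \<in> frontier \<Omega>" "\<And>y. y \<in> frontier \<Omega> \<Longrightarrow> H x \<le> H y"
      using continuous_attains_inf[OF cF False cH] by blast
    then show ?thesis using that[of "H x"] Hpos by blast
  qed (use that[of 1] in auto)
  have mp: "max m (H x) \<noteq> 0" for x using m(1) by linarith
  \<comment> \<open>\<open>H\<close> may vanish away from the boundary. The maximum with
    \<open>m\<close> keeps the denominator positive everywhere and equals \<open>H\<close> on the
    frontier, where the quotients therefore add up to 1.\<close>
  define \<eta> where "\<eta> z x = h z x / max m (H x)" for z x
  have \<eta>X: "Bcontfun (\<eta> z) \<in> X" and \<eta>b: "\<eta> z \<in> bcontfun" if z: "z \<in> D" for z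
  proof -
    have c: "continuous_on UNIV (\<eta> z)"
      unfolding \<eta>_def using mp by (intro continuous_on_divide continuous_on_max continuous_on_const ch cH) blast
    have s: "\<eta> z x = 0" if "x \<notin> cball z (r z / 2)" for x
      using that by (simp add: \<eta>_def h_def)
    have zF: "z \<in> frontier \<Omega>" using D(1) z by blast
    show "Bcontfun (\<eta> z) \<in> X"
      by (rule loc[OF zF compact_cball[of z "r z / 2"] _ c s]) (use r(1)[OF zF] in auto)
    show "\<eta> z \<in> bcontfun" by (rule compact_support_bcontfun[OF c compact_cball s])
  qed
  define Y where "Y = (\<Sum>z\<in>D. Bcontfun (\<eta> z))"
  have "Y \<in> X" unfolding Y_def by (rule subspace_sum[OF subspace_X \<eta>X])
  have app: "ap (\<Sum>z\<in>D'. f z) x = (\<Sum>z\<in>D'. ap (f z) x)" if "finite D'"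
    for D' and f :: "'a \<Rightarrow> 'a \<Rightarrow>\<^sub>C real" and x
    using that by (induction D' rule: finite_induct) auto
  have Yx: "ap Y x = H x / max m (H x)" for x
  proof -
    have "ap Y x = (\<Sum>z\<in>D. \<eta> z x)"
      unfolding Y_def app[OF D(2)] by (rule sum.cong) (simp_all add: apply_Bcontfun \<eta>b)
    also have "\<dots> = H x / max m (H x)"
      unfolding \<eta>_def H_def by (rule sum_divide_distrib[symmetric])
    finally show ?thesis .
  qed
  have "const_bcontfun 1 - Y \<in> X"
  proof (rule X_frontier)
    fix x assume "x \<in> frontier \<Omega>"
    then show "ap (const_bcontfun 1 - Y) x = 0"
      using m(2)[of x] m(1) by (simp add: Yx const_bcontfun.rep_eq max_absorb2)
  qed
  from subspace_add[OF subspace_X this \<open>Y \<in> X\<close>] show ?thesis by simp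
qed

end

section \<open>Mild solutions\<close>

lemma has_integral_reverse:
  fixes f :: "real \<Rightarrow> 'a::banach"
  assumes "(f has_integral I) {0..t}" "t \<ge> 0"
  shows "((\<lambda>s. f (t - s)) has_integral I) {0..t}"
proof -
  have i: "(f has_integral I) (cbox 0 t)" using assms(1) by simp
  have "(\<lambda>x. (1 / (-1::real)) *\<^sub>R x + - ((1 / (-1)) *\<^sub>R t)) ` cbox 0 t = {0..t}"
  proof (intro equalityI subsetI)
    fix x assume "x \<in> {0..t}"
    then show "x \<in> (\<lambda>x. (1 / (-1::real)) *\<^sub>R x + - ((1 / (-1)) *\<^sub>R t)) ` cbox 0 t"
      by (intro image_eqI[of _ _ "t - x"]) auto
  qed auto
  with has_integral_affinity[OF i, of "-1" t] show ?thesis by simp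
qed

lemma has_integral_rescale:
  fixes f :: "real \<Rightarrow> 'a::banach"
  assumes "continuous_on {0..t} f" "t \<ge> 0"
  shows "(f has_integral t *\<^sub>R integral {0..1} (\<lambda>s. f (t * s))) {0..t}"
proof (cases "t = 0")
  case True
  then show ?thesis by (simp add: has_integral_refl)
next
  case False
  then have t: "t > 0" using assms(2) by simp
  have i: "(f has_integral integral {0..t} f) (cbox 0 t)"
    using integrable_integral[OF integrable_continuous_real[OF assms(1)]] by simp
  have "(\<lambda>x. (1 / t) *\<^sub>R x + - ((1 / t) *\<^sub>R 0)) ` cbox 0 t = {0..1}"
  proof (intro equalityI subsetI)
    fix x :: real assume "x \<in> {0..1}"
    then show "x \<in> (\<lambda>x. (1 / t) *\<^sub>R x + - ((1 / t) *\<^sub>R 0)) ` cbox 0 t"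
      using t by (intro image_eqI[of _ _ "t * x"]) (auto simp: mult_le_cancel_left2)
  qed (use t in \<open>auto simp: divide_le_eq\<close>)
  with has_integral_affinity[OF i, of t 0]
  have "((\<lambda>x. f (t * x)) has_integral (1 / t) *\<^sub>R integral {0..t} f) {0..1}"
    using t by simp
  then have "integral {0..1} (\<lambda>s. f (t * s)) = (1 / t) *\<^sub>R integral {0..t} f"
    by (rule integral_unique)
  then show ?thesis using i t by simp
qed

lemma norm_vec_le_sum: "norm (x :: 'b::real_normed_vector ^ 'n) \<le> (\<Sum>i\<in>UNIV. norm (x $ i))"
  unfolding norm_vec_def by (rule L2_set_le_sum) simp

lemma norm_vec_le_CARD:
  fixes x :: "'b::real_normed_vector ^ 'n"
  assumes "\<And>i. norm (x $ i) \<le> c"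
  shows "norm x \<le> real CARD('n) * c"
  using norm_vec_le_sum[of x] sum_bounded_above[of UNIV "\<lambda>i. norm (x $ i)" c] assms by fastforce

context heat_semigroup
begin

text \<open>\<open>V t\<close> stands for the integral of the orbit of 1 over \<open>{0..t}\<close>,
  fixed by its pairings. It carries the constant \<open>F 0\<close> in the fixed-point equation,
  which asks for values in \<open>C0 \<Omega>\<close> and continuity in \<open>t\<close>.\<close>

definition one_potential :: "(real \<Rightarrow> 'a \<Rightarrow>\<^sub>C real) \<Rightarrow> bool" where
  "one_potential V \<longleftrightarrow> (\<forall>t\<ge>0. V t \<in> C0 \<Omega> \<and> (\<forall>p\<in>L2 \<Omega>. ((\<lambda>s. ip (S s (\<lambda>x. 1)) p) has_integral ip (ap (V t)) p) {0..t}))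
    \<and> continuous_on {0..} V \<and> V 0 = 0"

text \<open>\<open>one_in_X\<close> supplies \<open>V t\<close> for each \<open>t\<close>
  separately. Continuity in \<open>t\<close> comes from duality: the increment pairs with
  \<open>p\<close> as the integral over \<open>{s..t}\<close>, so \<open>V\<close> is Lipschitz
  continuous.\<close>

lemma one_potential_exists:
  assumes "C2_boundary \<Omega>"
  shows "\<exists>V. one_potential V"
proof -
  let ?one = "const_bcontfun 1 :: 'a \<Rightarrow>\<^sub>C real"
  have one: "ap ?one = (\<lambda>x. 1)" by (simp add: const_bcontfun.rep_eq)
  have "\<forall>t\<in>{0..}. \<exists>W. W \<in> C0 \<Omega> \<and> (\<forall>p\<in>L2 \<Omega>. integral {0..t} (\<lambda>s. ip (S s (\<lambda>x. 1)) p) = ip (ap W) p)"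
    using one_in_X[OF assms] unfolding X_def one by auto
  from bchoice[OF this] obtain V where V: "\<And>t. t \<ge> 0 \<Longrightarrow> V t \<in> C0 \<Omega>"
    "\<And>t p. t \<ge> 0 \<Longrightarrow> p \<in> L2 \<Omega> \<Longrightarrow> integral {0..t} (\<lambda>s. ip (S s (\<lambda>x. 1)) p) = ip (ap (V t)) p"
    by auto
  note int = ip_S_integrable[of _ _ ?one, unfolded one]
  have lip: "norm (V t - V s) \<le> (t - s) * norm ?one" if "0 \<le> s" "s \<le> t" for s t
  proof (rule norm_le_of_ip)
    fix p assume p: "p \<in> L2 \<Omega>"
    have "integral {0..s} (\<lambda>s. ip (S s (\<lambda>x. 1)) p) + integral {s..t} (\<lambda>s. ip (S s (\<lambda>x. 1)) p) =
        integral {0..t} (\<lambda>s. ip (S s (\<lambda>x. 1)) p)"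
      using that by (intro Henstock_Kurzweil_Integration.integral_combine int[OF p]) auto
    then have "ip (ap (V t - V s)) p = integral {s..t} (\<lambda>s. ip (S s (\<lambda>x. 1)) p)"
      using that V(2)[OF _ p] by (simp add: ip_diff L2_bcontfun p)
    then show "\<bar>ip (ap (V t - V s)) p\<bar> \<le> (t - s) * norm ?one * L1 p"
      using integral_ip_S_le[OF p that, of ?one] unfolding one by simp
  qed (use that V(1) in \<open>auto intro: C0_diff\<close>)
  have "continuous_on {0..} V"
  proof (rule lipschitz_on_continuous_on)
    show "(norm ?one)-lipschitz_on {0..} V"
    proof (rule lipschitz_onI)
      fix s t :: real assume "s \<in> {0..}" "t \<in> {0..}"
      then show "dist (V s) (V t) \<le> norm ?one * dist s t"
        using lip[of s t] lip[of t s] by (cases "s \<le> t") (auto simp: dist_norm norm_minus_commute mult.commute)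
    qed simp
  qed
  moreover have "V 0 = 0"
  proof (rule C0_eqI)
    show "(0 :: 'a \<Rightarrow>\<^sub>C real) \<in> C0 \<Omega>" using subspace_C0 by (rule subspace_0)
    show "ip (ap (V 0)) p = ip (ap 0) p" if "p \<in> L2 \<Omega>" for p
      using V(2)[OF order_refl that] by (simp add: L2_inner_def)
  qed (use V(1) in simp)
  ultimately show ?thesis
    using V(1) V(2)[symmetric] integrable_integral[OF int] by (intro exI[of _ V]) (auto simp: one_potential_def)
qed

end

section \<open>The fixed-point equation in \<open>C0 \<Omega>\<close>\<close>

locale reaction_diffusion = bounded_domain \<Omega> for \<Omega> :: "'a::euclidean_space set" +
  fixes \<kappa> :: "'n::finite \<Rightarrow> real" and S :: "'n \<Rightarrow> real \<Rightarrow> ('a \<Rightarrow> real) \<Rightarrow> 'a \<Rightarrow> real"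
    and F :: "real ^ 'n \<Rightarrow> real ^ 'n"
  assumes hs: "\<And>i. heat_semigroup \<Omega> (\<kappa> i) (S i)" and C2: "C2_boundary \<Omega>"
    and lipF: "locally_lipschitz F"
begin

sublocale hs: heat_semigroup \<Omega> "\<kappa> i" "S i" for i
  by (rule hs)

abbreviation "PP i \<equiv> heat_semigroup.P \<Omega> (S i)"

definition V :: "'n \<Rightarrow> real \<Rightarrow> 'a \<Rightarrow>\<^sub>C real" where
  "V i = (SOME V. heat_semigroup.one_potential \<Omega> (S i) V)"

lemma V_spec: "heat_semigroup.one_potential \<Omega> (S i) (V i)"
  unfolding V_def by (rule someI_ex[OF hs.one_potential_exists[OF C2]])

lemma V_C0: "t \<ge> 0 \<Longrightarrow> V i t \<in> C0 \<Omega>"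
  and V_integral: "t \<ge> 0 \<Longrightarrow> p \<in> L2 \<Omega> \<Longrightarrow>
    ((\<lambda>s. ip (S i s (\<lambda>x. 1)) p) has_integral ip (ap (V i t)) p) {0..t}"
  and V_continuous: "continuous_on {0..} (V i)" and V_0: "V i 0 = 0"
  using V_spec[of i] by (simp_all add: hs.one_potential_def)

definition C0n :: "(('a \<Rightarrow>\<^sub>C real) ^ 'n) set" where "C0n = {U. \<forall>i. U $ i \<in> C0 \<Omega>}"

lemma F_continuous: "continuous_on A F"
proof -
  have "isCont F v" for v
  proof -
    obtain r L where "r > 0" "L-lipschitz_on (cball v r) F" using lipF unfolding locally_lipschitz_def by blast
    then show ?thesis
      using continuous_on_interior[OF lipschitz_on_continuous_on, of L "cball v r" F v] by simp
  qed
  then show ?thesis by (simp add: continuous_at_imp_continuous_on)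
qed

text \<open>Compactness of the ball makes the local constants uniform.
  \<open>local_lipschitz\<close> has a time parameter, which is frozen at 0.\<close>

lemma F_lipschitz_ball: "\<exists>L. L-lipschitz_on (cball 0 R) F"
proof -
  have "local_lipschitz {0::real} UNIV (\<lambda>t. F)"
  proof (rule local_lipschitzI)
    fix t :: real and v
    obtain r L where r: "r > 0" "L-lipschitz_on (cball v r) F" using lipF unfolding locally_lipschitz_def by blast
    show "\<exists>u>0. \<exists>L. \<forall>t\<in>cball t u \<inter> {0}. L-lipschitz_on (cball v u \<inter> UNIV) F"
      using r by (intro exI[of _ r] conjI exI[of _ L] ballI) auto
  qed
  then have "local_lipschitz {0::real} (cball 0 R) (\<lambda>t. F)"
    by (rule local_lipschitz_subset) auto
  then obtain L where "\<And>t. t \<in> {0::real} \<Longrightarrow> L-lipschitz_on (cball 0 R) F"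
    by (rule local_lipschitz_compact_implies_lipschitz) auto
  then show ?thesis by blast
qed

lemma at_point_diff: "at_point U x - at_point W x = at_point (U - W) x"
  by (simp add: at_point_def vec_eq_iff)

lemma norm_at_point: "norm (at_point U x) \<le> norm U"
  unfolding norm_vec_def at_point_def by (intro L2_set_mono) (auto intro: norm_bounded[where 'b = real, simplified])

lemma continuous_at_point: "continuous_on A (at_point U)"
  unfolding at_point_def by (intro continuous_intros) auto

lemma F_at_point_bcontfun: "(\<lambda>x. F (at_point U x) $ i - c) \<in> bcontfun"
proof -
  have "bounded (F ` cball 0 (norm U))"
    by (intro compact_imp_bounded compact_continuous_image F_continuous) auto
  then obtain B where B: "\<And>v. norm v \<le> norm U \<Longrightarrow> norm (F v) \<le> B"
    unfolding bounded_iff by force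
  show ?thesis
  proof (rule bcontfun_normI[of _ "B + \<bar>c\<bar>"])
    show "continuous_on UNIV (\<lambda>x. F (at_point U x) $ i - c)"
      by (intro continuous_intros continuous_on_compose2[OF F_continuous continuous_at_point]) auto
    show "norm (F (at_point U x) $ i - c) \<le> B + \<bar>c\<bar>" for x
      using B[OF norm_at_point[of U x]] component_le_norm_cart[of "F (at_point U x)" i] by simp
  qed
qed

definition N :: "'n \<Rightarrow> ('a \<Rightarrow>\<^sub>C real) ^ 'n \<Rightarrow> 'a \<Rightarrow>\<^sub>C real" where
  "N i U = Bcontfun (\<lambda>x. F (at_point U x) $ i - F 0 $ i)"

lemma apply_N: "ap (N i U) x = F (at_point U x) $ i - F 0 $ i"
  unfolding N_def by (simp add: apply_Bcontfun F_at_point_bcontfun)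

lemma N_C0: "U \<in> C0n \<Longrightarrow> N i U \<in> C0 \<Omega>"
proof -
  assume U: "U \<in> C0n"
  have "at_point U x = 0" if "x \<notin> \<Omega>" for x
    using U that C0_zero[OF _ open_dom] by (auto simp: at_point_def vec_eq_iff C0n_def)
  then show ?thesis by (simp add: C0_iff[OF open_dom] apply_N)
qed

lemma N_lipschitz:
  assumes "L-lipschitz_on (cball 0 R) F" "norm U \<le> R" "norm W \<le> R"
  shows "norm (N i U - N i W) \<le> L * norm (U - W)"
proof (rule norm_bound)
  fix x
  have L: "L \<ge> 0" using assms(1) by (rule lipschitz_on_nonneg)
  have "norm (ap (N i U - N i W) x) = \<bar>(F (at_point U x) - F (at_point W x)) $ i\<bar>"
    by (simp add: apply_N)
  also have "\<dots> \<le> norm (F (at_point U x) - F (at_point W x))" by (rule component_le_norm_cart)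
  also have "\<dots> \<le> L * norm (at_point U x - at_point W x)"
    using lipschitz_onD[OF assms(1), of "at_point U x" "at_point W x"] norm_at_point[of U x] norm_at_point[of W x] assms
    by (auto simp: dist_norm)
  also have "\<dots> \<le> L * norm (U - W)"
    unfolding at_point_diff using L norm_at_point by (intro mult_left_mono)
  finally show "norm (ap (N i U - N i W) x) \<le> L * norm (U - W)" .
qed

lemma N_continuous: "continuous_on A (N i)"
proof -
  have "isCont (N i) U" for U
  proof -
    obtain L where L: "L-lipschitz_on (cball 0 (norm U + 1)) F" using F_lipschitz_ball by blast
    have "L-lipschitz_on (cball U 1) (N i)"
    proof (rule lipschitz_onI)
      fix W Z assume "W \<in> cball U 1" "Z \<in> cball U 1"
      then have "norm W \<le> norm U + 1" "norm Z \<le> norm U + 1"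
        using norm_triangle_ineq2[of W U] norm_triangle_ineq2[of Z U] by (auto simp: dist_norm norm_minus_commute)
      then show "dist (N i W) (N i Z) \<le> L * dist W Z"
        using N_lipschitz[OF L] by (simp add: dist_norm)
    qed (use lipschitz_on_nonneg[OF L] in simp)
    then have "continuous_on (ball U 1) (N i)"
      by (intro continuous_on_subset[OF lipschitz_on_continuous_on]) auto
    then show ?thesis by (simp add: continuous_on_eq_continuous_at)
  qed
  then show ?thesis by (simp add: continuous_at_imp_continuous_on)
qed

text \<open>The Duhamel integral over \<open>[0, t]\<close>, rescaled to \<open>[0, 1]\<close> so that its continuity in \<open>t\<close> is that of a
  parameter-dependent integral.\<close>

definition duh :: "(real \<Rightarrow> ('a \<Rightarrow>\<^sub>C real) ^ 'n) \<Rightarrow> 'n \<Rightarrow> real \<Rightarrow> 'a \<Rightarrow>\<^sub>C real" where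
  "duh U i t = t *\<^sub>R integral {0..1} (\<lambda>\<sigma>. PP i (t * (1 - \<sigma>)) (N i (U (t * \<sigma>))))"

text \<open>The Duhamel formula with the reaction term split into \<open>N\<close> and the constant
  \<open>F 0\<close>, whose potential is \<open>V\<close>. For \<open>U0\<close> and
  \<open>U\<close> with components in \<open>C0 \<Omega>\<close>, every term lies in
  \<open>C0 \<Omega>\<close> without recourse to \<open>L2\<close> representatives.\<close>

definition rhs :: "(real \<Rightarrow> ('a \<Rightarrow>\<^sub>C real) ^ 'n) \<Rightarrow> ('a \<Rightarrow>\<^sub>C real) ^ 'n \<Rightarrow> real \<Rightarrow> ('a \<Rightarrow>\<^sub>C real) ^ 'n" where
  "rhs U U0 t = (\<chi> i. PP i t (U0 $ i) + duh U i t + (F 0 $ i) *\<^sub>R V i t)"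

lemma duh_integrand_continuous:
  assumes "continuous_on {0..T} U" "\<And>s. s \<in> {0..T} \<Longrightarrow> U s \<in> C0n" "T \<ge> 0"
  shows "continuous_on ({0..T} \<times> {0..1}) (\<lambda>(t, \<sigma>). PP i (t * (1 - \<sigma>)) (N i (U (t * \<sigma>))))"
proof -
  have m: "t * \<sigma> \<in> {0..T}" if "t \<in> {0..T}" "\<sigma> \<in> {0..1}" for t \<sigma> :: real
    using that mult_mono[of t T \<sigma> 1] by auto
  show ?thesis
    unfolding split_beta
  proof (rule hs.continuous_on_P)
    show "continuous_on ({0..T} \<times> {0..1}) (\<lambda>x. N i (U (fst x * snd x)))"
    proof (rule continuous_on_compose2[OF N_continuous[of UNIV]])
      show "continuous_on ({0..T} \<times> {0..1}) (\<lambda>x. U (fst x * snd x))"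
        by (rule continuous_on_compose2[OF assms(1)]) (use m in \<open>auto intro!: continuous_intros\<close>)
    qed simp
  next
    fix x :: "real \<times> real" assume "x \<in> {0..T} \<times> {0..1}"
    then have x: "fst x \<in> {0..T}" "snd x \<in> {0..1}" by auto
    show "0 \<le> fst x * (1 - snd x)" using x by auto
    show "N i (U (fst x * snd x)) \<in> C0 \<Omega>" by (intro N_C0 assms(2) m x)
  qed (intro continuous_intros)
qed

lemma duh_continuous:
  assumes "continuous_on {0..T} U" "\<And>s. s \<in> {0..T} \<Longrightarrow> U s \<in> C0n" "T \<ge> 0"
  shows "continuous_on {0..T} (duh U i)"
  unfolding duh_def
  using integral_continuous_on_param[of "{0..T}" 0 1 "\<lambda>t \<sigma>. PP i (t * (1 - \<sigma>)) (N i (U (t * \<sigma>)))"]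
    duh_integrand_continuous[OF assms]
  by (intro continuous_intros) simp

lemma duh_integrand_integrable:
  assumes "continuous_on {0..T} U" "\<And>s. s \<in> {0..T} \<Longrightarrow> U s \<in> C0n" "t \<in> {0..T}"
  shows "(\<lambda>\<sigma>. PP i (t * (1 - \<sigma>)) (N i (U (t * \<sigma>)))) integrable_on {0..1}"
proof (rule integrable_continuous_real)
  have "continuous_on {0..1::real} (\<lambda>\<sigma>. case (t, \<sigma>) of (t, \<sigma>) \<Rightarrow> PP i (t * (1 - \<sigma>)) (N i (U (t * \<sigma>))))"
    by (rule continuous_on_compose2[OF duh_integrand_continuous[OF assms(1,2)]])
      (use assms(3) in \<open>auto intro!: continuous_intros\<close>)
  then show "continuous_on {0..1} (\<lambda>\<sigma>. PP i (t * (1 - \<sigma>)) (N i (U (t * \<sigma>))))" by simp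
qed

lemma duh_C0:
  assumes "continuous_on {0..T} U" "\<And>s. s \<in> {0..T} \<Longrightarrow> U s \<in> C0n" "t \<in> {0..T}"
  shows "duh U i t \<in> C0 \<Omega>"
proof -
  have "integral {0..1} (\<lambda>\<sigma>. PP i (t * (1 - \<sigma>)) (N i (U (t * \<sigma>)))) \<in> C0 \<Omega>"
  proof (rule hs.integral_C0[OF duh_integrand_integrable[OF assms]])
    fix \<sigma> :: real assume s: "\<sigma> \<in> {0..1}"
    have "t * \<sigma> \<in> {0..T}" using s assms(3) mult_mono[of t T \<sigma> 1] by auto
    then show "PP i (t * (1 - \<sigma>)) (N i (U (t * \<sigma>))) \<in> C0 \<Omega>"
      using s assms(3) by (intro hs.P_C0 N_C0 assms(2)) auto
  qed
  then show ?thesis unfolding duh_def by (rule subspace_scale[OF subspace_C0])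
qed

lemma duh_integral:
  assumes U: "continuous_on {0..t} U" "\<And>s. s \<in> {0..t} \<Longrightarrow> U s \<in> C0n" and t: "t \<ge> 0"
  shows "((\<lambda>s. PP i (t - s) (N i (U s))) has_integral duh U i t) {0..t}"
proof -
  have "continuous_on {0..t} (\<lambda>s. PP i (t - s) (N i (U s)))"
    by (intro hs.continuous_on_P continuous_intros continuous_on_compose2[OF N_continuous[of UNIV] U(1)] N_C0 U(2)) auto
  from has_integral_rescale[OF this t] show ?thesis
    by (simp add: duh_def right_diff_distrib)
qed

text \<open>The requirement at a single time. It involves \<open>U\<close> on \<open>{0..t}\<close>
  only, on which the restriction and the glueing of solutions rely.\<close>

definition mild_at :: "(real \<Rightarrow> ('a \<Rightarrow>\<^sub>C real) ^ 'n) \<Rightarrow> real \<Rightarrow> bool" where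
  "mild_at U t \<longleftrightarrow> (\<forall>i. U t $ i \<in> C0 \<Omega> \<and>
        (\<exists>w. has_L2_integral \<Omega> (\<lambda>s. S i (t - s) (\<lambda>x. F (at_point (U s) x) $ i)) 0 t w \<and>
             L2_eq \<Omega> (ap (U t $ i))
                     (\<lambda>x. S i t (ap (U 0 $ i)) x + w x)))"

lemma mild_solution_iff:
  "mild_solution \<Omega> S F T U \<longleftrightarrow> 0 < T \<and> continuous_on {t. 0 \<le> t \<and> ereal t < T} U \<and>
     (\<forall>t. 0 \<le> t \<and> ereal t < T \<longrightarrow> mild_at U t)"
  by (simp add: mild_solution_def mild_at_def)

lemma mild_at_cong:
  assumes "mild_at U t" "t \<ge> 0" "\<And>s. s \<in> {0..t} \<Longrightarrow> U' s = U s"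
  shows "mild_at U' t"
proof -
  have "has_L2_integral \<Omega> (\<lambda>s. S i (t - s) (\<lambda>x. F (at_point (U' s) x) $ i)) 0 t w \<longleftrightarrow>
    has_L2_integral \<Omega> (\<lambda>s. S i (t - s) (\<lambda>x. F (at_point (U s) x) $ i)) 0 t w" for i w
  proof -
    have "((\<lambda>s. ip (S i (t - s) (\<lambda>x. F (at_point (U' s) x) $ i)) \<phi>) has_integral I) {0..t} \<longleftrightarrow>
      ((\<lambda>s. ip (S i (t - s) (\<lambda>x. F (at_point (U s) x) $ i)) \<phi>) has_integral I) {0..t}" for \<phi> I
      by (rule has_integral_cong) (simp add: assms(3))
    moreover have "(\<forall>s\<in>{0..t}. S i (t - s) (\<lambda>x. F (at_point (U' s) x) $ i) \<in> L2 \<Omega>) \<longleftrightarrow>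
      (\<forall>s\<in>{0..t}. S i (t - s) (\<lambda>x. F (at_point (U s) x) $ i) \<in> L2 \<Omega>)"
      by (rule ball_cong) (simp_all add: assms(3))
    ultimately show ?thesis unfolding has_L2_integral_def by presburger
  qed
  then show ?thesis using assms by (simp add: mild_at_def)
qed

lemma F_at_point_split:
  assumes U: "U \<in> C0n" and t: "t \<ge> 0" and p: "p \<in> L2 \<Omega>"
  shows "(\<lambda>x. F (at_point U x) $ i) \<in> L2 \<Omega>"
    "ip (S i t (\<lambda>x. F (at_point U x) $ i)) p = ip (ap (PP i t (N i U))) p + F 0 $ i * ip (S i t (\<lambda>x. 1)) p"
proof -
  have e: "(\<lambda>x. F (at_point U x) $ i) = (\<lambda>x. 1 * ap (N i U) x + F 0 $ i * 1)"
    by (simp add: apply_N)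
  show "(\<lambda>x. F (at_point U x) $ i) \<in> L2 \<Omega>"
    unfolding e by (intro L2_lin L2_bcontfun L2_const)
  show "ip (S i t (\<lambda>x. F (at_point U x) $ i)) p = ip (ap (PP i t (N i U))) p + F 0 $ i * ip (S i t (\<lambda>x. 1)) p"
    unfolding e by (subst hs.S_lin[OF t L2_bcontfun L2_const p]) (simp add: hs.ip_P[OF t N_C0[OF U] p])
qed

text \<open>Paired with \<open>p\<close>, the integrand of the mild formulation splits by
  \<open>F_at_point_split\<close> into the parts that integrate to \<open>duh\<close> and to a
  multiple of \<open>V\<close>. The potential \<open>V\<close> integrates over the elapsed time
  \<open>s\<close>, whence the reversal to \<open>t - s\<close>.\<close>

lemma mild_at_rhs:
  assumes U: "continuous_on {0..t} U" "\<And>s. s \<in> {0..t} \<Longrightarrow> U s \<in> C0n" and t: "t \<ge> 0"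
    and eq: "U t = rhs U (U 0) t"
  shows "mild_at U t"
  unfolding mild_at_def
proof (intro allI conjI)
  fix i
  show "U t $ i \<in> C0 \<Omega>" using U(2)[of t] t by (simp add: C0n_def)
  define w where "w = duh U i t + (F 0 $ i) *\<^sub>R V i t"
  show "\<exists>w. has_L2_integral \<Omega> (\<lambda>s. S i (t - s) (\<lambda>x. F (at_point (U s) x) $ i)) 0 t w \<and>
             L2_eq \<Omega> (ap (U t $ i)) (\<lambda>x. S i t (ap (U 0 $ i)) x + w x)"
  proof (intro exI[of _ "ap w"] conjI)
    have U0: "U 0 $ i \<in> C0 \<Omega>" using U(2)[of 0] t by (simp add: C0n_def)
    have "U t $ i = PP i t (U 0 $ i) + w" by (subst eq) (simp add: rhs_def w_def)
    then show "L2_eq \<Omega> (ap (U t $ i)) (\<lambda>x. S i t (ap (U 0 $ i)) x + ap w x)"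
      using hs.P_S[OF t U0] by (auto simp: L2_eq_def elim: eventually_mono)
    show "has_L2_integral \<Omega> (\<lambda>s. S i (t - s) (\<lambda>x. F (at_point (U s) x) $ i)) 0 t (ap w)"
      unfolding has_L2_integral_def
    proof (intro conjI ballI L2_bcontfun)
      fix s assume s: "s \<in> {0..t}"
      show "S i (t - s) (\<lambda>x. F (at_point (U s) x) $ i) \<in> L2 \<Omega>"
        by (rule hs.S_L2) (use s F_at_point_split(1)[OF U(2)[OF s] order_refl L2_const] in auto)
    next
      fix p assume p: "p \<in> L2 \<Omega>"
      have 1: "((\<lambda>s. ip (ap (PP i (t - s) (N i (U s)))) p) has_integral ip (ap (duh U i t)) p) {0..t}"
        using has_integral_linear[OF duh_integral[OF U t] bounded_linear_ip[OF p]] by (simp add: o_def)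
      have 2: "((\<lambda>s. ip (S i (t - s) (\<lambda>x. 1)) p) has_integral ip (ap (V i t)) p) {0..t}"
        by (rule has_integral_reverse[OF V_integral[OF t p] t])
      have "((\<lambda>s. ip (ap (PP i (t - s) (N i (U s)))) p + F 0 $ i * ip (S i (t - s) (\<lambda>x. 1)) p)
          has_integral ip (ap (duh U i t)) p + F 0 $ i * ip (ap (V i t)) p) {0..t}"
        by (intro has_integral_add has_integral_mult_right 1 2)
      also have "ip (ap (duh U i t)) p + F 0 $ i * ip (ap (V i t)) p = ip (ap w) p"
        using ip_lin[OF L2_bcontfun[of "duh U i t"] L2_bcontfun[of "V i t"] p, of 1] by (simp add: w_def)
      finally have "((\<lambda>s. ip (ap (PP i (t - s) (N i (U s)))) p + F 0 $ i * ip (S i (t - s) (\<lambda>x. 1)) p)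
          has_integral ip (ap w) p) {0..t}" .
      then show "((\<lambda>s. ip (S i (t - s) (\<lambda>x. F (at_point (U s) x) $ i)) p) has_integral ip (ap w) p) {0..t}"
        by (rule has_integral_eq[rotated]) (simp add: F_at_point_split(2)[OF U(2) _ p])
    qed
  qed
qed

end

section \<open>Local existence by the contraction principle\<close>

context reaction_diffusion
begin

lemma closed_C0n: "closed C0n"
proof -
  have "C0n = (\<Inter>i. (\<lambda>U. U $ i) -` C0 \<Omega>)" by (auto simp: C0n_def)
  moreover have "closed ((\<lambda>U. U $ i) -` C0 \<Omega>)" for i
    by (intro closed_vimage closed_C0 continuous_intros)
  ultimately show ?thesis by auto
qed

lemma duh_diff_le:
  assumes U: "continuous_on {0..t} U" "\<And>s. s \<in> {0..t} \<Longrightarrow> U s \<in> C0n"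
    and W: "continuous_on {0..t} W" "\<And>s. s \<in> {0..t} \<Longrightarrow> W s \<in> C0n"
    and t: "t \<ge> 0" and c: "\<And>s. s \<in> {0..t} \<Longrightarrow> norm (N i (U s) - N i (W s)) \<le> c"
  shows "norm (duh U i t - duh W i t) \<le> t * c"
proof -
  have "((\<lambda>s. PP i (t - s) (N i (U s)) - PP i (t - s) (N i (W s))) has_integral duh U i t - duh W i t) {0..t}"
    by (intro has_integral_diff duh_integral U W t)
  then have "norm (duh U i t - duh W i t) \<le> integral {0..t} (\<lambda>s. c)"
  proof (subst integral_unique[symmetric], assumption, intro integral_norm_bound_integral)
    fix s assume s: "s \<in> {0..t}"
    have "PP i (t - s) (N i (U s)) - PP i (t - s) (N i (W s)) = PP i (t - s) (N i (U s) - N i (W s))"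
      using s by (intro hs.P_diff[symmetric] N_C0 U W) auto
    also have "norm \<dots> \<le> norm (N i (U s) - N i (W s))"
      using s by (intro hs.P_norm hs.C0_diff N_C0 U W) auto
    also have "\<dots> \<le> c" by (rule c[OF s])
    finally show "norm (PP i (t - s) (N i (U s)) - PP i (t - s) (N i (W s))) \<le> c" .
  qed (auto intro: has_integral_integrable)
  then show ?thesis using t by simp
qed

lemma duh_le:
  assumes U: "continuous_on {0..t} U" "\<And>s. s \<in> {0..t} \<Longrightarrow> U s \<in> C0n"
    and t: "t \<ge> 0" and c: "\<And>s. s \<in> {0..t} \<Longrightarrow> norm (N i (U s)) \<le> c"
  shows "norm (duh U i t) \<le> t * c"
proof -
  have "norm (duh U i t) \<le> integral {0..t} (\<lambda>s. c)"
    using duh_integral[OF U t, of i]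
  proof (subst integral_unique[symmetric], assumption, intro integral_norm_bound_integral)
    fix s assume s: "s \<in> {0..t}"
    have "norm (PP i (t - s) (N i (U s))) \<le> norm (N i (U s))"
      using s by (intro hs.P_norm N_C0 U) auto
    then show "norm (PP i (t - s) (N i (U s))) \<le> c" using c[OF s] by simp
  qed (auto intro: has_integral_integrable)
  then show ?thesis using t by simp
qed

lemma rhs_continuous:
  assumes U: "continuous_on {0..T} U" "\<And>s. s \<in> {0..T} \<Longrightarrow> U s \<in> C0n" "T \<ge> 0" and U0: "U0 \<in> C0n"
  shows "continuous_on {0..T} (rhs U U0)"
  unfolding rhs_def
proof (rule continuous_on_vec_lambda)
  fix i
  have "continuous_on {0..T} (\<lambda>t. PP i t (U0 $ i))"
    using U0 by (intro hs.continuous_on_P continuous_intros) (auto simp: C0n_def)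
  then show "continuous_on {0..T} (\<lambda>t. PP i t (U0 $ i) + duh U i t + F 0 $ i *\<^sub>R V i t)"
    by (intro continuous_intros duh_continuous[OF U] continuous_on_subset[OF V_continuous]) auto
qed

lemma rhs_C0n:
  assumes U: "continuous_on {0..T} U" "\<And>s. s \<in> {0..T} \<Longrightarrow> U s \<in> C0n" "t \<in> {0..T}" and U0: "U0 \<in> C0n"
  shows "rhs U U0 t \<in> C0n"
proof -
  have "PP i t (U0 $ i) + duh U i t + F 0 $ i *\<^sub>R V i t \<in> C0 \<Omega>" for i
    by (intro subspace_add[OF subspace_C0] subspace_scale[OF subspace_C0] hs.P_C0 V_C0 duh_C0[OF U])
      (use U0 assms(3) in \<open>auto simp: C0n_def\<close>)
  then show ?thesis by (simp add: C0n_def rhs_def)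
qed

lemma local_existence:
  assumes U0: "U0 \<in> C0n"
  shows "\<exists>T>0. \<exists>U. U 0 = U0 \<and> continuous_on {0..T} U \<and> (\<forall>t\<in>{0..T}. U t \<in> C0n \<and> U t = rhs U U0 t)"
proof -
  \<comment> \<open>\<open>R\<close> bounds every value within distance 1 of \<open>U0\<close>, so
    that one Lipschitz constant serves all candidates.\<close>
  define R where "R = norm U0 + 1"
  obtain L where L: "L-lipschitz_on (cball 0 R) F" using F_lipschitz_ball by blast
  have L0: "L \<ge> 0" by (rule lipschitz_on_nonneg[OF L])
  have Rball: "norm u \<le> R" if "norm (u - U0) \<le> 1" for u
    using norm_triangle_ineq2[of u U0] that by (simp add: R_def)
  define B where "B = (\<Sum>i\<in>UNIV. norm (N i U0)) + L"
  have NB: "norm (N i u) \<le> B" if u: "norm (u - U0) \<le> 1" for u i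
  proof -
    have "norm (N i u) \<le> norm (N i U0) + norm (N i u - N i U0)"
      using norm_triangle_ineq[of "N i U0" "N i u - N i U0"] by simp
    also have "norm (N i u - N i U0) \<le> L * norm (u - U0)"
      by (rule N_lipschitz[OF L Rball[OF u]]) (simp add: R_def)
    also have "L * norm (u - U0) \<le> L" using mult_left_mono[OF u L0] by simp
    also have "norm (N i U0) \<le> (\<Sum>i\<in>UNIV. norm (N i U0))" by (rule member_le_sum) auto
    finally show ?thesis by (simp add: B_def)
  qed
  define n where "n = real CARD('n)"
  have n: "n > 0" by (simp add: n_def)
  \<comment> \<open>\<open>g i t\<close> bounds the distance of component \<open>i\<close> of the
    right-hand side from \<open>U0 $ i\<close> for all candidates at once. With \<open>n\<close>
    components, a bound \<open>1 / n\<close> for each gives total distance at most 1.\<close>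
  define g where "g i t = norm (PP i t (U0 $ i) - U0 $ i) + t * B + \<bar>F 0 $ i\<bar> * norm (V i t)" for i t
  have g_lim: "(g i \<longlongrightarrow> 0) (at_right 0)" for i
  proof -
    have "((\<lambda>t. PP i t (U0 $ i)) \<longlongrightarrow> U0 $ i) (at_right 0)"
      using U0 by (intro hs.P_right_continuous_0) (simp add: C0n_def)
    moreover have "(V i \<longlongrightarrow> V i 0) (at 0 within {0..})"
      using V_continuous[of i] by (simp add: continuous_on_def)
    then have "(V i \<longlongrightarrow> 0) (at_right 0)"
      unfolding V_0 by (rule tendsto_within_subset) auto
    ultimately have "(g i \<longlongrightarrow> norm (U0 $ i - U0 $ i) + 0 * B + \<bar>F 0 $ i\<bar> * norm (0 :: 'a \<Rightarrow>\<^sub>C real)) (at_right 0)"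
      unfolding g_def by (intro tendsto_intros)
    then show ?thesis by simp
  qed
  have "\<forall>\<^sub>F t in at_right 0. \<forall>i\<in>UNIV. g i t < 1 / n"
    using g_lim n by (intro eventually_ball_finite ballI order_tendstoD(2)[of "g _"]) auto
  then obtain b where b: "b > 0" "\<And>t i. 0 < t \<Longrightarrow> t < b \<Longrightarrow> g i t < 1 / n"
    unfolding eventually_at_right_field by auto
  \<comment> \<open>The first entry keeps \<open>{0..\<tau>}\<close> below \<open>b\<close>; the
    second makes the contraction factor \<open>n * (\<tau> * L)\<close> at most one half, with
    \<open>L + 1\<close> in place of \<open>L\<close> to allow \<open>L = 0\<close>.\<close>
  define \<tau> where "\<tau> = min (b / 2) (1 / (2 * n * (L + 1)))"
  have \<tau>: "\<tau> > 0" using b n L0 by (simp add: \<tau>_def)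
  have g_le: "g i t \<le> 1 / n" if "t \<in> {0..\<tau>}" for i t
  proof (cases "t = 0")
    case True
    have "U0 $ i \<in> C0 \<Omega>" using U0 by (simp add: C0n_def)
    then show ?thesis using True n by (simp add: g_def hs.P_0 V_0)
  next
    case False
    then show ?thesis using b(2)[of t i] that b(1) by (simp add: \<tau>_def)
  qed
  have \<tau>L: "n * (\<tau> * L) \<le> 1 / 2"
  proof -
    have "\<tau> * L \<le> 1 / (2 * n * (L + 1)) * L" using L0 by (intro mult_right_mono) (auto simp: \<tau>_def)
    also have "\<dots> = 1 / (2 * n) * (L / (L + 1))" by simp
    also have "\<dots> \<le> 1 / (2 * n) * 1" using L0 n by (intro mult_left_mono) auto
    finally show ?thesis using n by (simp add: field_simps)
  qed
  \<comment> \<open>Candidates are bounded continuous functions on the whole line, so that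
    completeness is at hand; the clamp extends the right-hand side by constants outside
    \<open>{0..\<tau>}\<close>.\<close>
  define cl where "cl t = max 0 (min \<tau> t)" for t
  have cl: "cl t \<in> {0..\<tau>}" for t using \<tau> by (auto simp: cl_def)
  have clid: "t \<in> {0..\<tau>} \<Longrightarrow> cl t = t" for t by (auto simp: cl_def)
  define Z where "Z = PiC UNIV (\<lambda>_::real. C0n \<inter> cball U0 1)"
  have Z: "ap u t \<in> C0n" "norm (ap u t - U0) \<le> 1" if "u \<in> Z" for u t
    using mem_PiCD[OF that[unfolded Z_def]] by (auto simp: dist_norm norm_minus_commute Pi_iff)
  have uc: "continuous_on A (ap u)" for A and u :: "real \<Rightarrow>\<^sub>C (('a \<Rightarrow>\<^sub>C real) ^ 'n)" by simp
  have rhs_near: "norm (rhs (ap u) U0 t - U0) \<le> 1" if u: "u \<in> Z" and t: "t \<in> {0..\<tau>}" for u t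
  proof -
    have "norm (rhs (ap u) U0 t - U0) \<le> real CARD('n) * (1 / n)"
    proof (rule norm_vec_le_CARD)
      fix i
      have "(rhs (ap u) U0 t - U0) $ i =
          (PP i t (U0 $ i) - U0 $ i) + duh (ap u) i t + F 0 $ i *\<^sub>R V i t"
        by (simp add: rhs_def)
      also have "norm \<dots> \<le> norm (PP i t (U0 $ i) - U0 $ i) + norm (duh (ap u) i t) + norm (F 0 $ i *\<^sub>R V i t)"
        by (intro norm_triangle_le add_mono norm_triangle_ineq order_refl)
      also have "\<dots> \<le> g i t"
        unfolding g_def using t by (intro add_mono duh_le uc Z[OF u] NB) auto
      also have "\<dots> \<le> 1 / n" by (rule g_le[OF t])
      finally show "norm ((rhs (ap u) U0 t - U0) $ i) \<le> 1 / n" .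
    qed
    then show ?thesis using n by (simp add: n_def)
  qed
  define \<Phi> where "\<Phi> u = Bcontfun (\<lambda>t. rhs (ap u) U0 (cl t))" for u
  have \<Phi>: "ap (\<Phi> u) t = rhs (ap u) U0 (cl t)" if u: "u \<in> Z" for u t
  proof -
    have "(\<lambda>t. rhs (ap u) U0 (cl t)) \<in> bcontfun"
    proof (rule bcontfun_normI)
      show "continuous_on UNIV (\<lambda>t. rhs (ap u) U0 (cl t))"
      proof (rule continuous_on_compose2[OF rhs_continuous[of \<tau>, OF uc Z(1)[OF u] _ U0]])
        show "continuous_on UNIV cl" unfolding cl_def by (intro continuous_intros)
      qed (use cl \<tau> in auto)
      show "norm (rhs (ap u) U0 (cl t)) \<le> R" for t
        by (rule Rball[OF rhs_near[OF u cl]])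
    qed
    then show ?thesis by (simp add: \<Phi>_def Bcontfun_inverse)
  qed
  have "\<exists>!u. u \<in> Z \<and> \<Phi> u = u"
  proof (rule Banach_fix)
    show "complete Z" unfolding Z_def complete_eq_closed by (intro closed_PiC closed_Int closed_C0n closed_cball)
    have "const_bcontfun U0 \<in> Z" using U0 by (simp add: Z_def mem_PiC_iff const_bcontfun.rep_eq)
    then show "Z \<noteq> {}" by blast
    show "\<Phi> ` Z \<subseteq> Z"
    proof
      fix y assume "y \<in> \<Phi> ` Z"
      then obtain u where u: "u \<in> Z" "y = \<Phi> u" by blast
      show "y \<in> Z"
        unfolding u(2) Z_def mem_PiC_iff
        using rhs_near[OF u(1) cl] rhs_C0n[OF uc Z(1)[OF u(1)] cl U0]
        by (auto simp: \<Phi>[OF u(1)] dist_norm norm_minus_commute)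
    qed
    show "dist (\<Phi> u) (\<Phi> v) \<le> 1 / 2 * dist u v" if uv: "u \<in> Z" "v \<in> Z" for u v
    proof (rule dist_bound)
      fix t
      have "norm (rhs (ap u) U0 (cl t) - rhs (ap v) U0 (cl t)) \<le> real CARD('n) * (\<tau> * (L * dist u v))"
      proof (rule norm_vec_le_CARD)
        fix i
        have "(rhs (ap u) U0 (cl t) - rhs (ap v) U0 (cl t)) $ i =
            duh (ap u) i (cl t) - duh (ap v) i (cl t)"
          by (simp add: rhs_def)
        also have "norm \<dots> \<le> cl t * (L * dist u v)"
        proof (intro duh_diff_le uc Z(1) uv)
          fix s
          have "norm (N i (ap u s) - N i (ap v s)) \<le> L * norm (ap u s - ap v s)"
            by (intro N_lipschitz[OF L] Rball Z(2) uv)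
          also have "\<dots> \<le> L * dist u v"
            using dist_bounded[of u s v] L0 by (intro mult_left_mono) (simp_all add: dist_norm)
          finally show "norm (N i (ap u s) - N i (ap v s)) \<le> L * dist u v" .
        qed (use cl[of t] in auto)
        also have "\<dots> \<le> \<tau> * (L * dist u v)" using cl[of t] L0 by (intro mult_right_mono) auto
        finally show "norm ((rhs (ap u) U0 (cl t) - rhs (ap v) U0 (cl t)) $ i) \<le> \<tau> * (L * dist u v)" .
      qed
      also have "\<dots> = n * (\<tau> * L) * dist u v" by (simp add: n_def)
      also have "\<dots> \<le> 1 / 2 * dist u v" using \<tau>L by (intro mult_right_mono) auto
      finally show "dist (ap (\<Phi> u) t) (ap (\<Phi> v) t) \<le> 1 / 2 * dist u v"
        by (simp add: \<Phi> uv dist_norm)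
    qed
  qed auto
  then obtain u where u: "u \<in> Z" "\<Phi> u = u" by blast
  have eq: "ap u t = rhs (ap u) U0 t" if "t \<in> {0..\<tau>}" for t
    using \<Phi>[OF u(1), of t] u(2) clid[OF that] by simp
  have "ap u 0 = U0"
    using eq[of 0] \<tau> U0 by (simp add: rhs_def duh_def V_0 hs.P_0 C0n_def vec_eq_iff)
  moreover have "\<forall>t\<in>{0..\<tau>}. ap u t \<in> C0n \<and> ap u t = rhs (ap u) U0 t"
    using eq Z(1)[OF u(1)] by blast
  ultimately show ?thesis using \<tau> uc by blast
qed

section \<open>Maximal solutions\<close>

definition restr :: "ereal \<Rightarrow> (real \<Rightarrow> ('a \<Rightarrow>\<^sub>C real) ^ 'n) \<Rightarrow> real \<Rightarrow> ('a \<Rightarrow>\<^sub>C real) ^ 'n" where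
  "restr T U t = (if 0 \<le> t \<and> ereal t < T then U t else 0)"

lemma mild_solution_cong:
  assumes "mild_solution \<Omega> S F T U" "\<And>t. 0 \<le> t \<Longrightarrow> ereal t < T \<Longrightarrow> U' t = U t"
  shows "mild_solution \<Omega> S F T U'"
proof -
  have "mild_at U' t" if t: "0 \<le> t" "ereal t < T" for t
  proof (rule mild_at_cong)
    show "mild_at U t" using assms(1) t by (simp add: mild_solution_iff)
    show "U' s = U s" if "s \<in> {0..t}" for s
    proof (rule assms(2))
      show "ereal s < T" using that t(2) by (auto intro: le_less_trans[of _ "ereal t"])
    qed (use that in auto)
  qed (use t in simp)
  moreover have "continuous_on {t. 0 \<le> t \<and> ereal t < T} U' = continuous_on {t. 0 \<le> t \<and> ereal t < T} U"
    by (rule continuous_on_cong) (auto simp: assms(2))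
  ultimately show ?thesis using assms(1) by (simp add: mild_solution_iff)
qed

lemma mild_solution_exists:
  assumes "U0 \<in> C0n"
  shows "\<exists>T U. mild_solution \<Omega> S F T U \<and> U 0 = U0"
proof -
  obtain T U where T: "(T::real) > 0" and U: "U 0 = U0" "continuous_on {0..T} U"
    "\<And>t. t \<in> {0..T} \<Longrightarrow> U t \<in> C0n" "\<And>t. t \<in> {0..T} \<Longrightarrow> U t = rhs U U0 t"
    using local_existence[OF assms] by blast
  have "mild_at U t" if t: "0 \<le> t" "t < T" for t
    by (rule mild_at_rhs) (use t U in \<open>auto intro: continuous_on_subset\<close>)
  moreover have "continuous_on {t. 0 \<le> t \<and> ereal t < ereal T} U"
    by (rule continuous_on_subset[OF U(2)]) auto
  ultimately have "mild_solution \<Omega> S F (ereal T) U" using T by (simp add: mild_solution_iff)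
  then show ?thesis using U(1) by blast
qed

text \<open>The mild equation at \<open>t\<close> involves only times up to \<open>t\<close>, and
  continuity at \<open>t\<close> is local; both can be checked in any member of \<open>C\<close>
  that lives beyond \<open>t\<close>.\<close>

lemma mild_solution_chain_limit:
  assumes C: "C \<noteq> {}" "\<And>T U. (T, U) \<in> C \<Longrightarrow> mild_solution \<Omega> S F T U"
    and agree: "\<And>T U t. (T, U) \<in> C \<Longrightarrow> 0 \<le> t \<Longrightarrow> ereal t < T \<Longrightarrow> U' t = U t"
  shows "mild_solution \<Omega> S F (Sup (fst ` C)) U'"
proof -
  have cover: "\<exists>T U. (T, U) \<in> C \<and> ereal t < T" if "ereal t < Sup (fst ` C)" for t
    using that unfolding less_Sup_iff by auto
  have sol: "mild_solution \<Omega> S F T U'" if "(T, U) \<in> C" for T U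
    by (rule mild_solution_cong[OF C(2)[OF that]]) (rule agree[OF that])
  obtain T0 U0 where T0: "(T0, U0) \<in> C" using C(1) by auto
  have "0 < T0" using sol[OF T0] by (simp add: mild_solution_iff)
  also have "T0 \<le> Sup (fst ` C)" using T0 by (intro Sup_upper) force
  finally have pos: "0 < Sup (fst ` C)" .
  have "mild_at U' t" if t: "0 \<le> t" "ereal t < Sup (fst ` C)" for t
    using cover[OF t(2)] sol t(1) by (auto simp: mild_solution_iff)
  moreover have "continuous_on {t. 0 \<le> t \<and> ereal t < Sup (fst ` C)} U'"
    unfolding continuous_on_def
  proof
    fix t assume "t \<in> {t. 0 \<le> t \<and> ereal t < Sup (fst ` C)}"
    then obtain T U where TU: "(T, U) \<in> C" "0 \<le> t" "ereal t < T" using cover by blast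
    have TS: "T \<le> Sup (fst ` C)" using TU(1) by (intro Sup_upper) force
    have "open {s. ereal s < T}"
      by (intro open_Collect_less continuous_intros)
    then have "at t within {t. 0 \<le> t \<and> ereal t < Sup (fst ` C)} = at t within {t. 0 \<le> t \<and> ereal t < T}"
      using TU TS by (intro at_within_nhd[of t "{s. ereal s < T}"]) auto
    then show "(U' \<longlongrightarrow> U' t) (at t within {t. 0 \<le> t \<and> ereal t < Sup (fst ` C)})"
      using sol[OF TU(1)] TU(2,3) by (simp add: mild_solution_iff continuous_on_def)
  qed
  ultimately show ?thesis using pos by (simp add: mild_solution_iff)
qed

lemma maximal_solution_exists:
  assumes U0: "U0 \<in> C0n"
  shows "\<exists>T U. maximal_solution \<Omega> S F U0 T U"
proof -
  \<comment> \<open>\<open>restr\<close> sets the values outside the interval of existence to 0.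
    Otherwise two solutions that extend each other could differ there, and \<open>le\<close> would
    not be antisymmetric.\<close>
  define A where "A = {(T, U). mild_solution \<Omega> S F T U \<and> U 0 = U0 \<and> restr T U = U}"
  define le where "le p p' \<longleftrightarrow> fst p \<le> fst p' \<and> (\<forall>t. 0 \<le> t \<and> ereal t < fst p \<longrightarrow> snd p' t = snd p t)"
    for p p' :: "ereal \<times> (real \<Rightarrow> ('a \<Rightarrow>\<^sub>C real) ^ 'n)"
  have restr_A: "(T, restr T U) \<in> A" if "mild_solution \<Omega> S F T U" "U 0 = U0" for T U
  proof -
    have "0 < T" using that(1) by (simp add: mild_solution_iff)
    then have "restr T U 0 = U0" using that(2) by (simp add: restr_def zero_ereal_def)
    moreover have "mild_solution \<Omega> S F T (restr T U)"
      by (rule mild_solution_cong[OF that(1)]) (simp add: restr_def)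
    moreover have "restr T (restr T U) = restr T U" by (auto simp: restr_def)
    ultimately show ?thesis by (simp add: A_def)
  qed
  have antisym: "p = p'" if "p \<in> A" "p' \<in> A" "le p p'" "le p' p" for p p'
  proof -
    have "fst p = fst p'" using that(3,4) by (auto simp: le_def)
    moreover have "snd p' = snd p"
    proof
      fix t
      have r: "restr (fst p) (snd p) = snd p" "restr (fst p') (snd p') = snd p'"
        using that(1,2) by (auto simp: A_def)
      show "snd p' t = snd p t"
      proof (cases "0 \<le> t \<and> ereal t < fst p")
        case True
        then show ?thesis using that(3) by (simp add: le_def)
      next
        case False
        then have "restr (fst p) (snd p) t = 0" "restr (fst p') (snd p') t = 0"
          using \<open>fst p = fst p'\<close> by (auto simp: restr_def)
        then show ?thesis unfolding r by simp
      qed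
    qed
    ultimately show ?thesis by (simp add: prod_eq_iff)
  qed
  have trans: "le p r" if "le p p'" "le p' r" for p p' r
    unfolding le_def
  proof (intro conjI allI impI)
    show "fst p \<le> fst r" using that by (auto simp: le_def)
    fix t assume t: "0 \<le> t \<and> ereal t < fst p"
    then have "ereal t < fst p'" using that(1) less_le_trans[of "ereal t" "fst p" "fst p'"] by (simp add: le_def)
    then show "snd r t = snd p t" using t that by (simp add: le_def)
  qed
  have po: "partial_order_on A (relation_of le A)"
  proof (rule partial_order_on_relation_ofI)
    show "le p p" if "p \<in> A" for p by (simp add: le_def)
    show "le p r" if "p \<in> A" "p' \<in> A" "r \<in> A" "le p p'" "le p' r" for p p' r
      by (rule trans[OF that(4,5)])
    show "p = p'" if "p \<in> A" "p' \<in> A" "le p p'" "le p' p" for p p'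
      by (rule antisym[OF that])
  qed
  have "\<exists>m\<in>A. \<forall>a\<in>A. le m a \<longrightarrow> a = m"
  proof (rule predicate_Zorn[OF po])
    fix C assume C: "C \<in> Chains (relation_of le A)"
    then have CA: "C \<subseteq> A" and tot: "\<And>a b. a \<in> C \<Longrightarrow> b \<in> C \<Longrightarrow> le a b \<or> le b a"
      unfolding Chains_def relation_of_def by blast+
    show "\<exists>u\<in>A. \<forall>a\<in>C. le a u"
    proof (cases "C = {}")
      case True
      then show ?thesis using mild_solution_exists[OF U0] restr_A by blast
    next
      case False
      \<comment> \<open>Any member alive at \<open>t\<close> may be chosen, since members of a chain
        agree at common times. Where no member is alive, the value is arbitrary and is erased by
        \<open>restr\<close> afterwards.\<close>
      define U' where "U' t = snd (SOME p. p \<in> C \<and> ereal t < fst p) t" for t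
      have agree: "U' t = U t" if TU: "(T, U) \<in> C" "0 \<le> t" "ereal t < T" for T U t
      proof -
        let ?p = "SOME p. p \<in> C \<and> ereal t < fst p"
        have p: "?p \<in> C \<and> ereal t < fst ?p"
          by (rule someI[of _ "(T, U)"]) (use TU in simp)
        then have "snd ?p t = U t"
          using tot[of ?p "(T, U)"] TU by (auto simp: le_def)
        then show ?thesis by (simp add: U'_def)
      qed
      have sol: "mild_solution \<Omega> S F (Sup (fst ` C)) U'"
      proof (rule mild_solution_chain_limit[OF False])
        show "mild_solution \<Omega> S F T U" if "(T, U) \<in> C" for T U using that CA by (auto simp: A_def)
      qed (rule agree)
      obtain T U where TU: "(T, U) \<in> C" using False by auto
      then have "mild_solution \<Omega> S F T U" "U 0 = U0" using CA by (auto simp: A_def)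
      then have "U' 0 = U0" using agree[OF TU, of 0] by (simp add: mild_solution_iff zero_ereal_def)
      from restr_A[OF sol this] show ?thesis
      proof (rule bexI[rotated], intro ballI)
        fix a assume a: "a \<in> C"
        have "fst a \<le> Sup (fst ` C)" using a by (intro Sup_upper) auto
        then show "le a (Sup (fst ` C), restr (Sup (fst ` C)) U')"
          using agree[of "fst a" "snd a"] a by (auto simp: le_def restr_def intro: less_le_trans)
      qed
    qed
  qed
  then obtain m where m: "m \<in> A" "\<And>a. a \<in> A \<Longrightarrow> le m a \<Longrightarrow> a = m" by blast
  obtain T U where TU: "m = (T, U)" by (cases m)
  have sol: "mild_solution \<Omega> S F T U" "U 0 = U0" using m(1) by (auto simp: A_def TU)
  \<comment> \<open>A competing extension need not belong to \<open>A\<close>, so it is normalised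
    by \<open>restr\<close> before it is compared with \<open>m\<close>.\<close>
  have "T' = T" if "mild_solution \<Omega> S F T' U'" "T \<le> T'" "\<forall>t. 0 \<le> t \<and> ereal t < T \<longrightarrow> U' t = U t" for T' U'
  proof -
    have "0 < T" using sol(1) by (simp add: mild_solution_iff)
    then have "U' 0 = U0" using that(3) sol(2) by (simp add: zero_ereal_def)
    then have "(T', restr T' U') \<in> A" using that(1) by (intro restr_A)
    moreover have "le m (T', restr T' U')"
      using that(2,3) by (auto simp: le_def TU restr_def intro: less_le_trans)
    ultimately show ?thesis using m(2) TU by blast
  qed
  then show ?thesis using sol unfolding maximal_solution_def by blast
qed

text \<open>Paired with the indicator of the ball, the integrand of the mild formulation starts at
  \<open>F v $ i\<close> times the measure of the ball. It stays below half of this negative value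
  for short times, and the component itself starts from 0, so integration contradicts nonnegativity
  without any time derivative of \<open>U\<close>.\<close>

lemma negative_component:
  assumes sol: "mild_solution \<Omega> S F T U" and v: "F v $ i < 0" and r: "r > 0" "ball x0 r \<subseteq> \<Omega>"
    and U0: "U 0 $ i = 0" "\<And>x. x \<in> ball x0 r \<Longrightarrow> at_point (U 0) x = v"
  shows "\<exists>t x. 0 \<le> t \<and> ereal t < T \<and> x \<in> \<Omega> \<and> ap (U t $ i) x < 0"
proof (rule ccontr)
  assume contra: "\<not> ?thesis"
  have T: "0 < T" and Uc: "continuous_on {t. 0 \<le> t \<and> ereal t < T} U"
    and mild: "\<And>t. 0 \<le> t \<Longrightarrow> ereal t < T \<Longrightarrow> mild_at U t"
    using sol by (auto simp: mild_solution_iff)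
  have UC: "U t \<in> C0n" if "0 \<le> t" "ereal t < T" for t
    using mild[OF that] by (simp add: mild_at_def C0n_def)
  \<comment> \<open>\<open>T\<close> may be infinite; a real \<open>T1\<close> below it gives a
    compact square of times for uniform continuity.\<close>
  obtain T1 :: real where T1: "T1 > 0" "ereal T1 < T"
    using ereal_dense2[OF T] by (auto simp: zero_ereal_def)
  have dom: "0 \<le> t \<and> ereal t < T" if "t \<in> {0..T1}" for t
    using that T1 by (auto intro: le_less_trans[of _ "ereal T1"])
  let ?Q = "{0..T1} \<times> {0..T1}"
  define p :: "'a \<Rightarrow> real" where "p = indicator (ball x0 r)"
  have p: "p \<in> L2 \<Omega>" unfolding p_def by (rule L2_indicator) (simp add: borel_open)
  define a where "a = ip (\<lambda>x. 1) p"
  have a: "a > 0"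
  proof -
    have "a = (\<integral>x. indicator (ball x0 r) x \<partial>leb)" by (simp add: a_def L2_inner_def p_def)
    also have "\<dots> = measure lebesgue (ball x0 r)"
      using r by (simp add: measure_restrict_space Int_absorb2 Int_absorb1)
    finally have "a = measure lebesgue (ball x0 r)" .
    moreover have "measure lebesgue (ball x0 r) > 0"
    proof (rule ccontr)
      assume "\<not> ?thesis"
      then have "measure lebesgue (ball x0 r) = 0"
        using measure_nonneg[of lebesgue "ball x0 r"] by linarith
      then have "negligible (ball x0 r)"
        using lmeasurable_ball by (simp add: negligible_iff_measure)
      then show False using open_not_negligible[OF open_ball] r(1) by (metis ball_eq_empty not_less)
    qed
    ultimately show ?thesis by (simp only:)
  qed
  \<comment> \<open>The first argument is the semigroup time, the second the time at which
    \<open>U\<close> is evaluated. \<open>h\<close> is jointly continuous through \<open>P\<close>.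
    The constant \<open>F 0\<close> is kept apart in \<open>k\<close>, for which right-continuity at
    0 suffices.\<close>
  define h where "h s t = ip (ap (PP i s (N i (U t)))) p" for s t
  define k where "k s = F 0 $ i * ip (S i s (\<lambda>x. 1)) p" for s
  have h0: "h 0 0 + k 0 = F v $ i * a"
  proof -
    have "h 0 0 + k 0 = ip (\<lambda>x. F (at_point (U 0) x) $ i) p"
      using F_at_point_split[OF UC, of 0 0 p i] T p hs.S_0
      by (simp add: h_def k_def zero_ereal_def)
    also have "\<dots> = (\<integral>x. (F v $ i) * (1 * p x) \<partial>leb)"
      unfolding L2_inner_def using U0(2) by (intro Bochner_Integration.integral_cong) (auto simp: p_def indicator_def)
    also have "\<dots> = F v $ i * a" by (simp add: a_def L2_inner_def)
    finally show ?thesis .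
  qed
  \<comment> \<open>Thus \<open>h 0 0 + k 0 = - 2 * e\<close>; an error of \<open>e / 2\<close> in
    each of \<open>h\<close> and \<open>k\<close> leaves at most \<open>- e\<close>.\<close>
  define e where "e = - (F v $ i * a) / 2"
  have e: "e > 0" using v a by (simp add: e_def mult_neg_pos)
  have "((\<lambda>s. ip (S i s (\<lambda>x. 1)) p) \<longlongrightarrow> ip (\<lambda>x. 1) p) (at_right 0)"
    by (rule tendsto_ip[OF hs.S_right_continuous_0[OF L2_const] _ L2_const p])
      (auto simp: eventually_at_filter hs.S_L2 L2_const)
  then have "(k \<longlongrightarrow> k 0) (at_right 0)"
    unfolding k_def hs.S_0[OF L2_const p] by (intro tendsto_intros)
  then have "\<forall>\<^sub>F s in at_right 0. dist (k s) (k 0) < e / 2" using e by (intro tendstoD) auto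
  then obtain d1 where d1: "d1 > 0" "\<And>s. 0 < s \<Longrightarrow> s < d1 \<Longrightarrow> dist (k s) (k 0) < e / 2"
    unfolding eventually_at_right_field by auto
  have kd: "\<bar>k s - k 0\<bar> < e / 2" if "0 \<le> s" "s < d1" for s
    using d1(2)[of s] that e by (cases "s = 0") (auto simp: dist_real_def)
  have "continuous_on (?Q) (\<lambda>z. h (fst z) (snd z))"
    unfolding h_def
  proof (intro bounded_linear.continuous_on[OF bounded_linear_ip[OF p]] hs.continuous_on_P)
    show "continuous_on (?Q) (\<lambda>z. N i (U (snd z)))"
    proof (rule continuous_on_compose2[OF N_continuous[of UNIV]])
      show "continuous_on (?Q) (\<lambda>z. U (snd z))"
        by (rule continuous_on_compose2[OF Uc]) (use dom in \<open>auto intro!: continuous_intros\<close>)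
    qed simp
    show "N i (U (snd z)) \<in> C0 \<Omega>" if "z \<in> ?Q" for z
    proof -
      have "snd z \<in> {0..T1}" using that by auto
      from dom[OF this] show ?thesis by (intro N_C0 UC) simp_all
    qed
  qed (auto intro: continuous_intros)
  then have "uniformly_continuous_on (?Q) (\<lambda>z. h (fst z) (snd z))"
    by (rule compact_uniformly_continuous) (intro compact_Times compact_Icc)
  then obtain d2 where d2: "d2 > 0" "\<And>z z'. z \<in> ?Q \<Longrightarrow> z' \<in> ?Q \<Longrightarrow>
      dist z' z < d2 \<Longrightarrow> dist (h (fst z') (snd z')) (h (fst z) (snd z)) < e / 2"
    by (rule uniformly_continuous_onE[OF _ half_gt_zero[OF e]]) (rule that)
  have hd: "\<bar>h s t - h 0 0\<bar> < e / 2" if "s \<in> {0..T1}" "t \<in> {0..T1}" "s < d2 / 2" "t < d2 / 2" for s t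
  proof -
    have "dist (s, t) (0, 0) \<le> \<bar>s\<bar> + \<bar>t\<bar>"
      using norm_Pair_le[of s t] by (simp add: dist_norm)
    also have "\<dots> < d2" using that by auto
    finally show ?thesis
      using d2(2)[of "(0, 0)" "(s, t)"] that T1 by (simp add: dist_real_def)
  qed
  \<comment> \<open>\<open>d1 / 2\<close> and \<open>d2 / 3\<close> give the strict inequalities of
    \<open>kd\<close> and \<open>hd\<close>. In \<open>hd\<close> both arguments stay below
    \<open>d2 / 2\<close> because the distance in the product is bounded by their sum.\<close>
  define t where "t = min T1 (min (d1 / 2) (d2 / 3))"
  have t: "0 < t" "t \<le> T1" "t < d1" "t < d2 / 2" using T1 d1 d2 by (auto simp: t_def)
  have tT: "0 \<le> t" "ereal t < T" using dom[of t] t by auto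
  obtain w where w: "has_L2_integral \<Omega> (\<lambda>s. S i (t - s) (\<lambda>x. F (at_point (U s) x) $ i)) 0 t w"
    "L2_eq \<Omega> (ap (U t $ i)) (\<lambda>x. S i t (ap (U 0 $ i)) x + w x)"
    using mild[OF tT, unfolded mild_at_def, THEN spec, of i] by (elim conjE exE) (rule that)
  have wL: "w \<in> L2 \<Omega>" using w(1) by (simp add: has_L2_integral_def)
  have "ip (ap (U t $ i)) p = ip (\<lambda>x. S i t (ap (U 0 $ i)) x + w x) p"
    by (intro ip_cong_AE w L2_bcontfun L2_add hs.S_L2 tT wL p)
  also have "\<dots> = ip (S i t (ap (U 0 $ i))) p + ip w p"
    by (intro ip_add hs.S_L2 L2_bcontfun tT wL p)
  \<comment> \<open>Linearity with both coefficients 0 expresses that \<open>S i t\<close> maps the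
    zero function to zero.\<close>
  also have "ip (S i t (ap (U 0 $ i))) p = 0"
    using hs.S_lin[OF tT(1) L2_const L2_const p, where i = i and a = 0 and b = 0] U0(1) by simp
  finally have ipw: "ip (ap (U t $ i)) p = ip w p" by simp
  have "0 \<le> ip (ap (U t $ i)) p"
    unfolding L2_inner_def using contra tT
    by (intro integral_nonneg_AE AE_I2) (auto simp: p_def indicator_def not_less)
  moreover have "ip w p \<le> integral {0..t} (\<lambda>s. - e)"
  proof (rule has_integral_le)
    show "((\<lambda>s. ip (S i (t - s) (\<lambda>x. F (at_point (U s) x) $ i)) p) has_integral ip w p) {0..t}"
      using w(1) p by (simp add: has_L2_integral_def)
    show "((\<lambda>s. - e) has_integral integral {0..t} (\<lambda>s. - e)) {0..t}"
      by (rule integrable_integral[OF integrable_const_ivl])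
    fix s assume s: "s \<in> {0..t}"
    then have sT: "0 \<le> s" "ereal s < T" using dom[of s] t by auto
    have "ip (S i (t - s) (\<lambda>x. F (at_point (U s) x) $ i)) p = h (t - s) s + k (t - s)"
      using F_at_point_split(2)[OF UC[OF sT] _ p, of "t - s" i] s by (simp add: h_def k_def)
    also have "\<dots> \<le> (h 0 0 + e / 2) + (k 0 + e / 2)"
    proof -
      have "\<bar>h (t - s) s - h 0 0\<bar> < e / 2" by (rule hd) (use s t in auto)
      moreover have "\<bar>k (t - s) - k 0\<bar> < e / 2" by (rule kd) (use s t in auto)
      ultimately show ?thesis by linarith
    qed
    also have "\<dots> = - e" using h0 by (simp add: e_def)
    finally show "ip (S i (t - s) (\<lambda>x. F (at_point (U s) x) $ i)) p \<le> - e" .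
  qed
  moreover have "integral {0..t} (\<lambda>s. - e) < 0" using t(1) e by simp
  ultimately show False using ipw by simp
qed

end

theorem theorem5p2:
  fixes \<Omega> :: "(real ^ 'd) set"
    and \<kappa> :: "'n::finite \<Rightarrow> real"
    and F :: "real ^ 'n \<Rightarrow> real ^ 'n"
    and S :: "'n \<Rightarrow> real \<Rightarrow> (real ^ 'd \<Rightarrow> real) \<Rightarrow> real ^ 'd \<Rightarrow> real"
  assumes "\<Omega> \<noteq> {}" and "open \<Omega>" and "bounded \<Omega>" and "connected \<Omega>" and "C2_boundary \<Omega>"
    and "\<And>i. \<kappa> i > 0"
    and "\<And>i. dirichlet_heat_semigroup \<Omega> (\<kappa> i) (S i)"
    and "locally_lipschitz F"
    and "\<And>U0 T U. (\<forall>i. U0 $ i \<in> C0 \<Omega>) \<Longrightarrow>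
           (\<forall>x\<in>\<Omega>. \<forall>i. apply_bcontfun (U0 $ i) x \<ge> 0) \<Longrightarrow>
           maximal_solution \<Omega> S F U0 T U \<Longrightarrow>
           (\<forall>t x i. 0 \<le> t \<and> ereal t < T \<and> x \<in> \<Omega> \<longrightarrow> apply_bcontfun (U t $ i) x \<ge> 0)"
  shows "\<forall>i. \<forall>v :: real ^ 'n. v $ i = 0 \<and> (\<forall>j. j \<noteq> i \<longrightarrow> v $ j \<ge> 0) \<longrightarrow> F v $ i \<ge> 0"
proof (intro allI impI)
  fix i and v :: "real ^ 'n"
  assume v: "v $ i = 0 \<and> (\<forall>j. j \<noteq> i \<longrightarrow> v $ j \<ge> 0)"
  interpret reaction_diffusion \<Omega> \<kappa> S F
  proof (intro reaction_diffusion.intro reaction_diffusion_axioms.intro)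
    show dom: "bounded_domain \<Omega>"
      using assms(2,3) by (rule bounded_domain.intro)
    show "heat_semigroup \<Omega> (\<kappa> i) (S i)" for i
      using dom assms(6,7) by (intro heat_semigroup.intro heat_semigroup_axioms.intro)
  qed (rule assms)+
  show "F v $ i \<ge> 0"
  proof (rule ccontr)
    assume "\<not> F v $ i \<ge> 0"
    then have neg: "F v $ i < 0" by simp
    have v0: "v $ j \<ge> 0" for j using v by (cases "j = i") auto
    obtain x0 where "x0 \<in> \<Omega>" using assms(1) by blast
    then obtain r where r: "r > 0" "ball x0 r \<subseteq> \<Omega>"
      using assms(2) open_contains_ball by blast
    \<comment> \<open>A truncated tent: 1 up to distance \<open>r / 2\<close> from
      \<open>x0\<close>, and 0 from distance \<open>r\<close> onward. Multiplied by the nonnegative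
      vector \<open>v\<close>, it gives admissible initial data that equal \<open>v\<close> near
      \<open>x0\<close>.\<close>
    define c where "c x = max 0 (min 1 (2 - 2 * dist x0 x / r))" for x
    have cb: "c \<in> bcontfun"
      by (rule bcontfun_normI[of _ 1]) (use r(1) in \<open>auto simp: c_def intro!: continuous_intros\<close>)
    define U0 :: "((real ^ 'd) \<Rightarrow>\<^sub>C real) ^ 'n" where "U0 = (\<chi> j. v $ j *\<^sub>R Bcontfun c)"
    have U0_apply: "ap (U0 $ j) x = v $ j * c x" for j x
      by (simp add: U0_def apply_Bcontfun cb)
    have "c x = 0" if "x \<notin> \<Omega>" for x
    proof -
      have "dist x0 x \<ge> r" using that r(2) by (meson mem_ball not_less subsetD)
      then show ?thesis using r(1) by (simp add: c_def field_simps)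
    qed
    then have U0: "U0 \<in> C0n"
      by (simp add: C0n_def C0_iff[OF open_dom] U0_apply)
    obtain T U where sol: "maximal_solution \<Omega> S F U0 T U"
      using maximal_solution_exists[OF U0] by blast
    then have mild: "mild_solution \<Omega> S F T U" and init: "U 0 = U0"
      by (auto simp: maximal_solution_def)
    have "at_point (U 0) x = v" if "x \<in> ball x0 (r / 2)" for x
    proof -
      have "c x = 1" using that r(1) by (simp add: c_def field_simps)
      then show ?thesis by (simp add: init at_point_def U0_apply vec_eq_iff)
    qed
    moreover have "U 0 $ i = 0"
      using v by (simp add: init U0_def)
    moreover have "ball x0 (r / 2) \<subseteq> \<Omega>"
      using r subset_ball[of "r / 2" r x0] by auto
    ultimately obtain t x where "0 \<le> t" "ereal t < T" "x \<in> \<Omega>" "ap (U t $ i) x < 0"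
      using negative_component[OF mild neg, of "r / 2" x0] r(1) by auto
    moreover have "\<forall>i. U0 $ i \<in> C0 \<Omega>" using U0 by (simp add: C0n_def)
    moreover have "\<forall>x\<in>\<Omega>. \<forall>i. ap (U0 $ i) x \<ge> 0"
      using v0 by (simp add: U0_apply c_def)
    ultimately show False
      using assms(9)[OF _ _ sol] by (meson not_le)
  qed
qed

end
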